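(* Let $(S,\mathfrak{m},k)$ and $(T,\mathfrak{n},k)$ be local rings with common residue field $k$, with $S\neq k\neq T$, and let $R=S\times_k T$ be their fiber product over $k$. Let $M$ and $N$ be finitely generated $R$-modules. Assume that neither $S$ nor $T$ is a discrete valuation domain. If $\operatorname{Tor}_m^R(M,N)=0$ for some $m\geq 6$, then $\operatorname{pd}_R M\leq 1$ or $\operatorname{pd}_R N\leq 1$, and therefore $\operatorname{Tor}_i^R(M,N)=0$ for all $i\geq 2$.
   Context: A local ring is a commutative Noetherian ring with a unique maximal ideal. With $\pi_S:S\to k$ and $\pi_T:T\to k$ the natural surjections onto the common residue field, the fiber product is the subring $R=S\times_k T=\{(s,t)\in S\times T : \pi_S(s)=\pi_T(t)\}$ of $S\times T$; it is a local ring with maximal ideal $\mathfrak{m}\times\mathfrak{n}$. $\operatorname{pd}_R$ denotes projective dimension over $R$. *)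

theory Defs
  imports "HOL-Algebra.Algebra" "HOL-Library.Extended_Nat"
begin

section \<open>Local rings and fiber products\<close>

definition local_ring :: "('a, 'x) ring_scheme \<Rightarrow> bool" where
  "local_ring R \<longleftrightarrow> cring R \<and> noetherian_ring R \<and> (\<exists>!I. maximalideal I R)"

text \<open>A discrete valuation domain is a local principal ideal domain that is not a field.\<close>

definition discrete_valuation_domain :: "('a, 'x) ring_scheme \<Rightarrow> bool" where
  "discrete_valuation_domain R \<longleftrightarrow> principal_domain R \<and> local_ring R \<and> \<not> field R"

definition fiber_product ::
  "('s, 'x) ring_scheme \<Rightarrow> ('t, 'y) ring_scheme \<Rightarrow> ('s \<Rightarrow> 'k) \<Rightarrow> ('t \<Rightarrow> 'k) \<Rightarrow> ('s \<times> 't) ring" where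
  "fiber_product S T f g =
     RDirProd S T \<lparr>carrier := {(s, t). s \<in> carrier S \<and> t \<in> carrier T \<and> f s = g t}\<rparr>"


section \<open>Modules\<close>

definition mod_hom ::
  "('r, 'x) ring_scheme \<Rightarrow> ('r, 'a, 'y) module_scheme \<Rightarrow> ('r, 'b, 'z) module_scheme \<Rightarrow> ('a \<Rightarrow> 'b) set" where
  "mod_hom R M N = {f \<in> carrier M \<rightarrow> carrier N.
     (\<forall>x\<in>carrier M. \<forall>y\<in>carrier M. f (x \<oplus>\<^bsub>M\<^esub> y) = f x \<oplus>\<^bsub>N\<^esub> f y) \<and>
     (\<forall>r\<in>carrier R. \<forall>x\<in>carrier M. f (r \<odot>\<^bsub>M\<^esub> x) = r \<odot>\<^bsub>N\<^esub> f x)}"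

definition fin_gen :: "('r, 'x) ring_scheme \<Rightarrow> ('r, 'a, 'y) module_scheme \<Rightarrow> bool" where
  "fin_gen R M \<longleftrightarrow> (\<exists>A. finite A \<and> A \<subseteq> carrier M \<and>
     (\<forall>U. submodule U R M \<and> A \<subseteq> U \<longrightarrow> U = carrier M))"

text \<open>The free module on a set \<open>B\<close>: finitely supported functions \<open>B \<rightarrow> R\<close>, extended by zero outside \<open>B\<close>.
  The ring fields \<open>mult\<close> and \<open>one\<close> of a module record carry no meaning.\<close>

definition free_module :: "('r, 'x) ring_scheme \<Rightarrow> 'p set \<Rightarrow> ('r, 'p \<Rightarrow> 'r) module" where
  "free_module R B =
     \<lparr>carrier = {f. f \<in> B \<rightarrow> carrier R \<and> (\<forall>x. x \<notin> B \<longrightarrow> f x = \<zero>\<^bsub>R\<^esub>) \<and> finite {x. f x \<noteq> \<zero>\<^bsub>R\<^esub>}},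
      monoid.mult = undefined, one = undefined,
      ring.zero = (\<lambda>_. \<zero>\<^bsub>R\<^esub>), add = (\<lambda>f g x. f x \<oplus>\<^bsub>R\<^esub> g x),
      smult = (\<lambda>r f x. r \<otimes>\<^bsub>R\<^esub> f x)\<rparr>"

text \<open>A module is projective iff it is a direct summand of a free module. Letting the basis \<open>B\<close> range
  over the subsets of the type of \<open>P\<close> loses nothing: a projective \<open>P\<close> is a direct summand of the
  free module on the set \<open>carrier P\<close>.\<close>

definition projective_module :: "('r, 'x) ring_scheme \<Rightarrow> ('r, 'p, 'y) module_scheme \<Rightarrow> bool" where
  "projective_module R P \<longleftrightarrow> module R P \<and>
     (\<exists>(B :: 'p set) i p. i \<in> mod_hom R P (free_module R B) \<and> p \<in> mod_hom R (free_module R B) P \<and>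
        (\<forall>x\<in>carrier P. p (i x) = x))"


section \<open>Projective resolutions and projective dimension\<close>

text \<open>The complex \<open>\<dots> \<rightarrow> P 2 \<rightarrow> P 1 \<rightarrow> P 0 \<rightarrow> M \<rightarrow> 0\<close> with differentials \<open>d n : P (n + 1) \<rightarrow> P n\<close> and
  augmentation \<open>e : P 0 \<rightarrow> M\<close> is exact.\<close>

definition projective_resolution ::
  "('r, 'x) ring_scheme \<Rightarrow> ('r, 'm, 'y) module_scheme \<Rightarrow>
   (nat \<Rightarrow> ('r, 'p) module) \<Rightarrow> (nat \<Rightarrow> 'p \<Rightarrow> 'p) \<Rightarrow> ('p \<Rightarrow> 'm) \<Rightarrow> bool" where
  "projective_resolution R M P d e \<longleftrightarrow>
     (\<forall>n. projective_module R (P n)) \<and>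
     (\<forall>n. d n \<in> mod_hom R (P (Suc n)) (P n)) \<and>
     e \<in> mod_hom R (P 0) M \<and>
     e ` carrier (P 0) = carrier M \<and>
     d 0 ` carrier (P 1) = {x \<in> carrier (P 0). e x = \<zero>\<^bsub>M\<^esub>} \<and>
     (\<forall>n. d (Suc n) ` carrier (P (Suc (Suc n))) = {x \<in> carrier (P (Suc n)). d n x = \<zero>\<^bsub>P n\<^esub>})"

text \<open>Resolutions of \<open>M\<close> are taken with elements in the infinite type \<open>('r + 'm) list\<close>. Every
  \<open>R\<close>-module \<open>M\<close> has a free resolution by modules of cardinality at most \<open>max |R| |M| \<aleph>\<^sub>0\<close>, and the
  syzygies of that resolution decide whether the projective dimension is at most \<open>n\<close>; up to
  isomorphism all these modules live in this type. So neither the projective dimension nor Tor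
  depends on this choice of type.\<close>

type_synonym ('r, 'm) res_elt = "('r + 'm) list"

definition proj_dim :: "('r, 'x) ring_scheme \<Rightarrow> ('r, 'm, 'y) module_scheme \<Rightarrow> enat" where
  "proj_dim R M = Inf {enat n | n.
     \<exists>(P :: nat \<Rightarrow> ('r, ('r, 'm) res_elt) module) d e.
       projective_resolution R M P d e \<and> (\<forall>i>n. carrier (P i) = {\<zero>\<^bsub>P i\<^esub>})}"


section \<open>Tensor products\<close>

text \<open>The tensor product over \<open>R\<close>, as an abelian group (written multiplicatively, as all groups in
  HOL-Algebra): the free abelian group on pairs modulo the bilinearity relations. Its
  \<open>R\<close>-module structure plays no role for the vanishing of Tor.\<close>

definition tensor_rels ::
  "('r, 'x) ring_scheme \<Rightarrow> ('r, 'a, 'y) module_scheme \<Rightarrow> ('r, 'b, 'z) module_scheme \<Rightarrow> ('a \<times> 'b \<Rightarrow>\<^sub>0 int) set" where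
  "tensor_rels R M N = generate (free_Abelian_group (carrier M \<times> carrier N))
     ({frag_of (x \<oplus>\<^bsub>M\<^esub> x', y) - frag_of (x, y) - frag_of (x', y) | x x' y.
         x \<in> carrier M \<and> x' \<in> carrier M \<and> y \<in> carrier N} \<union>
      {frag_of (x, y \<oplus>\<^bsub>N\<^esub> y') - frag_of (x, y) - frag_of (x, y') | x y y'.
         x \<in> carrier M \<and> y \<in> carrier N \<and> y' \<in> carrier N} \<union>
      {frag_of (r \<odot>\<^bsub>M\<^esub> x, y) - frag_of (x, r \<odot>\<^bsub>N\<^esub> y) | r x y.
         r \<in> carrier R \<and> x \<in> carrier M \<and> y \<in> carrier N})"

definition tensor ::
  "('r, 'x) ring_scheme \<Rightarrow> ('r, 'a, 'y) module_scheme \<Rightarrow> ('r, 'b, 'z) module_scheme \<Rightarrow>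
   ('a \<times> 'b \<Rightarrow>\<^sub>0 int) set monoid" where
  "tensor R M N = free_Abelian_group (carrier M \<times> carrier N) Mod tensor_rels R M N"

text \<open>The map \<open>f \<otimes> id : M \<otimes> N \<rightarrow> M' \<otimes> N\<close> induced by a homomorphism \<open>f : M \<rightarrow> M'\<close>; all
  representatives of a class \<open>C\<close> have the same image, so that the image below is a singleton.\<close>

definition tensor_map ::
  "('r, 'x) ring_scheme \<Rightarrow> ('r, 'a, 'y) module_scheme \<Rightarrow> ('r, 'b, 'z) module_scheme \<Rightarrow>
   ('a \<Rightarrow> 'b) \<Rightarrow> ('r, 'c, 'w) module_scheme \<Rightarrow> ('a \<times> 'c \<Rightarrow>\<^sub>0 int) set \<Rightarrow> ('b \<times> 'c \<Rightarrow>\<^sub>0 int) set" where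
  "tensor_map R M M' f N C = the_elem
     ((\<lambda>c. tensor_rels R M' N #>\<^bsub>free_Abelian_group (carrier M' \<times> carrier N)\<^esub>
             frag_extend (\<lambda>(x, y). frag_of (f x, y)) c) ` C)"


section \<open>Tor\<close>

definition tensor_cycles ::
  "('r, 'x) ring_scheme \<Rightarrow> (nat \<Rightarrow> ('r, 'p) module) \<Rightarrow> (nat \<Rightarrow> 'p \<Rightarrow> 'p) \<Rightarrow>
   ('r, 'n, 'z) module_scheme \<Rightarrow> nat \<Rightarrow> ('p \<times> 'n \<Rightarrow>\<^sub>0 int) set set" where
  "tensor_cycles R P d N n = (case n of
       0 \<Rightarrow> carrier (tensor R (P 0) N)
     | Suc j \<Rightarrow> kernel (tensor R (P (Suc j)) N) (tensor R (P j) N)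
                  (tensor_map R (P (Suc j)) (P j) (d j) N))"

definition tensor_homology ::
  "('r, 'x) ring_scheme \<Rightarrow> (nat \<Rightarrow> ('r, 'p) module) \<Rightarrow> (nat \<Rightarrow> 'p \<Rightarrow> 'p) \<Rightarrow>
   ('r, 'n, 'z) module_scheme \<Rightarrow> nat \<Rightarrow> ('p \<times> 'n \<Rightarrow>\<^sub>0 int) set set monoid" where
  "tensor_homology R P d N n =
     (tensor R (P n) N) \<lparr>carrier := tensor_cycles R P d N n\<rparr> Mod
     (tensor_map R (P (Suc n)) (P n) (d n) N ` carrier (tensor R (P (Suc n)) N))"

definition chosen_resolution ::
  "('r, 'x) ring_scheme \<Rightarrow> ('r, 'm, 'y) module_scheme \<Rightarrow>
   (nat \<Rightarrow> ('r, ('r, 'm) res_elt) module) \<times> (nat \<Rightarrow> ('r, 'm) res_elt \<Rightarrow> ('r, 'm) res_elt)" where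
  "chosen_resolution R M = (SOME (P, d). \<exists>e. projective_resolution R M P d e)"

definition Tor ::
  "('r, 'x) ring_scheme \<Rightarrow> nat \<Rightarrow> ('r, 'm, 'y) module_scheme \<Rightarrow> ('r, 'n, 'z) module_scheme \<Rightarrow>
   (('r, 'm) res_elt \<times> 'n \<Rightarrow>\<^sub>0 int) set set monoid" where
  "Tor R n M N = (case chosen_resolution R M of (P, d) \<Rightarrow> tensor_homology R P d N n)"

end

theory Submission
  imports Defs
begin

text \<open>The maximal ideal of \<open>R\<close> is \<open>I \<oplus> J\<close> with \<open>I = \<mm> \<times> 0\<close> and \<open>J = 0 \<times> \<nn>\<close>, and \<open>I J = 0\<close>. Hence a relation
  \<open>\<Sum> r\<^sub>j k\<^sub>j = 0\<close> with all \<open>r\<^sub>j\<close> nonunits splits into its \<open>I\<close>-part and its \<open>J\<close>-part, so the second syzygy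
  \<open>U\<close> of \<open>N\<close> is a direct sum of a module killed by \<open>J\<close> and one killed by \<open>I\<close>. If \<open>0 \<noteq> A \<subseteq> I\<^sup>q\<close>, then
  the first syzygy of \<open>A\<close> has \<open>J\<close> as a direct summand, so \<open>Tor\<^sub>i\<^sub>+\<^sub>1(M, A) = 0\<close> implies \<open>Tor\<^sub>i(M, J) = 0\<close>, and
  likewise with \<open>I\<close> and \<open>J\<close> exchanged. If \<open>U \<noteq> 0\<close>, then \<open>Tor\<^sub>m(M, N) = 0\<close> thus leads down to
  \<open>Tor\<^sub>3(M, I) = 0\<close> or \<open>Tor\<^sub>3(M, J) = 0\<close>, say the former. As \<open>S\<close> is not a discrete valuation domain, the
  syzygy of \<open>I\<close> contains besides copies of \<open>J\<close> a nonzero summand inside a power of \<open>I\<close>, which gives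
  \<open>Tor\<^sub>1(M, J) = 0\<close>; the way through \<open>J\<close> gives \<open>Tor\<^sub>1(M, I) = 0\<close>. Then \<open>Tor\<^sub>2(M, k) = 0\<close>, so the second
  syzygy of \<open>M\<close> vanishes by Nakayama's lemma.

  All dimension shifts take place in the second argument, which is always presented as \<open>R\<^sup>q/K\<close>; an
  element of \<open>P \<otimes> R\<^sup>q/K\<close> is a \<open>q\<close>-tuple over \<open>P\<close> modulo \<open>P K\<close>. Going down to \<open>Tor\<^sub>1\<close>, which does not mention
  the resolution any more, shows that the vanishing is independent of the resolution of \<open>M\<close>.\<close>

section \<open>Tuples over a module and linear relations\<close>

text \<open>Why the second syzygy: a vanishing combination of vectors of R^q splits because its two
  parts lie in I R^q and J R^q, which meet in 0, whereas I N and J N may meet. So the relations must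
  be taken between elements of a free module, and only these elements have to be minimal generators;
  the given generators of \<open>M\<close> and \<open>N\<close> are arbitrary. The bound 6 is a
  count of degrees: 2 for the second syzygy of \<open>N\<close>, 1 for reaching Tor of I or J, 2 for
  passing from one ideal to both, and 1 because the final input is the vanishing of Tor_1.
  \<open>Tor\<close> is computed from a resolution picked by choice, of which only projectivity is
  known, while Nakayama's lemma needs finitely generated syzygies with minimal generators. Hence the
  vanishing has to travel from the chosen resolution of \<open>M\<close> to a minimal one and, for
  the last claim, back. Keeping every syzygy as a set of functions from \<open>nat\<close> to the
  elements of \<open>R\<close> gives all of them one type, so that an induction on the degree can
  range over them.\<close>

definition self_module :: "('r, 'x) ring_scheme \<Rightarrow> ('r, 'r) module" where
  "self_module R = \<lparr>carrier = carrier R, monoid.mult = monoid.mult R, one = one R,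
     ring.zero = ring.zero R, add = add R, smult = monoid.mult R\<rparr>"

text \<open>Tuples of length \<open>q\<close> are functions that vanish from \<open>q\<close> on, so tuples of length \<open>q\<close> are
  also tuples of any greater length.\<close>

definition tup :: "('p, 'y) ring_scheme \<Rightarrow> nat \<Rightarrow> (nat \<Rightarrow> 'p) set" where
  "tup P q = {x. (\<forall>l<q. x l \<in> carrier P) \<and> (\<forall>l\<ge>q. x l = \<zero>\<^bsub>P\<^esub>)}"

definition tup_submodule :: "('r, 'x) ring_scheme \<Rightarrow> nat \<Rightarrow> (nat \<Rightarrow> 'r) set \<Rightarrow> bool" where
  "tup_submodule R q K \<longleftrightarrow> K \<subseteq> tup R q \<and> (\<lambda>_. \<zero>\<^bsub>R\<^esub>) \<in> K \<and>
     (\<forall>x\<in>K. \<forall>y\<in>K. (\<lambda>l. x l \<oplus>\<^bsub>R\<^esub> y l) \<in> K) \<and>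
     (\<forall>r\<in>carrier R. \<forall>x\<in>K. (\<lambda>l. r \<otimes>\<^bsub>R\<^esub> x l) \<in> K)"

text \<open>A family of \<open>p\<close> vectors in \<open>R\<^sup>q\<close> is a function \<open>k\<close> where \<open>k j l\<close> is the \<open>l\<close>-th coordinate of the \<open>j\<close>-th
  vector.\<close>

definition lincomb ::
  "('r, 'p, 'y) module_scheme \<Rightarrow> (nat \<Rightarrow> nat \<Rightarrow> 'r) \<Rightarrow> nat \<Rightarrow> (nat \<Rightarrow> 'p) \<Rightarrow> nat \<Rightarrow> 'p" where
  "lincomb P k p x = (\<lambda>l. \<Oplus>\<^bsub>P\<^esub>j\<in>{..<p}. k j l \<odot>\<^bsub>P\<^esub> x j)"

definition gens ::
  "('r, 'x) ring_scheme \<Rightarrow> nat \<Rightarrow> (nat \<Rightarrow> 'r) set \<Rightarrow> (nat \<Rightarrow> nat \<Rightarrow> 'r) \<Rightarrow> nat \<Rightarrow> bool" where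
  "gens R q K k p \<longleftrightarrow> (\<forall>j<p. k j \<in> tup R q) \<and> K = lincomb (self_module R) k p ` tup R p"

definition rels :: "('r, 'x) ring_scheme \<Rightarrow> (nat \<Rightarrow> nat \<Rightarrow> 'r) \<Rightarrow> nat \<Rightarrow> (nat \<Rightarrow> 'r) set" where
  "rels R k p = {r \<in> tup R p. lincomb (self_module R) k p r = (\<lambda>_. \<zero>\<^bsub>R\<^esub>)}"

text \<open>The image of \<open>P \<otimes> K\<close> in \<open>P \<otimes> R\<^sup>q = P\<^sup>q\<close>, for \<open>K \<subseteq> R\<^sup>q\<close>.\<close>

inductive_set dot_span :: "('r, 'p, 'y) module_scheme \<Rightarrow> (nat \<Rightarrow> 'r) set \<Rightarrow> (nat \<Rightarrow> 'p) set"
  for P K where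
  zero: "(\<lambda>_. \<zero>\<^bsub>P\<^esub>) \<in> dot_span P K"
| step: "\<lbrakk>\<kappa> \<in> K; u \<in> carrier P; v \<in> dot_span P K\<rbrakk> \<Longrightarrow>
     (\<lambda>l. \<kappa> l \<odot>\<^bsub>P\<^esub> u \<oplus>\<^bsub>P\<^esub> v l) \<in> dot_span P K"

lemma self_module_simps [simp]:
  "carrier (self_module R) = carrier R" "\<zero>\<^bsub>self_module R\<^esub> = \<zero>\<^bsub>R\<^esub>"
  "x \<oplus>\<^bsub>self_module R\<^esub> y = x \<oplus>\<^bsub>R\<^esub> y" "x \<odot>\<^bsub>self_module R\<^esub> y = x \<otimes>\<^bsub>R\<^esub> y"
  by (simp_all add: self_module_def)

lemma tup_self_module [simp]: "tup (self_module R) q = tup R q"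
  by (simp add: tup_def)

lemma (in cring) tupE: "x \<in> tup R q \<Longrightarrow> x l \<in> carrier R"
  by (cases "l < q") (auto simp: tup_def)

lemma (in cring) self_module: "module R (self_module R)"
proof (rule moduleI)
  show "abelian_group (self_module R)"
    by (rule abelian_groupI) (auto simp: a_assoc intro: a_comm l_neg bexI[of _ "\<ominus> _"])
qed (auto simp: cring_axioms l_distr r_distr m_assoc)

context module begin

lemma neg_zero: "\<ominus>\<^bsub>M\<^esub> \<zero>\<^bsub>M\<^esub> = \<zero>\<^bsub>M\<^esub>"
  using M.r_neg[of "\<zero>\<^bsub>M\<^esub>"] M.l_zero[of "\<ominus>\<^bsub>M\<^esub> \<zero>\<^bsub>M\<^esub>"] by simp

lemma tupD: "x \<in> tup M q \<Longrightarrow> x l \<in> carrier M"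
  by (cases "l < q") (auto simp: tup_def)

lemma tup_ge: "x \<in> tup M q \<Longrightarrow> q \<le> l \<Longrightarrow> x l = \<zero>\<^bsub>M\<^esub>"
  by (auto simp: tup_def)

lemma tup_zero [simp]: "(\<lambda>_. \<zero>\<^bsub>M\<^esub>) \<in> tup M q"
  by (auto simp: tup_def)

lemma tup_add: "x \<in> tup M q \<Longrightarrow> y \<in> tup M q \<Longrightarrow> (\<lambda>l. x l \<oplus>\<^bsub>M\<^esub> y l) \<in> tup M q"
  by (auto simp: tup_def)

lemma tup_neg: "x \<in> tup M q \<Longrightarrow> (\<lambda>l. \<ominus>\<^bsub>M\<^esub> x l) \<in> tup M q"
  by (auto simp: tup_def)

lemma tup_diff: "x \<in> tup M q \<Longrightarrow> y \<in> tup M q \<Longrightarrow> (\<lambda>l. x l \<ominus>\<^bsub>M\<^esub> y l) \<in> tup M q"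
  by (auto simp: tup_def a_minus_def)

lemma tup_smult: "\<kappa> \<in> tup R q \<Longrightarrow> u \<in> carrier M \<Longrightarrow> (\<lambda>l. \<kappa> l \<odot>\<^bsub>M\<^esub> u) \<in> tup M q"
  by (auto simp: tup_def)

lemma dot_span_tup: "v \<in> dot_span M K \<Longrightarrow> K \<subseteq> tup R q \<Longrightarrow> v \<in> tup M q"
  by (induction rule: dot_span.induct) (auto intro!: tup_add tup_smult)

lemma dot_span_mono: "v \<in> dot_span M K \<Longrightarrow> K \<subseteq> K' \<Longrightarrow> v \<in> dot_span M K'"
  by (induction rule: dot_span.induct) (auto intro: dot_span.intros)

lemma dot_span_add:
  assumes "v \<in> dot_span M K" "w \<in> dot_span M K" "K \<subseteq> tup R q"
  shows "(\<lambda>l. v l \<oplus>\<^bsub>M\<^esub> w l) \<in> dot_span M K"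
  using assms(1)
proof induction
  case zero
  have "(\<lambda>l. \<zero>\<^bsub>M\<^esub> \<oplus>\<^bsub>M\<^esub> w l) = w"
    using tupD[OF dot_span_tup[OF assms(2,3)]] by auto
  then show ?case using assms(2) by simp
next
  case (step \<kappa> u v)
  have "(\<lambda>l. (\<kappa> l \<odot>\<^bsub>M\<^esub> u \<oplus>\<^bsub>M\<^esub> v l) \<oplus>\<^bsub>M\<^esub> w l) = (\<lambda>l. \<kappa> l \<odot>\<^bsub>M\<^esub> u \<oplus>\<^bsub>M\<^esub> (v l \<oplus>\<^bsub>M\<^esub> w l))"
    using step(2) tupD[OF dot_span_tup[OF assms(2,3)]] tupD[OF dot_span_tup[OF step(3) assms(3)]]
      R.tupE[OF subsetD[OF assms(3) step(1)]] by (intro ext) (simp add: M.a_assoc)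
  then show ?case using dot_span.step[OF step(1,2,4)] by simp
qed

lemma dot_span_single:
  assumes "\<kappa> \<in> K" "u \<in> carrier M" "K \<subseteq> tup R q"
  shows "(\<lambda>l. \<kappa> l \<odot>\<^bsub>M\<^esub> u) \<in> dot_span M K"
proof -
  have "(\<lambda>l. \<kappa> l \<odot>\<^bsub>M\<^esub> u \<oplus>\<^bsub>M\<^esub> \<zero>\<^bsub>M\<^esub>) = (\<lambda>l. \<kappa> l \<odot>\<^bsub>M\<^esub> u)"
    using assms(2) R.tupE[OF subsetD[OF assms(3,1)]] by (intro ext) simp
  then show ?thesis using dot_span.step[OF assms(1,2) dot_span.zero] by simp
qed

lemma dot_span_neg:
  assumes "v \<in> dot_span M K" "K \<subseteq> tup R q"
  shows "(\<lambda>l. \<ominus>\<^bsub>M\<^esub> v l) \<in> dot_span M K"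
  using assms(1)
proof induction
  case zero
  then show ?case by (simp add: dot_span.zero neg_zero)
next
  case (step \<kappa> u v)
  have "(\<lambda>l. \<ominus>\<^bsub>M\<^esub> (\<kappa> l \<odot>\<^bsub>M\<^esub> u \<oplus>\<^bsub>M\<^esub> v l)) = (\<lambda>l. \<kappa> l \<odot>\<^bsub>M\<^esub> (\<ominus>\<^bsub>M\<^esub> u) \<oplus>\<^bsub>M\<^esub> \<ominus>\<^bsub>M\<^esub> v l)"
    using step(2) tupD[OF dot_span_tup[OF step(3) assms(2)]] R.tupE[OF subsetD[OF assms(2) step(1)]]
    by (intro ext) (simp add: M.minus_add smult_r_minus)
  then show ?case using dot_span.step[of \<kappa> K "\<ominus>\<^bsub>M\<^esub> u" M, OF step(1) _ step(4)] step(2) by simp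
qed

lemma dot_span_diff:
  assumes "v \<in> dot_span M K" "w \<in> dot_span M K" "K \<subseteq> tup R q"
  shows "(\<lambda>l. v l \<ominus>\<^bsub>M\<^esub> w l) \<in> dot_span M K"
  unfolding a_minus_def using dot_span_add[OF assms(1) dot_span_neg[OF assms(2,3)] assms(3)] .

lemma dot_span_trivial: "v \<in> dot_span M {\<lambda>_. \<zero>} \<Longrightarrow> v = (\<lambda>_. \<zero>\<^bsub>M\<^esub>)"
  by (induction rule: dot_span.induct) auto

lemma dot_span_split:
  assumes "v \<in> dot_span M U" and U: "\<And>x. x \<in> U \<Longrightarrow> \<exists>a\<in>A. \<exists>b\<in>B. x = (\<lambda>l. a l \<oplus> b l)"
    and A: "A \<subseteq> tup R q" and B: "B \<subseteq> tup R q"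
  shows "\<exists>\<alpha>\<in>dot_span M A. \<exists>\<beta>\<in>dot_span M B. v = (\<lambda>l. \<alpha> l \<oplus>\<^bsub>M\<^esub> \<beta> l)"
  using assms(1)
proof induction
  case zero
  show ?case
    by (rule bexI[OF _ dot_span.zero], rule bexI[OF _ dot_span.zero]) simp
next
  case (step \<kappa> u v)
  from step(4) obtain \<alpha> \<beta> where ab: "\<alpha> \<in> dot_span M A" "\<beta> \<in> dot_span M B"
    "v = (\<lambda>l. \<alpha> l \<oplus>\<^bsub>M\<^esub> \<beta> l)" by blast
  from U[OF step(1)] obtain a b where k: "a \<in> A" "b \<in> B" "\<kappa> = (\<lambda>l. a l \<oplus> b l)" by blast
  have c: "\<alpha> l \<in> carrier M" "\<beta> l \<in> carrier M" "a l \<in> carrier R" "b l \<in> carrier R" for l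
    using tupD[OF dot_span_tup[OF ab(1) A]] tupD[OF dot_span_tup[OF ab(2) B]]
      R.tupE[of a q] R.tupE[of b q] k(1,2) A B by auto
  have "(\<lambda>l. \<kappa> l \<odot>\<^bsub>M\<^esub> u \<oplus>\<^bsub>M\<^esub> v l) = (\<lambda>l. (a l \<odot>\<^bsub>M\<^esub> u \<oplus>\<^bsub>M\<^esub> \<alpha> l) \<oplus>\<^bsub>M\<^esub> (b l \<odot>\<^bsub>M\<^esub> u \<oplus>\<^bsub>M\<^esub> \<beta> l))"
    using c step(2) by (intro ext) (simp add: ab k smult_l_distr M.a_ac)
  then show ?case
    by (intro bexI[OF _ dot_span.step[OF k(1) step(2) ab(1)]] bexI[OF _ dot_span.step[OF k(2) step(2) ab(2)]])
qed

lemma lincomb_closed: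
  assumes "\<And>j. j < p \<Longrightarrow> k j \<in> tup R q" "x \<in> tup M p"
  shows "lincomb M k p x \<in> tup M q"
  unfolding tup_def lincomb_def
proof (intro CollectI conjI allI impI)
  fix l assume "l \<ge> q"
  have "(\<Oplus>\<^bsub>M\<^esub>j\<in>{..<p}. k j l \<odot>\<^bsub>M\<^esub> x j) = (\<Oplus>\<^bsub>M\<^esub>j\<in>{..<p}. \<zero>\<^bsub>M\<^esub>)"
    using assms(1) \<open>l \<ge> q\<close> tupD[OF assms(2)] by (intro M.finsum_cong') (auto simp: tup_def)
  then show "(\<Oplus>\<^bsub>M\<^esub>j\<in>{..<p}. k j l \<odot>\<^bsub>M\<^esub> x j) = \<zero>\<^bsub>M\<^esub>" by simp
next
  fix l
  show "(\<Oplus>\<^bsub>M\<^esub>j\<in>{..<p}. k j l \<odot>\<^bsub>M\<^esub> x j) \<in> carrier M"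
    using tupD[OF assms(2)] R.tupE[OF assms(1)] by (intro M.finsum_closed) auto
qed

lemma lincomb_add:
  assumes "\<And>j. j < p \<Longrightarrow> k j \<in> tup R q" "x \<in> tup M p" "y \<in> tup M p"
  shows "lincomb M k p (\<lambda>j. x j \<oplus>\<^bsub>M\<^esub> y j) = (\<lambda>l. lincomb M k p x l \<oplus>\<^bsub>M\<^esub> lincomb M k p y l)"
proof
  fix l
  have c: "k j l \<in> carrier R" "x j \<in> carrier M" "y j \<in> carrier M" if "j < p" for j
    using R.tupE[OF assms(1)[OF that]] tupD[OF assms(2)] tupD[OF assms(3)] by auto
  have "(\<Oplus>\<^bsub>M\<^esub>j\<in>{..<p}. k j l \<odot>\<^bsub>M\<^esub> (x j \<oplus>\<^bsub>M\<^esub> y j)) = (\<Oplus>\<^bsub>M\<^esub>j\<in>{..<p}. k j l \<odot>\<^bsub>M\<^esub> x j \<oplus>\<^bsub>M\<^esub> k j l \<odot>\<^bsub>M\<^esub> y j)"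
    using c by (intro M.finsum_cong') (auto simp: smult_r_distr)
  also have "\<dots> = (\<Oplus>\<^bsub>M\<^esub>j\<in>{..<p}. k j l \<odot>\<^bsub>M\<^esub> x j) \<oplus>\<^bsub>M\<^esub> (\<Oplus>\<^bsub>M\<^esub>j\<in>{..<p}. k j l \<odot>\<^bsub>M\<^esub> y j)"
    using c by (intro M.finsum_addf) auto
  finally show "lincomb M k p (\<lambda>j. x j \<oplus>\<^bsub>M\<^esub> y j) l = lincomb M k p x l \<oplus>\<^bsub>M\<^esub> lincomb M k p y l"
    by (simp add: lincomb_def)
qed

lemma lincomb_zero [simp]:
  assumes "\<And>j. j < p \<Longrightarrow> k j \<in> tup R q"
  shows "lincomb M k p (\<lambda>_. \<zero>\<^bsub>M\<^esub>) = (\<lambda>_. \<zero>\<^bsub>M\<^esub>)"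
proof
  fix l
  have "(\<Oplus>\<^bsub>M\<^esub>j\<in>{..<p}. k j l \<odot>\<^bsub>M\<^esub> \<zero>\<^bsub>M\<^esub>) = (\<Oplus>\<^bsub>M\<^esub>j\<in>{..<p}. \<zero>\<^bsub>M\<^esub>)"
    using R.tupE[OF assms] by (intro M.finsum_cong') auto
  then show "lincomb M k p (\<lambda>_. \<zero>\<^bsub>M\<^esub>) l = \<zero>\<^bsub>M\<^esub>" by (simp add: lincomb_def)
qed

lemma lincomb_smult:
  assumes "\<And>j. j < p \<Longrightarrow> k j \<in> tup R q" "x \<in> tup M p" "r \<in> carrier R"
  shows "lincomb M k p (\<lambda>j. r \<odot>\<^bsub>M\<^esub> x j) = (\<lambda>l. r \<odot>\<^bsub>M\<^esub> lincomb M k p x l)"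
proof
  fix l
  have c: "k j l \<in> carrier R" "x j \<in> carrier M" if "j < p" for j
    using R.tupE[OF assms(1)[OF that]] tupD[OF assms(2)] by auto
  have "(\<Oplus>\<^bsub>M\<^esub>j\<in>{..<p}. k j l \<odot>\<^bsub>M\<^esub> (r \<odot>\<^bsub>M\<^esub> x j)) = (\<Oplus>\<^bsub>M\<^esub>j\<in>{..<p}. r \<odot>\<^bsub>M\<^esub> (k j l \<odot>\<^bsub>M\<^esub> x j))"
    using c assms(3) by (intro M.finsum_cong') (auto simp: smult_assoc1[symmetric] R.m_comm)
  also have "\<dots> = r \<odot>\<^bsub>M\<^esub> (\<Oplus>\<^bsub>M\<^esub>j\<in>{..<p}. k j l \<odot>\<^bsub>M\<^esub> x j)"
    using c assms(3) by (intro finsum_smult_ldistr[symmetric]) auto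
  finally show "lincomb M k p (\<lambda>j. r \<odot>\<^bsub>M\<^esub> x j) l = r \<odot>\<^bsub>M\<^esub> lincomb M k p x l"
    by (simp add: lincomb_def)
qed

lemma lincomb_neg:
  assumes "\<And>j. j < p \<Longrightarrow> k j \<in> tup R q" "x \<in> tup M p"
  shows "lincomb M k p (\<lambda>j. \<ominus>\<^bsub>M\<^esub> x j) = (\<lambda>l. \<ominus>\<^bsub>M\<^esub> lincomb M k p x l)"
proof -
  have *: "(\<ominus> \<one>) \<odot>\<^bsub>M\<^esub> z = \<ominus>\<^bsub>M\<^esub> z" if "z \<in> carrier M" for z
    using that by (simp add: smult_l_minus)
  have "lincomb M k p (\<lambda>j. (\<ominus> \<one>) \<odot>\<^bsub>M\<^esub> x j) = (\<lambda>l. (\<ominus> \<one>) \<odot>\<^bsub>M\<^esub> lincomb M k p x l)"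
    using assms by (intro lincomb_smult) auto
  moreover have "x j \<in> carrier M" "lincomb M k p x l \<in> carrier M" for j l
    using tupD[OF assms(2)] tupD[OF lincomb_closed[OF assms]] by auto
  ultimately show ?thesis by (simp add: *)
qed

lemma lincomb_diff:
  assumes "\<And>j. j < p \<Longrightarrow> k j \<in> tup R q" "x \<in> tup M p" "y \<in> tup M p"
  shows "lincomb M k p (\<lambda>j. x j \<ominus>\<^bsub>M\<^esub> y j) = (\<lambda>l. lincomb M k p x l \<ominus>\<^bsub>M\<^esub> lincomb M k p y l)"
  unfolding a_minus_def
  using lincomb_add[OF assms(1,2) tup_neg[OF assms(3)]] lincomb_neg[OF assms(1,3)] by simp

text \<open>Both sides are sums of the same products; the scalar \<open>r j\<close> is grouped with
  \<open>u\<close> on the left and with \<open>k j l\<close> on the right. This is the bridge from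
  relations over \<open>R\<close> to relations with entries in a module.\<close>

lemma lincomb_scalar:
  assumes "\<And>j. j < p \<Longrightarrow> k j \<in> tup R q" "r \<in> tup R p" "u \<in> carrier M"
  shows "lincomb M k p (\<lambda>j. r j \<odot>\<^bsub>M\<^esub> u) = (\<lambda>l. lincomb (self_module R) k p r l \<odot>\<^bsub>M\<^esub> u)"
proof
  fix l
  interpret S: module R "self_module R" by (rule R.self_module)
  have kc: "k j l \<in> carrier R" if "j < p" for j
    using R.tupE[OF assms(1)[OF that]] .
  have rc: "r j \<in> carrier R" for j
    using R.tupE[OF assms(2)] .
  have "(\<Oplus>\<^bsub>M\<^esub>j\<in>{..<n}. k j l \<odot>\<^bsub>M\<^esub> (r j \<odot>\<^bsub>M\<^esub> u)) =
     (\<Oplus>\<^bsub>self_module R\<^esub>j\<in>{..<n}. k j l \<otimes> r j) \<odot>\<^bsub>M\<^esub> u" if "n \<le> p" for n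
    using that
  proof (induction n)
    case 0
    have "(\<Oplus>\<^bsub>self_module R\<^esub>j\<in>{}. k j l \<otimes> r j) = \<zero>"
      using S.M.finsum_empty by simp
    then show ?case using assms(3) by simp
  next
    case (Suc n)
    have "k j l \<in> carrier R" if "j \<le> n" for j using kc Suc.prems that by simp
    then have c: "(\<Oplus>\<^bsub>self_module R\<^esub>j\<in>{..<n}. k j l \<otimes> r j) \<in> carrier R" "k n l \<in> carrier R"
      "(\<lambda>j. k j l \<otimes> r j) \<in> {..<n} \<rightarrow> carrier R"
      "(\<lambda>j. k j l \<odot>\<^bsub>M\<^esub> (r j \<odot>\<^bsub>M\<^esub> u)) \<in> {..<n} \<rightarrow> carrier M"
      using rc assms(3) S.M.finsum_closed[of "\<lambda>j. k j l \<otimes> r j" "{..<n}"] by (auto simp: Pi_def)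
    have "(\<Oplus>\<^bsub>self_module R\<^esub>j\<in>{..<Suc n}. k j l \<otimes> r j) = k n l \<otimes> r n \<oplus> (\<Oplus>\<^bsub>self_module R\<^esub>j\<in>{..<n}. k j l \<otimes> r j)"
      using S.M.finsum_insert[of "{..<n}" n "\<lambda>j. k j l \<otimes> r j"] c rc by (simp add: lessThan_Suc)
    moreover have "(\<Oplus>\<^bsub>M\<^esub>j\<in>{..<Suc n}. k j l \<odot>\<^bsub>M\<^esub> (r j \<odot>\<^bsub>M\<^esub> u)) =
        k n l \<odot>\<^bsub>M\<^esub> (r n \<odot>\<^bsub>M\<^esub> u) \<oplus>\<^bsub>M\<^esub> (\<Oplus>\<^bsub>M\<^esub>j\<in>{..<n}. k j l \<odot>\<^bsub>M\<^esub> (r j \<odot>\<^bsub>M\<^esub> u))"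
      using M.finsum_insert[of "{..<n}" n "\<lambda>j. k j l \<odot>\<^bsub>M\<^esub> (r j \<odot>\<^bsub>M\<^esub> u)"] c rc assms(3)
      by (simp add: lessThan_Suc)
    ultimately show ?case using Suc c rc assms(3)
      by (simp add: smult_l_distr smult_assoc1)
  qed
  from this[of p] show "lincomb M k p (\<lambda>j. r j \<odot>\<^bsub>M\<^esub> u) l = lincomb (self_module R) k p r l \<odot>\<^bsub>M\<^esub> u"
    by (simp add: lincomb_def)
qed

lemma lincomb_rels:
  assumes "\<And>j. j < p \<Longrightarrow> k j \<in> tup R q" "v \<in> dot_span M (rels R k p)"
  shows "lincomb M k p v = (\<lambda>_. \<zero>\<^bsub>M\<^esub>)"
  using assms(2)
proof induction
  case zero
  then show ?case using lincomb_zero[OF assms(1)] by simp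
next
  case (step \<kappa> u v)
  have rt: "rels R k p \<subseteq> tup R p" by (auto simp: rels_def)
  have k: "\<kappa> \<in> tup R p" "lincomb (self_module R) k p \<kappa> = (\<lambda>_. \<zero>)"
    using step(1) by (auto simp: rels_def)
  show ?case
    using lincomb_add[OF assms(1) tup_smult[OF k(1) step(2)] dot_span_tup[OF step(3) rt]]
      lincomb_scalar[OF assms(1) k(1) step(2)] k(2) step by simp
qed

lemma dot_span_lincomb:
  assumes "\<And>j. j < p \<Longrightarrow> k j \<in> K" "K \<subseteq> tup R q" "x \<in> tup M p"
  shows "lincomb M k p x \<in> dot_span M K"
proof -
  have kc: "k j l \<in> carrier R" if "j < p" for j l
    using R.tupE[of "k j" q] assms(1)[OF that] assms(2) by auto
  have "lincomb M k n x \<in> dot_span M K" if "n \<le> p" for n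
    using that
  proof (induction n)
    case 0
    then show ?case by (simp add: lincomb_def dot_span.zero)
  next
    case (Suc n)
    have c: "(\<lambda>j. k j l \<odot>\<^bsub>M\<^esub> x j) \<in> {..<n} \<rightarrow> carrier M" for l
      using kc Suc.prems tupD[OF assms(3)] by auto
    have "lincomb M k (Suc n) x = (\<lambda>l. k n l \<odot>\<^bsub>M\<^esub> x n \<oplus>\<^bsub>M\<^esub> lincomb M k n x l)"
      unfolding lincomb_def lessThan_Suc
      using c kc[of n] Suc.prems tupD[OF assms(3)] by (intro ext, subst M.finsum_insert) auto
    then show ?case
      using dot_span.step[of "k n" K "x n" M "lincomb M k n x"] Suc assms(1)[of n] tupD[OF assms(3)] by simp
  qed
  then show ?thesis by simp
qed

lemma gens_mem:
  assumes "gens R q K k p" "j < p" shows "k j \<in> K"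
proof -
  interpret S: module R "self_module R" by (rule R.self_module)
  define e where "e = (\<lambda>i. if i = j then \<one> else \<zero>)"
  have k: "k i \<in> tup R q" if "i < p" for i using assms that by (simp add: gens_def)
  have e: "e \<in> tup R p" using assms(2) by (auto simp: e_def tup_def)
  have "lincomb (self_module R) k p e l = k j l" for l
  proof -
    have kc: "k i l \<in> carrier R" if "i < p" for i using R.tupE[OF k[OF that]] .
    have "(\<Oplus>\<^bsub>self_module R\<^esub>i\<in>{..<p}. k i l \<otimes> e i) = (\<Oplus>\<^bsub>self_module R\<^esub>i\<in>{..<p}. if j = i then k i l else \<zero>\<^bsub>self_module R\<^esub>)"
      using kc by (intro S.M.finsum_cong') (auto simp: e_def)
    also have "\<dots> = k j l"
      using kc assms(2) by (intro S.M.finsum_singleton) auto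
    finally show ?thesis by (simp add: lincomb_def)
  qed
  then have "lincomb (self_module R) k p e = k j" by blast
  then have "k j \<in> lincomb (self_module R) k p ` tup R p" using e by (metis image_eqI)
  then show ?thesis using assms(1) by (simp add: gens_def)
qed

lemma gens_tup: "gens R q K k p \<Longrightarrow> K \<subseteq> tup R q"
  using module.lincomb_closed[OF R.self_module, of p k q] by (auto simp: gens_def)

text \<open>If \<kappa> is the combination of the \<open>k j\<close> with coefficients
  \<open>r j\<close>, then \<kappa> times \<open>u\<close> is the combination of the
  \<open>k j\<close> with entries \<open>r j\<close> times \<open>u\<close>, so the terms of a span
  element can be collected by generators. An element of the span thus becomes a tuple of length
  \<open>p\<close>, determined up to tuples whose combination is 0.\<close>

lemma dot_span_gens:
  assumes "gens R q K k p"
  shows "dot_span M K = lincomb M k p ` tup M p"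
proof
  show "lincomb M k p ` tup M p \<subseteq> dot_span M K"
    using dot_span_lincomb[of p k K q, OF _ gens_tup[OF assms]] gens_mem[OF assms] by blast
next
  have k: "\<And>j. j < p \<Longrightarrow> k j \<in> tup R q" using assms by (simp add: gens_def)
  show "dot_span M K \<subseteq> lincomb M k p ` tup M p"
  proof
    fix v assume "v \<in> dot_span M K"
    then show "v \<in> lincomb M k p ` tup M p"
    proof induction
      case zero
      show ?case by (rule image_eqI[OF _ tup_zero]) (simp add: lincomb_zero[OF k])
    next
      case (step \<kappa> u v)
      from step(1) assms obtain r where r: "r \<in> tup R p" "\<kappa> = lincomb (self_module R) k p r"
        by (auto simp: gens_def)
      from step(4) obtain x where x: "x \<in> tup M p" "v = lincomb M k p x" by blast
      have "(\<lambda>l. \<kappa> l \<odot>\<^bsub>M\<^esub> u \<oplus>\<^bsub>M\<^esub> v l) = lincomb M k p (\<lambda>j. r j \<odot>\<^bsub>M\<^esub> u \<oplus>\<^bsub>M\<^esub> x j)"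
        using lincomb_add[OF k tup_smult[OF r(1) step(2)] x(1)] lincomb_scalar[OF k r(1) step(2)] r x by simp
      then show ?case by (rule image_eqI[OF _ tup_add[OF tup_smult[OF r(1) step(2)] x(1)]])
    qed
  qed
qed

end

section \<open>Homomorphisms applied to tuples coordinate by coordinate\<close>

lemma mod_homD:
  assumes "f \<in> mod_hom R M N"
  shows "x \<in> carrier M \<Longrightarrow> f x \<in> carrier N"
    "x \<in> carrier M \<Longrightarrow> y \<in> carrier M \<Longrightarrow> f (x \<oplus>\<^bsub>M\<^esub> y) = f x \<oplus>\<^bsub>N\<^esub> f y"
    "r \<in> carrier R \<Longrightarrow> x \<in> carrier M \<Longrightarrow> f (r \<odot>\<^bsub>M\<^esub> x) = r \<odot>\<^bsub>N\<^esub> f x"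
  using assms by (auto simp: mod_hom_def)

locale two_modules = M: module R M + N: module R N
  for R (structure) and M :: "('a, 'b, 'c) module_scheme" and N :: "('a, 'd, 'e) module_scheme" +
  fixes f
  assumes hom: "f \<in> mod_hom R M N"
begin

lemmas f_closed = mod_homD(1)[OF hom]
lemmas f_add = mod_homD(2)[OF hom]
lemmas f_smult = mod_homD(3)[OF hom]

lemma f_zero [simp]: "f \<zero>\<^bsub>M\<^esub> = \<zero>\<^bsub>N\<^esub>"
  using f_smult[of \<zero> "\<zero>\<^bsub>M\<^esub>"] f_closed[of "\<zero>\<^bsub>M\<^esub>"] by simp

lemma f_neg: "x \<in> carrier M \<Longrightarrow> f (\<ominus>\<^bsub>M\<^esub> x) = \<ominus>\<^bsub>N\<^esub> f x"
  using f_smult[of "\<ominus> \<one>" x] f_closed[of x] by (simp add: M.smult_l_minus N.smult_l_minus)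

lemma f_diff: "x \<in> carrier M \<Longrightarrow> y \<in> carrier M \<Longrightarrow> f (x \<ominus>\<^bsub>M\<^esub> y) = f x \<ominus>\<^bsub>N\<^esub> f y"
  by (simp add: a_minus_def f_add f_neg)

lemma f_tup: "x \<in> tup M q \<Longrightarrow> (\<lambda>l. f (x l)) \<in> tup N q"
  using f_closed by (auto simp: tup_def)

lemma f_finsum:
  assumes "finite A" "g \<in> A \<rightarrow> carrier M"
  shows "f (\<Oplus>\<^bsub>M\<^esub>i\<in>A. g i) = (\<Oplus>\<^bsub>N\<^esub>i\<in>A. f (g i))"
  using assms
proof (induction A)
  case empty
  then show ?case by simp
next
  case (insert a A)
  then have "g \<in> A \<rightarrow> carrier M" "g a \<in> carrier M" by auto
  then show ?case using insert f_closed by (simp add: f_add M.M.finsum_insert N.M.finsum_insert Pi_def)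
qed

lemma f_lincomb:
  assumes "\<And>j. j < p \<Longrightarrow> k j \<in> tup R q" "x \<in> tup M p"
  shows "f (lincomb M k p x l) = lincomb N k p (\<lambda>j. f (x j)) l"
proof -
  have c: "k j l \<in> carrier R" "x j \<in> carrier M" if "j < p" for j
    using M.R.tupE[OF assms(1)[OF that]] M.tupD[OF assms(2)] by auto
  have "f (\<Oplus>\<^bsub>M\<^esub>j\<in>{..<p}. k j l \<odot>\<^bsub>M\<^esub> x j) = (\<Oplus>\<^bsub>N\<^esub>j\<in>{..<p}. f (k j l \<odot>\<^bsub>M\<^esub> x j))"
    using c by (intro f_finsum) auto
  also have "\<dots> = (\<Oplus>\<^bsub>N\<^esub>j\<in>{..<p}. k j l \<odot>\<^bsub>N\<^esub> f (x j))"
    using c f_closed by (intro N.M.finsum_cong') (auto simp: f_smult)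
  finally show ?thesis by (simp add: lincomb_def)
qed

lemma f_dot_span:
  assumes "v \<in> dot_span M K" "K \<subseteq> tup R q"
  shows "(\<lambda>l. f (v l)) \<in> dot_span N K"
  using assms(1)
proof induction
  case zero
  then show ?case by (simp add: dot_span.zero)
next
  case (step \<kappa> u v)
  have "(\<lambda>l. f (\<kappa> l \<odot>\<^bsub>M\<^esub> u \<oplus>\<^bsub>M\<^esub> v l)) = (\<lambda>l. \<kappa> l \<odot>\<^bsub>N\<^esub> f u \<oplus>\<^bsub>N\<^esub> f (v l))"
    using step(2) M.tupD[OF M.dot_span_tup[OF step(3) assms(2)]] M.R.tupE[OF subsetD[OF assms(2) step(1)]]
    by (intro ext) (simp add: f_add f_smult)
  then show ?case using dot_span.step[OF step(1) f_closed[OF step(2)] step(4)] by simp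
qed

lemma lift_tup:
  assumes "\<And>l. l < q \<Longrightarrow> y l \<in> f ` carrier M" "y \<in> tup N q"
  shows "\<exists>x\<in>tup M q. y = (\<lambda>l. f (x l))"
proof -
  have "\<forall>l. \<exists>z. l < q \<longrightarrow> z \<in> carrier M \<and> y l = f z" using assms(1) by blast
  then obtain z where z: "\<And>l. l < q \<Longrightarrow> z l \<in> carrier M \<and> y l = f (z l)" by metis
  define x where "x = (\<lambda>l. if l < q then z l else \<zero>\<^bsub>M\<^esub>)"
  have "y l = f (x l)" for l
    using z assms(2) by (cases "l < q") (auto simp: x_def tup_def)
  moreover have "x \<in> tup M q" using z by (auto simp: x_def tup_def)
  ultimately show ?thesis by auto
qed

lemma lift_dot_span:
  assumes "f ` carrier M = carrier N" "v \<in> dot_span N K" "K \<subseteq> tup R q"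
  shows "\<exists>w\<in>dot_span M K. v = (\<lambda>l. f (w l))"
  using assms(2)
proof induction
  case zero
  show ?case by (rule bexI[OF _ dot_span.zero]) simp
next
  case (step \<kappa> u v)
  from step(4) obtain w where w: "w \<in> dot_span M K" "v = (\<lambda>l. f (w l))" by blast
  from step(2) assms(1) obtain u' where u': "u' \<in> carrier M" "u = f u'" by blast
  have "(\<lambda>l. \<kappa> l \<odot>\<^bsub>N\<^esub> u \<oplus>\<^bsub>N\<^esub> v l) = (\<lambda>l. f (\<kappa> l \<odot>\<^bsub>M\<^esub> u' \<oplus>\<^bsub>M\<^esub> w l))"
    using u' w(2) M.tupD[OF M.dot_span_tup[OF w(1) assms(3)]] M.R.tupE[OF subsetD[OF assms(3) step(1)]]
    by (intro ext) (simp add: f_add f_smult)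
  then show ?case by (rule bexI[OF _ dot_span.step[OF step(1) u'(1) w(1)]])
qed

end

section \<open>Exactness after tensoring, and dimension shifting\<close>

text \<open>A consequence of projectivity that takes the place of flatness: linear functionals detect the
  image of \<open>P \<otimes> K\<close> in \<open>P\<^sup>q\<close>.\<close>

definition coord_module :: "('r, 'x) ring_scheme \<Rightarrow> ('r, 'p, 'y) module_scheme \<Rightarrow> bool" where
  "coord_module R P \<longleftrightarrow> module R P \<and> (\<exists>\<Lambda> \<subseteq> mod_hom R P (self_module R).
     \<forall>q K y. tup_submodule R q K \<longrightarrow> y \<in> tup P q \<longrightarrow> (\<forall>\<phi>\<in>\<Lambda>. (\<lambda>l. \<phi> (y l)) \<in> K) \<longrightarrow> y \<in> dot_span P K)"

text \<open>For a complex \<open>A \<rightarrow> B \<rightarrow> C\<close> this says that \<open>A \<otimes> R\<^sup>q/K \<rightarrow> B \<otimes> R\<^sup>q/K \<rightarrow> C \<otimes> R\<^sup>q/K\<close> is exact.\<close>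

definition tensor_exact ::
  "('r, 'x) ring_scheme \<Rightarrow> ('r, 'a, 'u) module_scheme \<Rightarrow> ('a \<Rightarrow> 'b) \<Rightarrow> ('r, 'b, 'v) module_scheme \<Rightarrow>
   ('b \<Rightarrow> 'c) \<Rightarrow> ('r, 'c, 'w) module_scheme \<Rightarrow> nat \<Rightarrow> (nat \<Rightarrow> 'r) set \<Rightarrow> bool" where
  "tensor_exact R A f B g C q K \<longleftrightarrow>
     (\<forall>x\<in>tup B q. (\<lambda>l. g (x l)) \<in> dot_span C K \<longrightarrow>
        (\<exists>u\<in>tup A q. \<exists>w\<in>dot_span B K. x = (\<lambda>l. f (u l) \<oplus>\<^bsub>B\<^esub> w l)))"

text \<open>If \<open>D\<close> is projective, then this is exactness of \<open>B \<rightarrow> C \<rightarrow> D\<close> after tensoring with \<open>R\<^sup>p\<close> modulo the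
  relations of \<open>k\<close>. For \<open>D = M\<close>, the end of a resolution, it is a condition on \<open>M\<close> alone.\<close>

definition rels_exact ::
  "('r, 'x) ring_scheme \<Rightarrow> ('r, 'b, 'v) module_scheme \<Rightarrow> ('b \<Rightarrow> 'c) \<Rightarrow> ('r, 'c, 'w) module_scheme \<Rightarrow>
   ('c \<Rightarrow> 'd) \<Rightarrow> ('r, 'd, 'z) module_scheme \<Rightarrow> (nat \<Rightarrow> nat \<Rightarrow> 'r) \<Rightarrow> nat \<Rightarrow> bool" where
  "rels_exact R B g C h D k p \<longleftrightarrow>
     (\<forall>x\<in>tup C p. lincomb D k p (\<lambda>j. h (x j)) = (\<lambda>_. \<zero>\<^bsub>D\<^esub>) \<longrightarrow>
        (\<exists>u\<in>tup B p. \<exists>w\<in>dot_span C (rels R k p). x = (\<lambda>l. g (u l) \<oplus>\<^bsub>C\<^esub> w l)))"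

lemma coord_module_module: "coord_module R P \<Longrightarrow> module R P"
  by (simp add: coord_module_def)

lemma coord_moduleE:
  assumes "coord_module R P"
  obtains \<Lambda> where "\<Lambda> \<subseteq> mod_hom R P (self_module R)"
    "\<And>q K y. \<lbrakk>tup_submodule R q K; y \<in> tup P q; \<And>\<phi>. \<phi> \<in> \<Lambda> \<Longrightarrow> (\<lambda>l. \<phi> (y l)) \<in> K\<rbrakk> \<Longrightarrow> y \<in> dot_span P K"
proof -
  from assms obtain \<Lambda> where "\<Lambda> \<subseteq> mod_hom R P (self_module R)" and
    *: "\<forall>q K y. tup_submodule R q K \<longrightarrow> y \<in> tup P q \<longrightarrow> (\<forall>\<phi>\<in>\<Lambda>. (\<lambda>l. \<phi> (y l)) \<in> K) \<longrightarrow> y \<in> dot_span P K"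
    unfolding coord_module_def by auto
  then show thesis by (intro that[of \<Lambda>]) simp_all
qed

lemma tup_submoduleD:
  assumes "tup_submodule R q K"
  shows "K \<subseteq> tup R q" "(\<lambda>_. \<zero>\<^bsub>R\<^esub>) \<in> K"
    "x \<in> K \<Longrightarrow> y \<in> K \<Longrightarrow> (\<lambda>l. x l \<oplus>\<^bsub>R\<^esub> y l) \<in> K"
    "r \<in> carrier R \<Longrightarrow> x \<in> K \<Longrightarrow> (\<lambda>l. r \<otimes>\<^bsub>R\<^esub> x l) \<in> K"
  using assms by (auto simp: tup_submodule_def)

lemma rels_tup: "rels R k p \<subseteq> tup R p"
  by (auto simp: rels_def)

context cring begin

lemma tup_submodule_rels:
  assumes "\<And>j. j < p \<Longrightarrow> k j \<in> tup R q"
  shows "tup_submodule R p (rels R k p)"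
proof -
  interpret S: module R "self_module R" by (rule self_module)
  have z: "lincomb (self_module R) k p (\<lambda>_. \<zero>) = (\<lambda>_. \<zero>)" using S.lincomb_zero[OF assms] by simp
  have a: "lincomb (self_module R) k p (\<lambda>l. x l \<oplus> y l) = (\<lambda>_. \<zero>)"
    if "x \<in> tup R p" "y \<in> tup R p" "lincomb (self_module R) k p x = (\<lambda>_. \<zero>)"
      "lincomb (self_module R) k p y = (\<lambda>_. \<zero>)" for x y
    using S.lincomb_add[of p k q x y] assms that by simp
  have s: "lincomb (self_module R) k p (\<lambda>l. r \<otimes> x l) = (\<lambda>_. \<zero>)"
    if "x \<in> tup R p" "lincomb (self_module R) k p x = (\<lambda>_. \<zero>)" "r \<in> carrier R" for x r
    using S.lincomb_smult[of p k q x r] assms that by simp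
  show ?thesis
    unfolding tup_submodule_def rels_def using z a s by (auto simp: tup_def)
qed

lemma tup_submodule_trivial: "tup_submodule R q {\<lambda>_. \<zero>}"
  by (auto simp: tup_submodule_def tup_def)

lemma tup_submodule_neg:
  assumes "tup_submodule R q K" "x \<in> K" shows "(\<lambda>l. \<ominus> x l) \<in> K"
proof -
  have "(\<lambda>l. (\<ominus> \<one>) \<otimes> x l) \<in> K" using tup_submoduleD(4)[OF assms(1) _ assms(2)] by simp
  moreover have "(\<ominus> \<one>) \<otimes> x l = \<ominus> x l" for l
    using tupE[of x q l] tup_submoduleD(1)[OF assms(1)] assms(2) by (auto simp: l_minus)
  ultimately show ?thesis by simp
qed

text \<open>Each step adds a multiple of an element of \<open>K\<close>. Together with
  \<open>f_dot_span\<close> it yields the easy converse of the detection property in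
  \<open>coord_module\<close>: functionals send the span over \<open>P\<close> into
  \<open>K\<close>.\<close>

lemma dot_span_self:
  assumes "v \<in> dot_span (self_module R) K" "tup_submodule R q K" shows "v \<in> K"
  using assms(1)
proof induction
  case zero
  then show ?case using tup_submoduleD(2)[OF assms(2)] by simp
next
  case (step \<kappa> u v)
  have "(\<lambda>l. u \<otimes> \<kappa> l \<oplus> v l) \<in> K"
    using tup_submoduleD(3)[OF assms(2) tup_submoduleD(4)[OF assms(2)]] step by simp
  moreover have "u \<otimes> \<kappa> l = \<kappa> l \<otimes> u" for l
    using step tupE[of \<kappa> q l] tup_submoduleD(1)[OF assms(2)] by (auto intro: m_comm)
  ultimately show ?case by simp
qed

lemma dot_span_functional:
  assumes "module R P" "\<phi> \<in> mod_hom R P (self_module R)" "v \<in> dot_span P K" "tup_submodule R q K"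
  shows "(\<lambda>l. \<phi> (v l)) \<in> K"
proof -
  interpret two_modules R P "self_module R" \<phi>
    using assms self_module by (simp add: two_modules_def two_modules_axioms_def)
  show ?thesis
    using dot_span_self[OF f_dot_span[OF assms(3) tup_submoduleD(1)[OF assms(4)]] assms(4)] .
qed

text \<open>Every functional sends \<open>x\<close> to a relation over \<open>R\<close>, and the
  detection property lifts this back to \<open>P\<close>. This is the equational criterion of
  flatness: relations with entries in a projective module come from relations over
  \<open>R\<close>.\<close>

lemma coord_rels:
  assumes "coord_module R P" "\<And>j. j < p \<Longrightarrow> k j \<in> tup R q" "x \<in> tup P p"
    "lincomb P k p x = (\<lambda>_. \<zero>\<^bsub>P\<^esub>)"
  shows "x \<in> dot_span P (rels R k p)"
proof -
  have P: "module R P" using assms(1) by (rule coord_module_module)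
  from coord_moduleE[OF assms(1)] obtain \<Lambda> where L: "\<Lambda> \<subseteq> mod_hom R P (self_module R)"
    "\<And>q K y. \<lbrakk>tup_submodule R q K; y \<in> tup P q; \<And>\<phi>. \<phi> \<in> \<Lambda> \<Longrightarrow> (\<lambda>l. \<phi> (y l)) \<in> K\<rbrakk> \<Longrightarrow> y \<in> dot_span P K"
    by blast
  show ?thesis
  proof (rule L(2)[OF tup_submodule_rels[of p k q, OF assms(2)] assms(3)])
    fix \<phi> assume f: "\<phi> \<in> \<Lambda>"
    interpret two_modules R P "self_module R" \<phi>
      using P L(1) f self_module by (auto simp: two_modules_def two_modules_axioms_def)
    have "lincomb (self_module R) k p (\<lambda>j. \<phi> (x j)) = (\<lambda>_. \<zero>)"
      using f_lincomb[where k = k, OF assms(2,3), symmetric] assms(4) f_zero by (intro ext) simp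
    then show "(\<lambda>l. \<phi> (x l)) \<in> rels R k p"
      using f_tup[OF assms(3)] by (simp add: rels_def)
  qed
qed

text \<open>Functionals send \<open>v\<close> into \<open>A\<close> and into \<open>B\<close>, hence
  to 0, and the detection property is applied to the zero submodule. It says that the sum of
  \<open>A\<close> and \<open>B\<close> stays direct after tensoring with a projective
  module.\<close>

lemma coord_inter:
  assumes "coord_module R P" "tup_submodule R q A" "tup_submodule R q B" "A \<inter> B \<subseteq> {\<lambda>_. \<zero>}"
    "v \<in> dot_span P A" "v \<in> dot_span P B"
  shows "v = (\<lambda>_. \<zero>\<^bsub>P\<^esub>)"
proof -
  have P: "module R P" using assms(1) by (rule coord_module_module)
  from coord_moduleE[OF assms(1)] obtain \<Lambda> where L: "\<Lambda> \<subseteq> mod_hom R P (self_module R)"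
    "\<And>q K y. \<lbrakk>tup_submodule R q K; y \<in> tup P q; \<And>\<phi>. \<phi> \<in> \<Lambda> \<Longrightarrow> (\<lambda>l. \<phi> (y l)) \<in> K\<rbrakk> \<Longrightarrow> y \<in> dot_span P K"
    by blast
  have "v \<in> dot_span P {\<lambda>_. \<zero>}"
  proof (rule L(2)[OF tup_submodule_trivial[of q]])
    show "v \<in> tup P q" using module.dot_span_tup[OF P assms(5) tup_submoduleD(1)[OF assms(2)]] .
    fix \<phi> assume f: "\<phi> \<in> \<Lambda>"
    show "(\<lambda>l. \<phi> (v l)) \<in> {\<lambda>_. \<zero>}"
      using dot_span_functional[OF P _ assms(5,2)] dot_span_functional[OF P _ assms(6,3)] f L(1) assms(4)
      by blast
  qed
  then show ?thesis by (rule module.dot_span_trivial[OF P])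
qed

end

text \<open>A window of a resolution, in which \<open>D\<close> may be a further term or the
  resolved module itself. Exactness at \<open>B\<close> after tensoring will be traded for a
  condition at \<open>C\<close>, one place further down, which is what a dimension shift
  does.\<close>

locale four_modules = AB: two_modules R A B f + BC: two_modules R B C g + CD: two_modules R C D h
  for R (structure) and A and B and C and D and f and g and h +
  assumes exact_B: "f ` carrier A = {x \<in> carrier B. g x = \<zero>\<^bsub>C\<^esub>}"
    and exact_C: "g ` carrier B = {x \<in> carrier C. h x = \<zero>\<^bsub>D\<^esub>}"
begin

lemma gf: "x \<in> carrier A \<Longrightarrow> g (f x) = \<zero>\<^bsub>C\<^esub>"
  using exact_B by auto

lemma hg: "x \<in> carrier B \<Longrightarrow> h (g x) = \<zero>\<^bsub>D\<^esub>"
  using exact_C by auto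

lemma lift_kernel_B:
  assumes "x \<in> tup B q" "\<And>l. g (x l) = \<zero>\<^bsub>C\<^esub>" shows "\<exists>u\<in>tup A q. x = (\<lambda>l. f (u l))"
  using assms AB.N.tupD[OF assms(1)] by (intro AB.lift_tup) (auto simp: exact_B)

lemma lift_kernel_C:
  assumes "x \<in> tup C q" "\<And>l. h (x l) = \<zero>\<^bsub>D\<^esub>" shows "\<exists>u\<in>tup B q. x = (\<lambda>l. g (u l))"
  using assms BC.N.tupD[OF assms(1)] by (intro BC.lift_tup) (auto simp: exact_C)

text \<open>A diagram chase: the combination \<open>y\<close> of \<open>x\<close> is killed by
  \<open>h\<close>, so it lifts to \<open>z\<close> over \<open>B\<close>, a cycle modulo
  \<open>K\<close>. Exactness at \<open>B\<close> replaces \<open>z\<close> by a combination of the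
  generators with entries \<open>v\<close>. Then \<open>x\<close> and the image of \<open>v\<close>
  under \<open>g\<close> have the same combination over \<open>C\<close>, and
  \<open>coord_rels\<close> puts their difference into the span of the relations.\<close>

lemma tensor_exact_imp_rels_exact:
  assumes C: "coord_module R C" and k: "gens R q K k p" and ex: "tensor_exact R A f B g C q K"
  shows "rels_exact R B g C h D k p"
  unfolding rels_exact_def
proof (intro ballI impI)
  fix x assume x: "x \<in> tup C p" and lx: "lincomb D k p (\<lambda>j. h (x j)) = (\<lambda>_. \<zero>\<^bsub>D\<^esub>)"
  have kt: "\<And>j. j < p \<Longrightarrow> k j \<in> tup R q" using k by (simp add: gens_def)
  have Kt: "K \<subseteq> tup R q" by (rule AB.N.gens_tup[OF k])
  define y where "y = lincomb C k p x"
  have y: "y \<in> tup C q" "y \<in> dot_span C K"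
    using BC.N.lincomb_closed[where k = k, OF kt x] BC.N.dot_span_gens[OF k] x by (auto simp: y_def)
  have "h (y l) = \<zero>\<^bsub>D\<^esub>" for l
    using CD.f_lincomb[where k = k, OF kt x] lx by (simp add: y_def)
  then obtain z where z: "z \<in> tup B q" "y = (\<lambda>l. g (z l))" using lift_kernel_C[OF y(1)] by blast
  with ex y(2) obtain u w where u: "u \<in> tup A q" and w: "w \<in> dot_span B K" and
    zuw: "z = (\<lambda>l. f (u l) \<oplus>\<^bsub>B\<^esub> w l)"
    unfolding tensor_exact_def by blast
  from w obtain v where v: "v \<in> tup B p" "w = lincomb B k p v"
    using AB.N.dot_span_gens[OF k] by blast
  have "y l = lincomb C k p (\<lambda>j. g (v j)) l" for l
  proof -
    have "y l = g (f (u l)) \<oplus>\<^bsub>C\<^esub> g (w l)"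
      using zuw z(2) AB.M.tupD[OF u] AB.f_closed AB.N.tupD[OF AB.N.dot_span_tup[OF w Kt]]
      by (simp add: BC.f_add)
    then show ?thesis
      using gf[OF AB.M.tupD[OF u]] BC.f_lincomb[where k = k, OF kt v(1)] v(2) BC.N.tupD[OF y(1)]
        BC.N.tupD[OF BC.N.lincomb_closed[where k = k, OF kt BC.f_tup[OF v(1)]]] by simp
  qed
  then have yv: "y = lincomb C k p (\<lambda>j. g (v j))" by blast
  define w' where "w' = (\<lambda>j. x j \<ominus>\<^bsub>C\<^esub> g (v j))"
  have gv: "(\<lambda>j. g (v j)) \<in> tup C p" by (rule BC.f_tup[OF v(1)])
  have w't: "w' \<in> tup C p" unfolding w'_def by (rule BC.N.tup_diff[OF x gv])
  have "lincomb C k p w' = (\<lambda>l. y l \<ominus>\<^bsub>C\<^esub> y l)"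
    unfolding w'_def using BC.N.lincomb_diff[where k = k, OF kt x gv] yv y_def by simp
  also have "\<dots> = (\<lambda>_. \<zero>\<^bsub>C\<^esub>)"
    using BC.N.tupD[OF y(1)] by (simp add: a_minus_def BC.N.M.r_neg)
  finally have "w' \<in> dot_span C (rels R k p)"
    using AB.M.R.coord_rels[where k = k and q = q, OF C kt w't] by blast
  moreover have "x = (\<lambda>l. g (v l) \<oplus>\<^bsub>C\<^esub> w' l)"
  proof
    fix l
    have "x l \<in> carrier C" "g (v l) \<in> carrier C" using BC.N.tupD[OF x] BC.N.tupD[OF gv] by auto
    then show "x l = g (v l) \<oplus>\<^bsub>C\<^esub> w' l"
      by (simp add: w'_def a_minus_def BC.N.M.a_lcomm BC.N.M.r_neg)
  qed
  ultimately show "\<exists>u\<in>tup B p. \<exists>w\<in>dot_span C (rels R k p). x = (\<lambda>l. g (u l) \<oplus>\<^bsub>C\<^esub> w l)"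
    using v(1) by blast
qed

text \<open>The chase in the other direction: the image of \<open>x\<close> is a combination of some
  \<open>y\<close>, whose image in \<open>D\<close> has combination 0. Hence \<open>y\<close> comes
  from some \<open>u\<close> over \<open>B\<close> up to relations, and \<open>x\<close> differs
  from the combination \<open>v\<close> of \<open>u\<close> by an element of the kernel of
  \<open>g\<close>, that is, by a boundary.\<close>

lemma rels_exact_imp_tensor_exact:
  assumes k: "gens R q K k p" and ex: "rels_exact R B g C h D k p"
  shows "tensor_exact R A f B g C q K"
  unfolding tensor_exact_def
proof (intro ballI impI)
  fix x assume x: "x \<in> tup B q" and gx: "(\<lambda>l. g (x l)) \<in> dot_span C K"
  have kt: "\<And>j. j < p \<Longrightarrow> k j \<in> tup R q" using k by (simp add: gens_def)
  from gx obtain y where y: "y \<in> tup C p" "(\<lambda>l. g (x l)) = lincomb C k p y"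
    using BC.N.dot_span_gens[OF k] by blast
  have "lincomb D k p (\<lambda>j. h (y j)) l = \<zero>\<^bsub>D\<^esub>" for l
    using CD.f_lincomb[where k = k and l = l, OF kt y(1), symmetric] y(2)[symmetric] hg AB.N.tupD[OF x] by simp
  then obtain u w where u: "u \<in> tup B p" and w: "w \<in> dot_span C (rels R k p)"
    and yuw: "y = (\<lambda>l. g (u l) \<oplus>\<^bsub>C\<^esub> w l)"
    using ex y(1) unfolding rels_exact_def by blast
  have gu: "(\<lambda>j. g (u j)) \<in> tup C p" by (rule BC.f_tup[OF u])
  have wt: "w \<in> tup C p" using BC.N.dot_span_tup[OF w rels_tup] .
  define v where "v = lincomb B k p u"
  have v: "v \<in> tup B q" "v \<in> dot_span B K"
    using AB.N.lincomb_closed[where k = k, OF kt u] AB.N.dot_span_gens[OF k] u by (auto simp: v_def)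
  have gxv: "g (x l) = g (v l)" for l
  proof -
    have "g (x l) = lincomb C k p (\<lambda>j. g (u j)) l \<oplus>\<^bsub>C\<^esub> \<zero>\<^bsub>C\<^esub>"
      using fun_cong[OF y(2), of l] BC.N.lincomb_add[where k = k, OF kt gu wt] BC.N.lincomb_rels[where k = k, OF kt w] yuw by simp
    then show ?thesis
      using BC.f_lincomb[where k = k and l = l, OF kt u] BC.N.tupD[OF BC.N.lincomb_closed[where k = k, OF kt gu]] v_def by simp
  qed
  have xv: "(\<lambda>l. x l \<ominus>\<^bsub>B\<^esub> v l) \<in> tup B q" by (rule AB.N.tup_diff[OF x v(1)])
  have "g (x l \<ominus>\<^bsub>B\<^esub> v l) = \<zero>\<^bsub>C\<^esub>" for l
    using AB.N.tupD[OF x] AB.N.tupD[OF v(1)] gxv BC.f_closed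
    by (simp add: BC.f_diff) (simp add: a_minus_def BC.N.M.r_neg)
  then obtain t where t: "t \<in> tup A q" "(\<lambda>l. x l \<ominus>\<^bsub>B\<^esub> v l) = (\<lambda>l. f (t l))"
    using lift_kernel_B[OF xv] by blast
  have "x = (\<lambda>l. f (t l) \<oplus>\<^bsub>B\<^esub> v l)"
  proof
    fix l
    have "x l = (x l \<ominus>\<^bsub>B\<^esub> v l) \<oplus>\<^bsub>B\<^esub> v l"
      using AB.N.tupD[OF x] AB.N.tupD[OF v(1)]
      by (simp add: a_minus_def AB.N.M.a_assoc AB.N.M.l_neg)
    then show "x l = f (t l) \<oplus>\<^bsub>B\<^esub> v l" using fun_cong[OF t(2), of l] by simp
  qed
  then show "\<exists>u\<in>tup A q. \<exists>w\<in>dot_span B K. x = (\<lambda>l. f (u l) \<oplus>\<^bsub>B\<^esub> w l)"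
    using t(1) v(2) by blast
qed

lemma rels_exact_imp_tensor_exact_rels:
  assumes kt: "\<And>j. j < p \<Longrightarrow> k j \<in> tup R q" and ex: "rels_exact R B g C h D k p"
  shows "tensor_exact R B g C h D p (rels R k p)"
  unfolding tensor_exact_def
proof (intro ballI impI)
  fix x assume x: "x \<in> tup C p" and "(\<lambda>l. h (x l)) \<in> dot_span D (rels R k p)"
  then have "lincomb D k p (\<lambda>j. h (x j)) = (\<lambda>_. \<zero>\<^bsub>D\<^esub>)" by (intro CD.N.lincomb_rels[where k = k, OF kt])
  then show "\<exists>u\<in>tup B p. \<exists>w\<in>dot_span C (rels R k p). x = (\<lambda>l. g (u l) \<oplus>\<^bsub>C\<^esub> w l)"
    using ex x unfolding rels_exact_def by blast
qed

text \<open>By \<open>coord_rels\<close> for \<open>D\<close>, a vanishing combination already lies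
  in the span of the relations, so the two notions of exactness at \<open>C\<close> agree. This is
  what allows the shift to be repeated.\<close>

lemma tensor_exact_rels_imp_rels_exact:
  assumes D: "coord_module R D" and kt: "\<And>j. j < p \<Longrightarrow> k j \<in> tup R q"
    and ex: "tensor_exact R B g C h D p (rels R k p)"
  shows "rels_exact R B g C h D k p"
  unfolding rels_exact_def
proof (intro ballI impI)
  fix x assume x: "x \<in> tup C p" and "lincomb D k p (\<lambda>j. h (x j)) = (\<lambda>_. \<zero>\<^bsub>D\<^esub>)"
  then have "(\<lambda>j. h (x j)) \<in> dot_span D (rels R k p)"
    using AB.M.R.coord_rels[where k = k and q = q, OF D kt CD.f_tup[OF x]] by blast
  then show "\<exists>u\<in>tup B p. \<exists>w\<in>dot_span C (rels R k p). x = (\<lambda>l. g (u l) \<oplus>\<^bsub>C\<^esub> w l)"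
    using ex x unfolding tensor_exact_def by blast
qed

text \<open>Exactness for \<open>U\<close> writes \<open>x\<close> as a boundary plus \<alpha> plus
  \<beta>, from the spans of \<open>S\<close> and \<open>T\<close>. The image of \<beta> under
  \<open>g\<close> lies in both spans over \<open>C\<close>, so it is 0 by
  \<open>coord_inter\<close>, and \<beta> is itself a boundary. In terms of Tor, vanishing passes to
  direct summands of the syzygy.\<close>

lemma tensor_exact_summand:
  assumes C: "coord_module R C" and S: "tup_submodule R q S" and T: "tup_submodule R q T"
    and U: "S \<subseteq> U" "T \<subseteq> U" "\<And>x. x \<in> U \<Longrightarrow> \<exists>a\<in>S. \<exists>b\<in>T. x = (\<lambda>l. a l \<oplus> b l)"
    and ST: "S \<inter> T \<subseteq> {\<lambda>_. \<zero>}" and ex: "tensor_exact R A f B g C q U"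
  shows "tensor_exact R A f B g C q S"
  unfolding tensor_exact_def
proof (intro ballI impI)
  fix x assume x: "x \<in> tup B q" and gx: "(\<lambda>l. g (x l)) \<in> dot_span C S"
  note St = tup_submoduleD(1)[OF S] and Tt = tup_submoduleD(1)[OF T]
  from ex x BC.N.dot_span_mono[OF gx U(1)] obtain u w where u: "u \<in> tup A q" and
    w: "w \<in> dot_span B U" and xuw: "x = (\<lambda>l. f (u l) \<oplus>\<^bsub>B\<^esub> w l)"
    unfolding tensor_exact_def by blast
  from AB.N.dot_span_split[OF w U(3) St Tt] obtain \<alpha> \<beta> where
    \<alpha>: "\<alpha> \<in> dot_span B S" and \<beta>: "\<beta> \<in> dot_span B T" and wab: "w = (\<lambda>l. \<alpha> l \<oplus>\<^bsub>B\<^esub> \<beta> l)"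
    by blast
  have \<alpha>t: "\<alpha> \<in> tup B q" and \<beta>t: "\<beta> \<in> tup B q"
    using AB.N.dot_span_tup[OF \<alpha> St] AB.N.dot_span_tup[OF \<beta> Tt] by auto
  note cl = AB.M.tupD[OF u] AB.N.tupD[OF \<alpha>t] AB.N.tupD[OF \<beta>t] AB.f_closed BC.f_closed
  have "g (\<beta> l) = g (x l) \<ominus>\<^bsub>C\<^esub> g (\<alpha> l)" for l
  proof -
    have c: "g (\<alpha> l) \<in> carrier C" "g (\<beta> l) \<in> carrier C" using cl by auto
    have "g (x l) = g (\<beta> l) \<oplus>\<^bsub>C\<^esub> g (\<alpha> l)"
      using cl gf BC.N.M.a_comm[OF c] by (simp add: xuw wab BC.f_add)
    then show ?thesis using c by (simp add: a_minus_def BC.N.M.a_assoc BC.N.M.r_neg)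
  qed
  then have "(\<lambda>l. g (\<beta> l)) \<in> dot_span C S"
    using BC.N.dot_span_diff[OF gx BC.f_dot_span[OF \<alpha> St] St] by simp
  then have "(\<lambda>l. g (\<beta> l)) = (\<lambda>_. \<zero>\<^bsub>C\<^esub>)"
    using AB.M.R.coord_inter[OF C S T ST _ BC.f_dot_span[OF \<beta> Tt]] by blast
  then obtain v where v: "v \<in> tup A q" "\<beta> = (\<lambda>l. f (v l))"
    using lift_kernel_B[OF \<beta>t] by meson
  have "x = (\<lambda>l. f (u l \<oplus>\<^bsub>A\<^esub> v l) \<oplus>\<^bsub>B\<^esub> \<alpha> l)"
    using cl AB.M.tupD[OF v(1)] by (intro ext) (simp add: xuw wab v(2) AB.f_add AB.N.M.a_ac)
  then show "\<exists>u\<in>tup A q. \<exists>w\<in>dot_span B S. x = (\<lambda>l. f (u l) \<oplus>\<^bsub>B\<^esub> w l)"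
    by (intro bexI[OF _ AB.M.tup_add[OF u v(1)]] bexI[OF _ \<alpha>])
qed

lemma tensor_exact_trivial: "tensor_exact R A f B g C q {\<lambda>_. \<zero>}"
  unfolding tensor_exact_def
proof (intro ballI impI)
  fix x assume x: "x \<in> tup B q" and "(\<lambda>l. g (x l)) \<in> dot_span C {\<lambda>_. \<zero>}"
  then have "(\<lambda>l. g (x l)) = (\<lambda>_. \<zero>\<^bsub>C\<^esub>)" by (intro BC.N.dot_span_trivial)
  then obtain u where u: "u \<in> tup A q" "x = (\<lambda>l. f (u l))" using lift_kernel_B[OF x] by meson
  then show "\<exists>u\<in>tup A q. \<exists>w\<in>dot_span B {\<lambda>_. \<zero>}. x = (\<lambda>l. f (u l) \<oplus>\<^bsub>B\<^esub> w l)"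
    using AB.f_closed AB.M.tupD[OF u(1)]
    by (intro bexI[OF _ u(1)] bexI[OF _ dot_span.zero]) simp
qed

text \<open>If \<open>K\<close> lies in the first q' coordinates, the other coordinates contribute a
  free summand. Cutting \<open>u\<close> off at q' changes nothing there, since \<open>x\<close> and
  \<open>w\<close> are both 0.\<close>

lemma tensor_exact_restrict:
  assumes "q' \<le> q" "K \<subseteq> tup R q'" "tensor_exact R A f B g C q K"
  shows "tensor_exact R A f B g C q' K"
  unfolding tensor_exact_def
proof (intro ballI impI)
  fix x assume x: "x \<in> tup B q'" and gx: "(\<lambda>l. g (x l)) \<in> dot_span C K"
  have "x \<in> tup B q" using x assms(1) AB.N.tupD[OF x] by (auto simp: tup_def)
  then obtain u w where u: "u \<in> tup A q" and w: "w \<in> dot_span B K"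
    and xuw: "x = (\<lambda>l. f (u l) \<oplus>\<^bsub>B\<^esub> w l)"
    using assms(3) gx unfolding tensor_exact_def by blast
  define u' where "u' = (\<lambda>l. if l < q' then u l else \<zero>\<^bsub>A\<^esub>)"
  have "u' \<in> tup A q'" using AB.M.tupD[OF u] by (auto simp: u'_def tup_def)
  moreover have "x l = f (u' l) \<oplus>\<^bsub>B\<^esub> w l" for l
  proof (cases "l < q'")
    case True
    then show ?thesis by (simp add: xuw u'_def)
  next
    case False
    then show ?thesis
      using AB.N.tup_ge[OF x, of l] AB.N.tup_ge[OF AB.N.dot_span_tup[OF w assms(2)], of l]
      by (simp add: u'_def)
  qed
  ultimately show "\<exists>u\<in>tup A q'. \<exists>w\<in>dot_span B K. x = (\<lambda>l. f (u l) \<oplus>\<^bsub>B\<^esub> w l)"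
    using w by blast
qed

text \<open>A tuple over \<open>D\<close> lifts to \<open>C\<close>, and two lifts differ by an
  image under \<open>g\<close>, which is absorbed by \<open>u\<close>. The right-hand side mentions
  \<open>D\<close> alone; with \<open>D\<close> the resolved module, the resolution has
  disappeared.\<close>

lemma rels_exact_iff_cokernel:
  assumes surj: "h ` carrier C = carrier D" and kt: "\<And>j. j < p \<Longrightarrow> k j \<in> tup R q"
  shows "rels_exact R B g C h D k p \<longleftrightarrow>
    (\<forall>y\<in>tup D p. lincomb D k p y = (\<lambda>_. \<zero>\<^bsub>D\<^esub>) \<longrightarrow> y \<in> dot_span D (rels R k p))"
proof (intro iffI ballI impI)
  fix y assume ex: "rels_exact R B g C h D k p" and y: "y \<in> tup D p"
    and ly: "lincomb D k p y = (\<lambda>_. \<zero>\<^bsub>D\<^esub>)"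
  obtain x where x: "x \<in> tup C p" "y = (\<lambda>l. h (x l))"
    using CD.lift_tup[OF _ y] CD.N.tupD[OF y] surj by blast
  then obtain u w where u: "u \<in> tup B p" and w: "w \<in> dot_span C (rels R k p)"
    and xuw: "x = (\<lambda>l. g (u l) \<oplus>\<^bsub>C\<^esub> w l)"
    using ex ly unfolding rels_exact_def by blast
  have "y = (\<lambda>l. h (w l))"
    using AB.N.tupD[OF u] BC.N.tupD[OF BC.N.dot_span_tup[OF w rels_tup]] CD.f_closed BC.f_closed
    by (intro ext) (simp add: x(2) xuw CD.f_add hg)
  then show "y \<in> dot_span D (rels R k p)" using CD.f_dot_span[OF w rels_tup] by simp
next
  assume ex: "\<forall>y\<in>tup D p. lincomb D k p y = (\<lambda>_. \<zero>\<^bsub>D\<^esub>) \<longrightarrow> y \<in> dot_span D (rels R k p)"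
  show "rels_exact R B g C h D k p"
    unfolding rels_exact_def
  proof (intro ballI impI)
    fix x assume x: "x \<in> tup C p" and "lincomb D k p (\<lambda>j. h (x j)) = (\<lambda>_. \<zero>\<^bsub>D\<^esub>)"
    then have "(\<lambda>j. h (x j)) \<in> dot_span D (rels R k p)" using ex CD.f_tup[OF x] by blast
    then obtain w where w: "w \<in> dot_span C (rels R k p)" "(\<lambda>j. h (x j)) = (\<lambda>j. h (w j))"
      using CD.lift_dot_span[OF surj _ rels_tup] by meson
    have wt: "w \<in> tup C p" using BC.N.dot_span_tup[OF w(1) rels_tup] .
    have "h (x l \<ominus>\<^bsub>C\<^esub> w l) = \<zero>\<^bsub>D\<^esub>" for l
      using BC.N.tupD[OF x] BC.N.tupD[OF wt] fun_cong[OF w(2), of l] CD.f_closed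
      by (simp add: CD.f_diff) (simp add: a_minus_def CD.N.M.r_neg)
    then obtain u where u: "u \<in> tup B p" "(\<lambda>l. x l \<ominus>\<^bsub>C\<^esub> w l) = (\<lambda>l. g (u l))"
      using lift_kernel_C[OF BC.N.tup_diff[OF x wt]] by meson
    have "x = (\<lambda>l. g (u l) \<oplus>\<^bsub>C\<^esub> w l)"
    proof
      fix l
      have "x l = (x l \<ominus>\<^bsub>C\<^esub> w l) \<oplus>\<^bsub>C\<^esub> w l"
        using BC.N.tupD[OF x] BC.N.tupD[OF wt] by (simp add: a_minus_def BC.N.M.a_assoc BC.N.M.l_neg)
      then show "x l = g (u l) \<oplus>\<^bsub>C\<^esub> w l" using fun_cong[OF u(2), of l] by simp
    qed
    then show "\<exists>u\<in>tup B p. \<exists>w\<in>dot_span C (rels R k p). x = (\<lambda>l. g (u l) \<oplus>\<^bsub>C\<^esub> w l)"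
      using u(1) w(1) by blast
  qed
qed

end

section \<open>Noetherian rings and minimal generators\<close>

context cring begin

lemma tup_submodule_diff:
  assumes "tup_submodule R q K" "x \<in> K" "y \<in> K" shows "(\<lambda>l. x l \<ominus> y l) \<in> K"
  unfolding a_minus_def
  using tup_submoduleD(3)[OF assms(1,2) tup_submodule_neg[OF assms(1,3)]] .

lemma tup_submodule_range:
  assumes "\<And>j. j < p \<Longrightarrow> k j \<in> tup R q"
  shows "tup_submodule R q (lincomb (self_module R) k p ` tup R p)"
proof -
  interpret S: module R "self_module R" by (rule self_module)
  show ?thesis
    unfolding tup_submodule_def
  proof (intro conjI ballI)
    show "lincomb (self_module R) k p ` tup R p \<subseteq> tup R q"
      using S.lincomb_closed[of p k q] assms by auto
    show "(\<lambda>_. \<zero>) \<in> lincomb (self_module R) k p ` tup R p"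
    proof (rule image_eqI)
      show "(\<lambda>_. \<zero>) = lincomb (self_module R) k p (\<lambda>_. \<zero>)"
        using S.lincomb_zero[of p k q] assms by simp
      show "(\<lambda>_. \<zero>) \<in> tup R p" by (simp add: tup_def)
    qed
  next
    fix x y assume "x \<in> lincomb (self_module R) k p ` tup R p" "y \<in> lincomb (self_module R) k p ` tup R p"
    then obtain a b where ab: "a \<in> tup R p" "x = lincomb (self_module R) k p a"
      "b \<in> tup R p" "y = lincomb (self_module R) k p b" by blast
    have "(\<lambda>l. x l \<oplus> y l) = lincomb (self_module R) k p (\<lambda>l. a l \<oplus> b l)"
      using S.lincomb_add[of p k q a b] assms ab by simp
    then show "(\<lambda>l. x l \<oplus> y l) \<in> lincomb (self_module R) k p ` tup R p"
      using S.tup_add[of a p b] ab by simp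
  next
    fix r x assume r: "r \<in> carrier R" and "x \<in> lincomb (self_module R) k p ` tup R p"
    then obtain a where a: "a \<in> tup R p" "x = lincomb (self_module R) k p a" by blast
    have "(\<lambda>l. r \<otimes> x l) = lincomb (self_module R) k p (\<lambda>l. r \<otimes> a l)"
      using S.lincomb_smult[of p k q a r] assms a r by simp
    moreover have "(\<lambda>l. r \<otimes> a l) \<in> tup R p" using a(1) r by (auto simp: tup_def)
    ultimately show "(\<lambda>l. r \<otimes> x l) \<in> lincomb (self_module R) k p ` tup R p" by blast
  qed
qed

lemma lincomb_mem:
  assumes "tup_submodule R q K" "\<And>j. j < p \<Longrightarrow> k j \<in> K" "x \<in> tup R p"
  shows "lincomb (self_module R) k p x \<in> K"
  using dot_span_self[OF module.dot_span_lincomb[OF self_module, of p k K q x] assms(1)]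
    assms tup_submoduleD(1)[OF assms(1)] by simp

lemma gensI:
  assumes K: "tup_submodule R q K" and k: "\<And>j. j < p \<Longrightarrow> k j \<in> K"
    and min: "\<And>U. tup_submodule R q U \<Longrightarrow> (\<And>j. j < p \<Longrightarrow> k j \<in> U) \<Longrightarrow> K \<subseteq> U"
  shows "gens R q K k p"
proof -
  have kt: "\<And>j. j < p \<Longrightarrow> k j \<in> tup R q" using k tup_submoduleD(1)[OF K] by blast
  have g: "gens R q (lincomb (self_module R) k p ` tup R p) k p" using kt by (simp add: gens_def)
  have "k j \<in> lincomb (self_module R) k p ` tup R p" if "j < p" for j
    using module.gens_mem[OF self_module g that] .
  then have "K \<subseteq> lincomb (self_module R) k p ` tup R p"
    using min[OF tup_submodule_range[of p k q, OF kt]] by blast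
  moreover have "lincomb (self_module R) k p ` tup R p \<subseteq> K"
    using lincomb_mem[OF K, of p k] k by blast
  ultimately show ?thesis using kt unfolding gens_def by blast
qed

lemma gens_minimal:
  assumes "gens R q K k p" "tup_submodule R q U" "\<And>j. j < p \<Longrightarrow> k j \<in> U"
  shows "K \<subseteq> U"
  using assms lincomb_mem[OF assms(2), of p k] by (auto simp: gens_def)

lemma gens_submodule: "gens R q K k p \<Longrightarrow> tup_submodule R q K"
  using tup_submodule_range[of p k q] by (simp add: gens_def)

text \<open>A relation with a unit coefficient can be solved for \<open>k j\<close>, so the other
  generators suffice. The last one is moved into the free slot \<open>j\<close>; for
  \<open>j = p - 1\<close> the family is merely shortened.\<close>

lemma gens_remove:
  assumes g: "gens R q K k p" and r: "r \<in> rels R k p" "j < p" "r j \<in> Units R"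
  shows "gens R q K (\<lambda>i. if i = j then k (p - 1) else k i) (p - 1)"
proof (rule gensI[OF gens_submodule[OF g]])
  interpret S: module R "self_module R" by (rule self_module)
  have kK: "k i \<in> K" if "i < p" for i using S.gens_mem[OF g that] .
  fix i assume "i < p - 1"
  then show "(if i = j then k (p - 1) else k i) \<in> K" using kK by auto
next
  interpret S: module R "self_module R" by (rule self_module)
  fix U assume U: "tup_submodule R q U"
    and kU: "\<And>i. i < p - 1 \<Longrightarrow> (if i = j then k (p - 1) else k i) \<in> U"
  have kc: "k i l \<in> carrier R" if "i < p" for i l
    using g that tupE[of "k i" q l] by (simp add: gens_def)
  have rc: "r i \<in> carrier R" for i using r(1) tupE[of r p i] by (simp add: rels_def)
  have other: "k i \<in> U" if "i < p" "i \<noteq> j" for i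
    using kU[of i] kU[of j] that r(2) by (cases "i = p - 1") auto
  have rest: "(\<lambda>l. \<Oplus>\<^bsub>self_module R\<^esub>i\<in>A. k i l \<otimes> r i) \<in> U" if "finite A" "A \<subseteq> {..<p} - {j}" for A
    using that
  proof induction
    case empty
    have "(\<lambda>l. \<Oplus>\<^bsub>self_module R\<^esub>i\<in>{}. k i l \<otimes> r i) = (\<lambda>_. \<zero>)"
      using S.M.finsum_empty by simp
    then show ?case using tup_submoduleD(2)[OF U] by simp
  next
    case (insert a A)
    have a: "a < p" "a \<noteq> j" and A: "\<And>i. i \<in> A \<Longrightarrow> i < p" using insert.prems by auto
    have "(\<Oplus>\<^bsub>self_module R\<^esub>i\<in>insert a A. k i l \<otimes> r i) = r a \<otimes> k a l \<oplus> (\<Oplus>\<^bsub>self_module R\<^esub>i\<in>A. k i l \<otimes> r i)" for l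
      using insert(1,2) a A kc rc by (subst S.M.finsum_insert) (auto simp: m_comm)
    then show ?case
      using tup_submoduleD(3)[OF U tup_submoduleD(4)[OF U rc[of a] other[OF a]]] insert.IH insert.prems
      by simp
  qed
  define w where "w = (\<lambda>l. \<Oplus>\<^bsub>self_module R\<^esub>i\<in>{..<p} - {j}. k i l \<otimes> r i)"
  have w: "w \<in> U" unfolding w_def by (rule rest) auto
  have wc: "w l \<in> carrier R" for l using tupE[OF subsetD[OF tup_submoduleD(1)[OF U] w]] .
  have "k j l \<otimes> r j = \<ominus> w l" for l
  proof -
    have "lincomb (self_module R) k p r l = \<zero>" using r(1) by (simp add: rels_def)
    then have "\<zero> = (\<Oplus>\<^bsub>self_module R\<^esub>i\<in>insert j ({..<p} - {j}). k i l \<otimes> r i)"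
      using r(2) by (simp add: lincomb_def insert_absorb)
    also have "\<dots> = k j l \<otimes> r j \<oplus> w l"
      using r(2) kc rc by (subst S.M.finsum_insert) (auto simp: w_def)
    finally show ?thesis using kc[OF r(2)] rc wc by (simp add: minus_equality[symmetric] a_comm)
  qed
  then have kw: "k j l = inv (r j) \<otimes> \<ominus> w l" for l
    using kc[OF r(2)] rc[of j] r(3) by (simp add: m_lcomm[of "inv (r j)"] flip: \<open>\<And>l. k j l \<otimes> r j = \<ominus> w l\<close>)
  have "(\<lambda>l. inv (r j) \<otimes> \<ominus> w l) \<in> U"
    using tup_submoduleD(4)[OF U _ tup_submodule_neg[OF U w]] r(3) by simp
  then have "k j \<in> U" by (simp add: kw[symmetric])
  with other have "k i \<in> U" if "i < p" for i using that by (cases "i = j") auto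
  then show "K \<subseteq> U" by (rule gens_minimal[OF g U])
qed

end

lemma (in cring) cring_idealI:
  assumes "I \<subseteq> carrier R" "\<zero> \<in> I" "\<And>a b. a \<in> I \<Longrightarrow> b \<in> I \<Longrightarrow> a \<oplus> b \<in> I"
    "\<And>r a. r \<in> carrier R \<Longrightarrow> a \<in> I \<Longrightarrow> r \<otimes> a \<in> I"
  shows "ideal I R"
proof (rule idealI[OF ring_axioms])
  show "subgroup I (add_monoid R)"
  proof (rule add.subgroupI)
    fix a assume a: "a \<in> I"
    have "\<ominus> a = (\<ominus> \<one>) \<otimes> a" using a assms(1) by (auto simp: l_minus)
    then show "\<ominus> a \<in> I" using assms(4)[OF _ a, of "\<ominus> \<one>"] by simp
  qed (use assms in auto)
  fix a x assume "a \<in> I" "x \<in> carrier R"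
  then show "x \<otimes> a \<in> I" "a \<otimes> x \<in> I" using assms(1,4) m_comm[of a x] by auto
qed

locale noetherian_cring = cring R + noetherian_ring R for R (structure)
begin

text \<open>Induction on \<open>q\<close>: the last coordinates of the elements of \<open>K\<close>
  form an ideal. Lifts of its finitely many generators, together with generators of the submodule
  where the last coordinate is 0, generate \<open>K\<close>.\<close>

lemma finite_generation:
  "tup_submodule R q K \<Longrightarrow> \<exists>A. finite A \<and> A \<subseteq> K \<and> (\<forall>U. tup_submodule R q U \<longrightarrow> A \<subseteq> U \<longrightarrow> K \<subseteq> U)"
proof (induction q arbitrary: K)
  case 0
  have "K \<subseteq> {\<lambda>_. \<zero>}" using tup_submoduleD(1)[OF 0] by (auto simp: tup_def)
  then show ?case using tup_submoduleD(2) by (intro exI[of _ "{}"]) blast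
next
  case (Suc q)
  note K = Suc.prems
  have sub: "tup_submodule R q {x \<in> V. x q = \<zero>}" if V: "tup_submodule R (Suc q) V" for V
    unfolding tup_submodule_def
  proof (intro conjI ballI)
    show "{x \<in> V. x q = \<zero>} \<subseteq> tup R q"
    proof
      fix x assume "x \<in> {x \<in> V. x q = \<zero>}"
      then have x: "x \<in> tup R (Suc q)" "x q = \<zero>" using tup_submoduleD(1)[OF V] by auto
      have "x l = \<zero>" if "q \<le> l" for l
        using x that by (cases "l = q") (auto simp: tup_def)
      then show "x \<in> tup R q" using x by (auto simp: tup_def)
    qed
  qed (use tup_submoduleD(2-4)[OF V] in auto)
  have id: "ideal {x q | x. x \<in> V} R" if V: "tup_submodule R (Suc q) V" for V
  proof (rule cring_idealI)
    show "{x q | x. x \<in> V} \<subseteq> carrier R" using tup_submoduleD(1)[OF V] tupE by blast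
    show "\<zero> \<in> {x q | x. x \<in> V}" using tup_submoduleD(2)[OF V] by force
    show "a \<oplus> b \<in> {x q | x. x \<in> V}" if "a \<in> {x q | x. x \<in> V}" "b \<in> {x q | x. x \<in> V}" for a b
      using that tup_submoduleD(3)[OF V] by force
    show "r \<otimes> a \<in> {x q | x. x \<in> V}" if "r \<in> carrier R" "a \<in> {x q | x. x \<in> V}" for r a
      using that tup_submoduleD(4)[OF V] by force
  qed
  from finetely_gen[OF id[OF K]] obtain B where B: "B \<subseteq> carrier R" "finite B"
    "{x q | x. x \<in> K} = Idl B" by blast
  have "\<exists>x\<in>K. x q = b" if "b \<in> B" for b
  proof -
    have "b \<in> {x q | x. x \<in> K}" unfolding B(3) using genideal_self[OF B(1)] that by blast
    then show ?thesis by auto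
  qed
  then obtain c where c: "\<And>b. b \<in> B \<Longrightarrow> c b \<in> K \<and> c b q = b" by metis
  from Suc.IH[OF sub[OF K]] obtain A where A: "finite A" "A \<subseteq> {x \<in> K. x q = \<zero>}"
    "\<And>U. tup_submodule R q U \<Longrightarrow> A \<subseteq> U \<Longrightarrow> {x \<in> K. x q = \<zero>} \<subseteq> U" by blast
  show ?case
  proof (intro exI[of _ "A \<union> c ` B"] conjI allI impI)
    show "finite (A \<union> c ` B)" "A \<union> c ` B \<subseteq> K" using A B c by auto
    fix U assume U: "tup_submodule R (Suc q) U" and AU: "A \<union> c ` B \<subseteq> U"
    \<comment> \<open>The intersection is taken because the element matching the last coordinate of
      a given \<open>x\<close> must lie in \<open>K\<close> as well as in \<open>U\<close>; only
      then is the difference covered by the induction hypothesis.\<close>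
    have KU: "tup_submodule R (Suc q) (K \<inter> U)"
      using K U by (auto simp: tup_submodule_def)
    have "A \<subseteq> {x \<in> U. x q = \<zero>}" using A(2) AU by auto
    from A(3)[OF sub[OF U] this] have KU0: "{x \<in> K. x q = \<zero>} \<subseteq> U" by blast
    have "B \<subseteq> {x q | x. x \<in> K \<inter> U}"
    proof
      fix b assume "b \<in> B"
      then have "c b \<in> K \<inter> U" "b = c b q" using c AU by auto
      then show "b \<in> {x q | x. x \<in> K \<inter> U}" by blast
    qed
    then have L: "{x q | x. x \<in> K} \<subseteq> {x q | x. x \<in> K \<inter> U}"
      unfolding B(3) by (rule genideal_minimal[OF id[OF KU]])
    show "K \<subseteq> U"
    proof
      fix x assume x: "x \<in> K"
      then obtain u where u: "u \<in> K" "u \<in> U" "x q = u q" using L by blast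
      have xc: "x l \<in> carrier R" "u l \<in> carrier R" for l
        using tupE[OF subsetD[OF tup_submoduleD(1)[OF K] x]] tupE[OF subsetD[OF tup_submoduleD(1)[OF K] u(1)]]
        by auto
      have "(\<lambda>l. x l \<ominus> u l) \<in> U"
        using KU0 tup_submodule_diff[OF K x u(1)] u(3) xc by (auto simp: a_minus_def r_neg)
      from tup_submoduleD(3)[OF U this u(2)] have "(\<lambda>l. (x l \<ominus> u l) \<oplus> u l) \<in> U" .
      moreover have "(x l \<ominus> u l) \<oplus> u l = x l" for l using xc by (simp add: a_minus_def a_assoc l_neg)
      ultimately show "x \<in> U" by simp
    qed
  qed
qed

lemma exists_gens:
  assumes K: "tup_submodule R q K" shows "\<exists>k p. gens R q K k p"
proof -
  from finite_generation[OF K] obtain A where A: "finite A" "A \<subseteq> K"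
    "\<And>U. tup_submodule R q U \<Longrightarrow> A \<subseteq> U \<Longrightarrow> K \<subseteq> U" by blast
  from A(1) obtain p :: nat and k where k: "A = k ` {i. i < p}"
    using finite_imp_nat_seg_image_inj_on by blast
  have "gens R q K k p"
  proof (rule gensI[OF K])
    show "k j \<in> K" if "j < p" for j using A(2) k that by auto
    show "K \<subseteq> U" if "tup_submodule R q U" "\<And>j. j < p \<Longrightarrow> k j \<in> U" for U
      by (rule A(3)[OF that(1)]) (use k that(2) in auto)
  qed
  then show ?thesis by blast
qed

text \<open>A generating family of least length works, since a unit coefficient would make a
  generator redundant. The entries of a relation beyond \<open>p\<close> are 0, a nonunit in a
  nontrivial ring, so the claim can range over all \<open>j\<close>.\<close>

lemma exists_min_gens:
  assumes K: "tup_submodule R q K" and nontriv: "\<one> \<noteq> \<zero>"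
  shows "\<exists>k p. gens R q K k p \<and> (\<forall>r\<in>rels R k p. \<forall>j. r j \<notin> Units R)"
proof -
  define p where "p = (LEAST p. \<exists>k. gens R q K k p)"
  have "\<exists>p k. gens R q K k p" using exists_gens[OF K] by blast
  then have "\<exists>k. gens R q K k p" unfolding p_def by (rule LeastI_ex)
  then obtain k where k: "gens R q K k p" by blast
  have "r j \<notin> Units R" if r: "r \<in> rels R k p" for r j
  proof
    assume u: "r j \<in> Units R"
    have "r j \<noteq> \<zero>" using u nontriv by (auto simp: Units_def)
    then have j: "j < p" using r by (auto simp: rels_def tup_def not_le[symmetric])
    have "p \<le> p - 1"
      using Least_le[of "\<lambda>p. \<exists>k. gens R q K k p", folded p_def] gens_remove[OF k r j u] by blast
    then show False using j by simp
  qed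
  then show ?thesis using k by blast
qed

end

section \<open>Vanishing of Tor over a local ring with decomposable maximal ideal\<close>

text \<open>Projectivity of the terms enters only as \<open>coord_module\<close>. Both an arbitrary
  projective resolution and the minimal free one are instances.\<close>

locale coord_resolution = M: module R M
  for R :: "('r, 'x) ring_scheme" (structure) and M :: "('r, 'm, 'y) module_scheme" +
  fixes P :: "nat \<Rightarrow> ('r, 'p) module" and d :: "nat \<Rightarrow> 'p \<Rightarrow> 'p" and e :: "'p \<Rightarrow> 'm"
  assumes coord: "coord_module R (P n)"
    and d_hom: "d n \<in> mod_hom R (P (Suc n)) (P n)"
    and e_hom: "e \<in> mod_hom R (P 0) M"
    and e_surj: "e ` carrier (P 0) = carrier M"
    and exact_0: "d 0 ` carrier (P 1) = {x \<in> carrier (P 0). e x = \<zero>\<^bsub>M\<^esub>}"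
    and exact_Suc: "d (Suc n) ` carrier (P (Suc (Suc n))) = {x \<in> carrier (P (Suc n)). d n x = \<zero>\<^bsub>P n\<^esub>}"
begin

text \<open>This is \<open>Tor\<^sub>n\<^sub>+\<^sub>1(M, R\<^sup>q/K) = 0\<close>, hence \<open>Tor\<^sub>n(M, K) = 0\<close> if \<open>n \<ge> 1\<close>.\<close>

definition tor_vanishes :: "nat \<Rightarrow> nat \<Rightarrow> (nat \<Rightarrow> 'r) set \<Rightarrow> bool" where
  "tor_vanishes n q K \<longleftrightarrow>
     tensor_exact R (P (Suc (Suc n))) (d (Suc n)) (P (Suc n)) (d n) (P n) q K"

lemma four_Suc: "four_modules R (P (Suc (Suc (Suc n)))) (P (Suc (Suc n))) (P (Suc n)) (P n)
    (d (Suc (Suc n))) (d (Suc n)) (d n)"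
  by (intro four_modules.intro two_modules.intro two_modules_axioms.intro four_modules_axioms.intro
      coord_module_module[OF coord] d_hom exact_Suc)

lemma four_0: "four_modules R (P (Suc (Suc 0))) (P (Suc 0)) (P 0) M (d (Suc 0)) (d 0) e"
  using exact_0
  by (intro four_modules.intro two_modules.intro two_modules_axioms.intro four_modules_axioms.intro
      coord_module_module[OF coord] d_hom exact_Suc e_hom M.module_axioms) simp_all

text \<open>\<open>K\<close> is isomorphic to R^p modulo the relations of \<open>k\<close>, and Tor
  of a free module vanishes in positive degrees: this is the dimension shift in the second
  argument.\<close>

lemma tor_vanishes_Suc:
  assumes g: "gens R q K k p"
  shows "tor_vanishes (Suc n) q K \<longleftrightarrow> tor_vanishes n p (rels R k p)"
proof -
  interpret four_modules R "P (Suc (Suc (Suc n)))" "P (Suc (Suc n))" "P (Suc n)" "P n"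
    "d (Suc (Suc n))" "d (Suc n)" "d n" by (rule four_Suc)
  have kt: "\<And>j. j < p \<Longrightarrow> k j \<in> tup R q" using g by (simp add: gens_def)
  show ?thesis
    unfolding tor_vanishes_def
    using tensor_exact_imp_rels_exact[OF coord g] rels_exact_imp_tensor_exact[OF g]
      rels_exact_imp_tensor_exact_rels[of p k q, OF kt] tensor_exact_rels_imp_rels_exact[OF coord, of p k q, OF kt]
    by blast
qed

lemma tor_vanishes_0:
  assumes g: "gens R q K k p"
  shows "tor_vanishes 0 q K \<longleftrightarrow>
    (\<forall>y\<in>tup M p. lincomb M k p y = (\<lambda>_. \<zero>\<^bsub>M\<^esub>) \<longrightarrow> y \<in> dot_span M (rels R k p))"
proof -
  interpret four_modules R "P (Suc (Suc 0))" "P (Suc 0)" "P 0" M "d (Suc 0)" "d 0" e by (rule four_0)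
  have kt: "\<And>j. j < p \<Longrightarrow> k j \<in> tup R q" using g by (simp add: gens_def)
  show ?thesis
    unfolding tor_vanishes_def
    using tensor_exact_imp_rels_exact[OF coord g] rels_exact_imp_tensor_exact[OF g]
      rels_exact_iff_cokernel[OF e_surj, of p k q, OF kt]
    by blast
qed

lemma tor_vanishes_rels_exact:
  assumes g: "gens R q K k p" and v: "tor_vanishes (Suc n) q K"
  shows "rels_exact R (P (Suc (Suc n))) (d (Suc n)) (P (Suc n)) (d n) (P n) k p"
proof -
  interpret four_modules R "P (Suc (Suc (Suc n)))" "P (Suc (Suc n))" "P (Suc n)" "P n"
    "d (Suc (Suc n))" "d (Suc n)" "d n" by (rule four_Suc)
  show ?thesis using v tensor_exact_imp_rels_exact[OF coord g] unfolding tor_vanishes_def by blast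
qed

lemma tor_vanishes_trivial: "tor_vanishes n q {\<lambda>_. \<zero>}"
  unfolding tor_vanishes_def
  by (cases n) (auto intro: four_modules.tensor_exact_trivial[OF four_0]
      four_modules.tensor_exact_trivial[OF four_Suc])

lemma tor_vanishes_restrict:
  assumes "q' \<le> q" "K \<subseteq> tup R q'" "tor_vanishes n q K" shows "tor_vanishes n q' K"
  using assms unfolding tor_vanishes_def
  by (cases n) (auto intro: four_modules.tensor_exact_restrict[OF four_0]
      four_modules.tensor_exact_restrict[OF four_Suc])

lemma tor_vanishes_summand:
  assumes "tup_submodule R q S" "tup_submodule R q T" "S \<subseteq> U" "T \<subseteq> U"
    and "\<And>x. x \<in> U \<Longrightarrow> \<exists>a\<in>S. \<exists>b\<in>T. x = (\<lambda>l. a l \<oplus> b l)"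
    and "S \<inter> T \<subseteq> {\<lambda>_. \<zero>}" and "tor_vanishes n q U"
  shows "tor_vanishes n q S"
proof (cases n)
  case 0
  show ?thesis
    using assms(7) four_modules.tensor_exact_summand[OF four_0 coord assms(1-6)]
    unfolding tor_vanishes_def 0 by blast
next
  case (Suc n')
  show ?thesis
    using assms(7) four_modules.tensor_exact_summand[OF four_Suc coord assms(1-6)]
    unfolding tor_vanishes_def Suc by blast
qed

end

text \<open>No comparison map between the resolutions is built. The generators and relations chosen
  in the second argument serve both resolutions at once, and in degree 0 both conditions become the
  same statement about \<open>M\<close>.\<close>

lemma tor_vanishes_independent:
  assumes "noetherian_cring R" "coord_resolution R M P d e" "coord_resolution R M P' d' e'"
    "tup_submodule R q K" "coord_resolution.tor_vanishes R P d n q K"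
  shows "coord_resolution.tor_vanishes R P' d' n q K"
  using assms(4,5)
proof (induction n arbitrary: q K)
  case 0
  then obtain k p where g: "gens R q K k p" using noetherian_cring.exists_gens[OF assms(1)] by blast
  show ?case
    using 0(2) coord_resolution.tor_vanishes_0[OF assms(2) g] coord_resolution.tor_vanishes_0[OF assms(3) g]
    by simp
next
  case (Suc n)
  then obtain k p where g: "gens R q K k p" using noetherian_cring.exists_gens[OF assms(1)] by blast
  have "tup_submodule R p (rels R k p)"
    using g assms(1) cring.tup_submodule_rels[of R p k q] by (simp add: gens_def noetherian_cring_def)
  then show ?case
    using Suc coord_resolution.tor_vanishes_Suc[OF assms(2) g] coord_resolution.tor_vanishes_Suc[OF assms(3) g]
    by simp
qed

section \<open>Tuples with entries in an ideal\<close>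

context cring begin

lemma lincomb_single:
  assumes "\<And>j. j < p \<Longrightarrow> k j \<in> tup R q" "i < p" "a \<in> carrier R"
  shows "lincomb (self_module R) k p (\<lambda>j. if j = i then a else \<zero>) = (\<lambda>l. k i l \<otimes> a)"
proof
  fix l
  interpret S: module R "self_module R" by (rule self_module)
  have kc: "k j l \<in> carrier R" if "j < p" for j using tupE[OF assms(1)[OF that]] .
  have "(\<Oplus>\<^bsub>self_module R\<^esub>j\<in>{..<p}. k j l \<otimes> (if j = i then a else \<zero>)) =
      (\<Oplus>\<^bsub>self_module R\<^esub>j\<in>{..<p}. if i = j then k j l \<otimes> a else \<zero>\<^bsub>self_module R\<^esub>)"
    using kc assms(3) by (intro S.M.finsum_cong') auto
  also have "\<dots> = k i l \<otimes> a"
    using kc assms(2,3) by (intro S.M.finsum_singleton) auto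
  finally show "lincomb (self_module R) k p (\<lambda>j. if j = i then a else \<zero>) l = k i l \<otimes> a"
    by (simp add: lincomb_def)
qed

definition ideal_tup :: "'a set \<Rightarrow> nat \<Rightarrow> (nat \<Rightarrow> 'a) set" where
  "ideal_tup I q = {x \<in> tup R q. \<forall>l. x l \<in> I}"

lemma tup_submodule_ideal_tup:
  assumes "ideal I R" shows "tup_submodule R q (ideal_tup I q)"
proof -
  interpret ideal I R by fact
  show ?thesis
    unfolding tup_submodule_def ideal_tup_def
    by (auto simp: tup_def I_l_closed)
qed

lemma lincomb_ideal:
  assumes "ideal I R" "\<And>j. j < p \<Longrightarrow> k j \<in> tup R q" "x \<in> ideal_tup I p"
  shows "lincomb (self_module R) k p x \<in> ideal_tup I q"
proof -
  interpret ideal I R by fact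
  interpret S: module R "self_module R" by (rule self_module)
  have kc: "k j l \<in> carrier R" if "j < p" for j l using tupE[OF assms(2)[OF that]] .
  have x: "x \<in> tup R p" "\<And>j. x j \<in> I" using assms(3) by (auto simp: ideal_tup_def)
  have "(\<Oplus>\<^bsub>self_module R\<^esub>j\<in>A. k j l \<otimes> x j) \<in> I" if "finite A" "A \<subseteq> {..<p}" for A l
    using that
  proof induction
    case (insert a A)
    then have "(\<Oplus>\<^bsub>self_module R\<^esub>j\<in>insert a A. k j l \<otimes> x j) = k a l \<otimes> x a \<oplus> (\<Oplus>\<^bsub>self_module R\<^esub>j\<in>A. k j l \<otimes> x j)"
      using kc Icarr[OF x(2)] by (subst S.M.finsum_insert) (auto simp: subset_eq)
    then show ?case using insert kc x(2) by (auto simp: I_l_closed)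
  qed (use S.M.finsum_empty in simp)
  then show ?thesis
    using S.lincomb_closed[of p k q x] assms(2) x(1) by (simp add: ideal_tup_def) (simp add: lincomb_def)
qed

end

text \<open>An abstraction of the fiber product: the nonunits are exactly the sums of an element of
  \<open>I\<close> and one of \<open>J\<close>. The annihilator assumptions carry the hypothesis on
  discrete valuation domains: a generator of \<open>I\<close>, if \<open>I\<close> is principal, is
  killed by a nonzero element of \<open>I\<close>, and likewise for \<open>J\<close>. The
  assumptions are symmetric, so facts proved for \<open>I\<close> transfer to \<open>J\<close> by
  \<open>swap\<close>.\<close>

locale split_local_ring = noetherian_cring R + I: ideal I R + J: ideal J R
  for R (structure) and I and J +
  assumes inter: "I \<inter> J = {\<zero>}"
    and split: "\<lbrakk>r \<in> carrier R; r \<notin> Units R\<rbrakk> \<Longrightarrow> \<exists>a\<in>I. \<exists>b\<in>J. r = a \<oplus> b"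
    and nonunit: "\<lbrakk>a \<in> I; b \<in> J\<rbrakk> \<Longrightarrow> a \<oplus> b \<notin> Units R"
    and I_nonzero: "I \<noteq> {\<zero>}" and J_nonzero: "J \<noteq> {\<zero>}"
    and I_annihilator: "\<lbrakk>x \<in> I; \<And>y. y \<in> I \<Longrightarrow> \<exists>r\<in>carrier R. y = r \<otimes> x\<rbrakk> \<Longrightarrow> \<exists>a\<in>I. a \<noteq> \<zero> \<and> a \<otimes> x = \<zero>"
    and J_annihilator: "\<lbrakk>x \<in> J; \<And>y. y \<in> J \<Longrightarrow> \<exists>r\<in>carrier R. y = r \<otimes> x\<rbrakk> \<Longrightarrow> \<exists>a\<in>J. a \<noteq> \<zero> \<and> a \<otimes> x = \<zero>"
begin

lemma swap: "split_local_ring R J I"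
proof -
  have "\<exists>a\<in>J. \<exists>b\<in>I. r = a \<oplus> b" if r: "r \<in> carrier R" "r \<notin> Units R" for r
    using split[OF r] I.Icarr J.Icarr a_comm by metis
  moreover have "a \<oplus> b \<notin> Units R" if "a \<in> J" "b \<in> I" for a b
    using nonunit[OF that(2,1)] a_comm[OF I.Icarr[OF that(2)] J.Icarr[OF that(1)]] by simp
  ultimately show ?thesis
    using inter I_nonzero J_nonzero I_annihilator J_annihilator
    by (intro split_local_ring.intro split_local_ring_axioms.intro noetherian_cring_axioms
        I.ideal_axioms J.ideal_axioms) auto
qed

lemma mult_IJ: "a \<in> I \<Longrightarrow> b \<in> J \<Longrightarrow> a \<otimes> b = \<zero>"
  using inter I.I_r_closed[of a b] J.I_l_closed[of b a] I.Icarr J.Icarr by blast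

lemma nontrivial: "\<one> \<noteq> \<zero>"
proof
  assume "\<one> = \<zero>"
  then have "\<zero> \<oplus> \<zero> \<in> Units R" using Units_one_closed by simp
  then show False using nonunit[OF I.zero_closed J.zero_closed] by simp
qed

lemma ideal_tup_rels:
  assumes "\<And>j. j < p \<Longrightarrow> k j \<in> ideal_tup I q" "x \<in> ideal_tup J p"
  shows "x \<in> rels R k p"
proof -
  interpret S: module R "self_module R" by (rule self_module)
  have "lincomb (self_module R) k p x l = \<zero>" for l
  proof -
    have "(\<Oplus>\<^bsub>self_module R\<^esub>j\<in>{..<p}. k j l \<otimes> x j) = (\<Oplus>\<^bsub>self_module R\<^esub>j\<in>{..<p}. \<zero>\<^bsub>self_module R\<^esub>)"
      using assms mult_IJ by (intro S.M.finsum_cong') (auto simp: ideal_tup_def)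
    then show ?thesis by (simp add: lincomb_def) (metis S.M.finsum_zero self_module_simps(2))
  qed
  then show ?thesis using assms(2) by (auto simp: rels_def ideal_tup_def)
qed

lemma nonunit_tup_split:
  assumes "r \<in> tup R p" "\<And>j. r j \<notin> Units R"
  shows "\<exists>a\<in>ideal_tup I p. \<exists>b\<in>ideal_tup J p. r = (\<lambda>j. a j \<oplus> b j)"
proof -
  have "\<forall>j. \<exists>u v. u \<in> I \<and> v \<in> J \<and> r j = u \<oplus> v" using split[OF tupE[OF assms(1)] assms(2)] by blast
  then obtain u v where uv: "\<And>j. u j \<in> I" "\<And>j. v j \<in> J" "\<And>j. r j = u j \<oplus> v j" by metis
  define a where "a = (\<lambda>j. if j < p then u j else \<zero>)"
  define b where "b = (\<lambda>j. if j < p then v j else \<zero>)"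
  have "r j = a j \<oplus> b j" for j
    using uv(3)[of j] assms(1) by (auto simp: a_def b_def tup_def)
  moreover have "a \<in> ideal_tup I p" "b \<in> ideal_tup J p"
    using uv(1,2) I.Icarr J.Icarr by (auto simp: a_def b_def ideal_tup_def tup_def)
  ultimately show ?thesis by blast
qed

lemma ideal_tup_inter: "ideal_tup I q \<inter> ideal_tup J q \<subseteq> {\<lambda>_. \<zero>}"
  using inter by (auto simp: ideal_tup_def)

lemma rels_split:
  assumes kt: "\<And>j. j < p \<Longrightarrow> k j \<in> tup R q" and r: "r \<in> rels R k p" and nu: "\<And>j. r j \<notin> Units R"
  shows "\<exists>a\<in>rels R k p \<inter> ideal_tup I p. \<exists>b\<in>rels R k p \<inter> ideal_tup J p. r = (\<lambda>j. a j \<oplus> b j)"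
proof -
  interpret S: module R "self_module R" by (rule self_module)
  have rt: "r \<in> tup R p" using r by (simp add: rels_def)
  from nonunit_tup_split[OF rt nu] obtain a b where a: "a \<in> ideal_tup I p" and b: "b \<in> ideal_tup J p"
    and rab: "r = (\<lambda>j. a j \<oplus> b j)" by blast
  define la where "la = lincomb (self_module R) k p a"
  define lb where "lb = lincomb (self_module R) k p b"
  have la: "la \<in> ideal_tup I q" unfolding la_def by (rule lincomb_ideal[OF I.ideal_axioms kt a])
  have lb: "lb \<in> ideal_tup J q" unfolding lb_def by (rule lincomb_ideal[OF J.ideal_axioms kt b])
  have at: "a \<in> tup R p" "b \<in> tup R p" using a b by (auto simp: ideal_tup_def)
  have sum: "la l \<oplus> lb l = \<zero>" for l
    using S.lincomb_add[of p k q a b] kt at r by (simp add: la_def lb_def rels_def rab fun_eq_iff)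
  \<comment> \<open>The two combinations are negatives of each other, so the one in \<open>I\<close>
    also lies in \<open>J\<close> and both are 0.\<close>
  have "la l \<in> J" for l
  proof -
    have "lb l \<in> J" "la l \<in> carrier R" "lb l \<in> carrier R"
      using la lb I.Icarr J.Icarr by (auto simp: ideal_tup_def)
    then show ?thesis using minus_equality[OF sum[of l]] J.a_inv_closed[of "lb l"] by simp
  qed
  then have "la = (\<lambda>_. \<zero>)" using la inter by (auto simp: ideal_tup_def)
  moreover have "lb = (\<lambda>_. \<zero>)"
    using sum calculation lb J.Icarr by (auto simp: ideal_tup_def)
  ultimately show ?thesis using a b at rab by (auto simp: rels_def la_def lb_def)
qed

lemma tup_submodule_inter:
  "tup_submodule R q A \<Longrightarrow> tup_submodule R q B \<Longrightarrow> tup_submodule R q (A \<inter> B)"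
  by (auto simp: tup_submodule_def)

end

locale split_resolution = split_local_ring R I J + coord_resolution R M P d e
  for R (structure) and I J M P d e
begin

lemma swap_resolution: "split_resolution R J I M P d e"
  by (intro split_resolution.intro swap coord_resolution_axioms)

lemma gens_positive:
  assumes "gens R q A k p" "A \<noteq> {\<lambda>_. \<zero>}" shows "0 < p"
proof (rule ccontr)
  assume "\<not> 0 < p"
  then have "p = 0" by simp
  interpret S: module R "self_module R" by (rule self_module)
  have "lincomb (self_module R) k 0 x = (\<lambda>_. \<zero>)" for x
    unfolding lincomb_def using S.M.finsum_empty by simp
  then have "A = {\<lambda>_. \<zero>}"
    using assms(1) \<open>p = 0\<close> by (auto simp: gens_def tup_def)
  then show False using assms(2) by simp
qed

text \<open>A relation \<open>r\<close> between minimal generators of \<open>A\<close> has \<open>r\<^sub>0 = a + b\<close> with \<open>a \<in> I\<close> and \<open>b \<in> J\<close>. As \<open>J\<close> kills \<open>A\<close>,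
  all of \<open>J e\<^sub>0\<close> consists of relations, and it is complemented by the relations with \<open>r\<^sub>0 \<in> I\<close>.\<close>

lemma step_to_J:
  assumes A: "tup_submodule R q A" "A \<subseteq> ideal_tup I q" "A \<noteq> {\<lambda>_. \<zero>}" and v: "tor_vanishes (Suc n) q A"
  shows "tor_vanishes n 1 (ideal_tup J 1)"
proof -
  obtain k p where g: "gens R q A k p" and min: "\<And>r j. r \<in> rels R k p \<Longrightarrow> r j \<notin> Units R"
    using exists_min_gens[OF A(1) nontrivial] by blast
  have p: "0 < p" by (rule gens_positive[OF g A(3)])
  have kt: "\<And>j. j < p \<Longrightarrow> k j \<in> tup R q" using g by (simp add: gens_def)
  have kI: "\<And>j. j < p \<Longrightarrow> k j \<in> ideal_tup I q" using module.gens_mem[OF self_module g] A(2) by blast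
  have rs: "tup_submodule R p (rels R k p)" by (rule tup_submodule_rels[of p k q, OF kt])
  define S where "S = {x \<in> ideal_tup J p. \<forall>l\<ge>1. x l = \<zero>}"
  define T where "T = {x \<in> rels R k p. x 0 \<in> I}"
  have S: "tup_submodule R p S"
    using tup_submodule_ideal_tup[OF J.ideal_axioms, of p] by (auto simp: tup_submodule_def S_def)
  have T: "tup_submodule R p T"
    using rs by (auto simp: tup_submodule_def T_def I.I_l_closed)
  have "tor_vanishes n p S"
  proof (rule tor_vanishes_summand[OF S T])
    show SU: "S \<subseteq> rels R k p" using ideal_tup_rels[of p k q, OF kI] by (auto simp: S_def)
    show "T \<subseteq> rels R k p" by (auto simp: T_def)
    show "tor_vanishes n p (rels R k p)" using v tor_vanishes_Suc[OF g] by simp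
    show "S \<inter> T \<subseteq> {\<lambda>_. \<zero>}"
    proof
      fix x assume "x \<in> S \<inter> T"
      then have "x 0 = \<zero>" "\<And>l. l \<ge> 1 \<Longrightarrow> x l = \<zero>" using inter by (auto simp: S_def T_def ideal_tup_def)
      then have "x l = \<zero>" for l by (cases l) auto
      then show "x \<in> {\<lambda>_. \<zero>}" by auto
    qed
    fix r assume r: "r \<in> rels R k p"
    have rc: "r l \<in> carrier R" for l using tupE[of r p l] r by (simp add: rels_def)
    obtain a b where ab: "a \<in> I" "b \<in> J" "r 0 = a \<oplus> b" using split[OF rc min[OF r]] by blast
    define s where "s = (\<lambda>l::nat. if l = 0 then b else \<zero>)"
    have s: "s \<in> S" using ab p J.Icarr by (auto simp: s_def S_def ideal_tup_def tup_def)
    have t: "(\<lambda>l. r l \<ominus> s l) \<in> rels R k p"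
      using tup_submodule_diff[OF rs r] s SU by blast
    have "r 0 \<ominus> s 0 = a" using ab I.Icarr J.Icarr by (simp add: s_def a_minus_def a_assoc r_neg)
    then have t': "(\<lambda>l. r l \<ominus> s l) \<in> T" using t ab by (simp add: T_def)
    have "r = (\<lambda>l. s l \<oplus> (r l \<ominus> s l))"
    proof
      fix l
      have "s l \<in> carrier R" using ab J.Icarr by (simp add: s_def)
      then show "r l = s l \<oplus> (r l \<ominus> s l)" using rc[of l] by (simp add: a_minus_def a_lcomm r_neg)
    qed
    then show "\<exists>a\<in>S. \<exists>b\<in>T. r = (\<lambda>l. a l \<oplus> b l)" by (rule bexI[OF bexI[OF _ t'] s])
  qed
  \<comment> \<open>Tuples are extended by zero, so the copy of \<open>J\<close> in coordinate 0 of
    R^p is literally the same set as \<open>J\<close> inside R^1.\<close>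
  moreover have "S = ideal_tup J 1"
    using p by (auto simp: S_def ideal_tup_def tup_def)
  ultimately show ?thesis using tor_vanishes_restrict[of 1 p "ideal_tup J 1" n] p
    by (auto simp: ideal_tup_def)
qed

lemma ideal_tup_nonzero: "ideal_tup I 1 \<noteq> {\<lambda>_. \<zero>}"
proof -
  obtain a where a: "a \<in> I" "a \<noteq> \<zero>" using I_nonzero I.zero_closed by blast
  have "(\<lambda>l. if l = 0 then a else \<zero>) \<in> ideal_tup I 1"
    using a I.Icarr by (auto simp: ideal_tup_def tup_def)
  moreover have "(\<lambda>l. if l = 0 then a else \<zero>) \<noteq> (\<lambda>_. \<zero>)" using a(2) by (metis (full_types))
  ultimately show ?thesis by blast
qed

lemma I_to_J: "tor_vanishes (Suc n) 1 (ideal_tup I 1) \<Longrightarrow> tor_vanishes n 1 (ideal_tup J 1)"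
  using step_to_J[OF tup_submodule_ideal_tup[OF I.ideal_axioms] _ ideal_tup_nonzero] by blast

lemma J_to_I: "tor_vanishes (Suc n) 1 (ideal_tup J 1) \<Longrightarrow> tor_vanishes n 1 (ideal_tup I 1)"
  by (rule split_resolution.I_to_J[OF swap_resolution])

text \<open>If one generator suffices, the assumption on annihilators supplies the relation. With at
  least two generators the Koszul relation between the first two works: coefficient
  \<open>k 1 0\<close> at place 0 and the negative of \<open>k 0 0\<close> at place 1, both in
  \<open>I\<close>.\<close>

lemma nonzero_syzygy:
  assumes g: "gens R 1 (ideal_tup I 1) k p" and min: "\<And>r j. r \<in> rels R k p \<Longrightarrow> r j \<notin> Units R"
  shows "rels R k p \<inter> ideal_tup I p \<noteq> {\<lambda>_. \<zero>}"
proof -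
  interpret S: module R "self_module R" by (rule self_module)
  have p: "0 < p" by (rule gens_positive[OF g ideal_tup_nonzero])
  have kt: "\<And>j. j < p \<Longrightarrow> k j \<in> tup R 1" using g by (simp add: gens_def)
  have kI: "\<And>j l. j < p \<Longrightarrow> k j l \<in> I" using S.gens_mem[OF g] by (auto simp: ideal_tup_def)
  have kc: "\<And>j l. j < p \<Longrightarrow> k j l \<in> carrier R" using kI I.Icarr by blast
  have single: "(\<lambda>j. if j = i then a else \<zero>) \<in> ideal_tup I p" if "i < p" "a \<in> I" for i a
    using that I.Icarr by (auto simp: ideal_tup_def tup_def)
  show ?thesis
  proof (cases "p = 1")
    case True
    have "\<exists>r\<in>carrier R. y = r \<otimes> k 0 0" if y: "y \<in> I" for y
    proof -
      have "(\<lambda>l. if l = 0 then y else \<zero>) \<in> ideal_tup I 1"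
        using y I.Icarr by (auto simp: ideal_tup_def tup_def)
      then obtain r where r: "r \<in> tup R p" "(\<lambda>l. if l = 0 then y else \<zero>) = lincomb (self_module R) k p r"
        using g unfolding gens_def by blast
      have "r = (\<lambda>j. if j = 0 then r 0 else \<zero>)" using r(1) True by (auto simp: tup_def)
      then have "lincomb (self_module R) k p r = (\<lambda>l. k 0 l \<otimes> r 0)"
        using lincomb_single[of p k 1 0 "r 0"] kt p tupE[OF r(1)] by simp
      then have "y = k 0 0 \<otimes> r 0" using fun_cong[OF r(2), of 0] by simp
      then show ?thesis using tupE[OF r(1), of 0] kc[OF p] m_comm by blast
    qed
    then obtain a where a: "a \<in> I" "a \<noteq> \<zero>" "a \<otimes> k 0 0 = \<zero>" using I_annihilator[OF kI[OF p]] by blast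
    have "k 0 l \<otimes> a = \<zero>" for l
      using a(1,3) I.Icarr kc[OF p] kt[OF p] m_comm by (cases l) (auto simp: tup_def)
    then have "lincomb (self_module R) k p (\<lambda>j. if j = 0 then a else \<zero>) = (\<lambda>_. \<zero>)"
      using lincomb_single[of p k 1 0 a] kt p a(1) I.Icarr by simp
    then have "(\<lambda>j. if j = 0 then a else \<zero>) \<in> rels R k p \<inter> ideal_tup I p"
      using single[OF p a(1)] by (auto simp: rels_def ideal_tup_def)
    moreover have "(\<lambda>j. if j = 0 then a else \<zero>) \<noteq> (\<lambda>_::nat. \<zero>)" using a(2) by (metis (full_types))
    ultimately show ?thesis by blast
  next
    case False
    then have p1: "1 < p" using p by simp
    \<comment> \<open>A zero generator would satisfy the relation with the unit 1 as coefficient,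
      against minimality.\<close>
    have k0: "k 0 0 \<noteq> \<zero>"
    proof
      assume 0: "k 0 0 = \<zero>"
      have "k 0 l = \<zero>" for l using 0 kt[OF p] by (cases l) (auto simp: tup_def)
      then have "lincomb (self_module R) k p (\<lambda>j. if j = 0 then \<one> else \<zero>) = (\<lambda>_. \<zero>)"
        using lincomb_single[of p k 1 0 \<one>] kt p by simp
      then have "(\<lambda>j. if j = 0 then \<one> else \<zero>) \<in> rels R k p"
        using p by (auto simp: rels_def tup_def)
      from min[OF this, of 0] show False by simp
    qed
    define u where "u = (\<lambda>j::nat. if j = 0 then k 1 0 else \<zero>)"
    define v where "v = (\<lambda>j::nat. if j = 1 then \<ominus> k 0 0 else \<zero>)"
    have u: "u \<in> ideal_tup I p" unfolding u_def by (rule single[OF p kI[OF p1]])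
    have v: "v \<in> ideal_tup I p" unfolding v_def using single[OF p1] kI[OF p] I.a_inv_closed by blast
    have uv: "(\<lambda>j. u j \<oplus> v j) \<in> ideal_tup I p"
      using tup_submoduleD(3)[OF tup_submodule_ideal_tup[OF I.ideal_axioms] u v] .
    have "lincomb (self_module R) k p (\<lambda>j. u j \<oplus> v j) = (\<lambda>l. k 0 l \<otimes> k 1 0 \<oplus> k 1 l \<otimes> (\<ominus> k 0 0))"
      using S.lincomb_add[of p k 1 u v] u v kt lincomb_single[of p k 1 0 "k 1 0"]
        lincomb_single[of p k 1 1 "\<ominus> k 0 0"] p p1 kc by (simp add: u_def v_def ideal_tup_def)
    also have "\<dots> = (\<lambda>_. \<zero>)"
    proof
      fix l
      show "k 0 l \<otimes> k 1 0 \<oplus> k 1 l \<otimes> (\<ominus> k 0 0) = \<zero>"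
        using kc[OF p] kc[OF p1] kt[OF p] kt[OF p1]
        by (cases l) (auto simp: tup_def r_minus m_comm r_neg)
    qed
    finally have "(\<lambda>j. u j \<oplus> v j) \<in> rels R k p \<inter> ideal_tup I p"
      using uv by (auto simp: rels_def ideal_tup_def)
    moreover have "u 1 \<oplus> v 1 \<noteq> \<zero>"
    proof
      assume "u 1 \<oplus> v 1 = \<zero>"
      then have "\<ominus> k 0 0 = \<zero>" using kc[OF p] by (simp add: u_def v_def)
      then have "\<ominus> (\<ominus> k 0 0) = \<zero>" by simp
      then show False using k0 kc[OF p] by simp
    qed
    then have "(\<lambda>j. u j \<oplus> v j) \<noteq> (\<lambda>_. \<zero>)" by (auto dest: fun_cong[of _ _ "1::nat"])
    ultimately show ?thesis by blast
  qed
qed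

lemma tor_vanishes_rels_I:
  assumes kt: "\<And>j. j < p \<Longrightarrow> k j \<in> tup R q" and min: "\<forall>r\<in>rels R k p. \<forall>j. r j \<notin> Units R"
    and v: "tor_vanishes n p (rels R k p)"
  shows "tup_submodule R p (rels R k p \<inter> ideal_tup I p)" "tor_vanishes n p (rels R k p \<inter> ideal_tup I p)"
proof -
  have rs: "tup_submodule R p (rels R k p)" by (rule tup_submodule_rels[of p k q, OF kt])
  show S: "tup_submodule R p (rels R k p \<inter> ideal_tup I p)"
    by (rule tup_submodule_inter[OF rs tup_submodule_ideal_tup[OF I.ideal_axioms]])
  have T: "tup_submodule R p (rels R k p \<inter> ideal_tup J p)"
    by (rule tup_submodule_inter[OF rs tup_submodule_ideal_tup[OF J.ideal_axioms]])
  show "tor_vanishes n p (rels R k p \<inter> ideal_tup I p)"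
  proof (rule tor_vanishes_summand[OF S T _ _ _ _ v])
    show "\<exists>a\<in>rels R k p \<inter> ideal_tup I p. \<exists>b\<in>rels R k p \<inter> ideal_tup J p. x = (\<lambda>l. a l \<oplus> b l)"
      if "x \<in> rels R k p" for x
      using rels_split[of p k q, OF kt that] min that by blast
  qed (use ideal_tup_inter in auto)
qed

lemma ideals_from_I:
  assumes v: "tor_vanishes 3 1 (ideal_tup I 1)"
  shows "tor_vanishes 1 1 (ideal_tup I 1) \<and> tor_vanishes 1 1 (ideal_tup J 1)"
proof
  have v': "tor_vanishes (Suc (Suc 1)) 1 (ideal_tup I 1)" using v by (simp add: numeral_3_eq_3)
  show "tor_vanishes 1 1 (ideal_tup I 1)" using J_to_I[OF I_to_J[OF v']] .
  have II: "tup_submodule R 1 (ideal_tup I 1)" by (rule tup_submodule_ideal_tup[OF I.ideal_axioms])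
  obtain k p where g: "gens R 1 (ideal_tup I 1) k p" and
    min: "\<And>r j. r \<in> rels R k p \<Longrightarrow> r j \<notin> Units R"
    using exists_min_gens[OF II nontrivial] by blast
  have kt: "\<And>j. j < p \<Longrightarrow> k j \<in> tup R 1" using g by (simp add: gens_def)
  have "tor_vanishes (Suc 1) p (rels R k p)" using v' tor_vanishes_Suc[OF g] by simp
  moreover have "\<forall>r\<in>rels R k p. \<forall>j. r j \<notin> Units R" using min by blast
  ultimately have S: "tup_submodule R p (rels R k p \<inter> ideal_tup I p)"
    "tor_vanishes (Suc 1) p (rels R k p \<inter> ideal_tup I p)"
    using tor_vanishes_rels_I[of p k 1, OF kt] by blast+
  have "rels R k p \<inter> ideal_tup I p \<noteq> {\<lambda>_. \<zero>}"
    by (rule nonzero_syzygy[OF g]) (rule min)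
  then show "tor_vanishes 1 1 (ideal_tup J 1)"
    using S(2) by (intro step_to_J[OF S(1)]) auto
qed

text \<open>Each step lowers the degree by one and exchanges \<open>I\<close> and \<open>J\<close>.
  Which of the two is reached in degree 3 depends on parity, hence the disjunction.\<close>

lemma ideals_from_either:
  assumes "n \<ge> 3" "tor_vanishes n 1 (ideal_tup I 1) \<or> tor_vanishes n 1 (ideal_tup J 1)"
  shows "tor_vanishes 1 1 (ideal_tup I 1) \<and> tor_vanishes 1 1 (ideal_tup J 1)"
  using assms
proof (induction n rule: dec_induct)
  case base
  then show ?case
    using ideals_from_I split_resolution.ideals_from_I[OF swap_resolution] by blast
next
  case (step n)
  then show ?case using I_to_J J_to_I by blast
qed

lemma ideals_from_syzygy:
  assumes g: "gens R q K k p" and min: "\<And>r j. r \<in> rels R k p \<Longrightarrow> r j \<notin> Units R"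
    and nz: "rels R k p \<noteq> {\<lambda>_. \<zero>}" and n: "n \<ge> 5" and v: "tor_vanishes n q K"
  shows "tor_vanishes 1 1 (ideal_tup I 1) \<and> tor_vanishes 1 1 (ideal_tup J 1)"
proof -
  \<comment> \<open>One degree is spent on passing from \<open>K\<close> to the relations, one on
    \<open>step_to_J\<close>; from 5 at least 3 remain, where \<open>ideals_from_either\<close>
    starts.\<close>
  obtain n' where n': "n = Suc (Suc n')" "n' \<ge> 3" using n by (intro that[of "n - 2"]) auto
  have kt: "\<And>j. j < p \<Longrightarrow> k j \<in> tup R q" using g by (simp add: gens_def)
  have v': "tor_vanishes (Suc n') p (rels R k p)" using v tor_vanishes_Suc[OF g] n' by simp
  have min': "\<forall>r\<in>rels R k p. \<forall>j. r j \<notin> Units R" using min by blast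
  note S = tor_vanishes_rels_I[of p k q, OF kt min' v']
  note T = split_resolution.tor_vanishes_rels_I[OF swap_resolution, of p k q, OF kt min' v']
  have "rels R k p \<inter> ideal_tup I p \<noteq> {\<lambda>_. \<zero>} \<or> rels R k p \<inter> ideal_tup J p \<noteq> {\<lambda>_. \<zero>}"
  proof (rule ccontr)
    assume a: "\<not> ?thesis"
    have "x = (\<lambda>_. \<zero>)" if "x \<in> rels R k p" for x
      using rels_split[of p k q, OF kt that min[OF that]] a by auto
    then show False using nz tup_submoduleD(2)[OF tup_submodule_rels[of p k q, OF kt]] by blast
  qed
  then have "tor_vanishes n' 1 (ideal_tup I 1) \<or> tor_vanishes n' 1 (ideal_tup J 1)"
    using step_to_J[OF S(1) _ _ S(2)] split_resolution.step_to_J[OF swap_resolution T(1) _ _ T(2)] by blast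
  then show ?thesis by (rule ideals_from_either[OF n'(2)])
qed

end

section \<open>Free modules and minimal resolutions\<close>

lemma free_module_simps [simp]:
  "\<zero>\<^bsub>free_module R B\<^esub> = (\<lambda>_. \<zero>\<^bsub>R\<^esub>)"
  "x \<oplus>\<^bsub>free_module R B\<^esub> y = (\<lambda>b. x b \<oplus>\<^bsub>R\<^esub> y b)"
  "r \<odot>\<^bsub>free_module R B\<^esub> x = (\<lambda>b. r \<otimes>\<^bsub>R\<^esub> x b)"
  by (simp_all add: free_module_def)

lemma free_module_carrier:
  "x \<in> carrier (free_module R B) \<longleftrightarrow> (\<forall>b\<in>B. x b \<in> carrier R) \<and> (\<forall>b. b \<notin> B \<longrightarrow> x b = \<zero>\<^bsub>R\<^esub>) \<and>
     finite {b. x b \<noteq> \<zero>\<^bsub>R\<^esub>}"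
  by (auto simp: free_module_def)

lemma free_module_tup: "carrier (free_module R {..<n}) = tup R n"
proof -
  have "finite {b. x b \<noteq> \<zero>\<^bsub>R\<^esub>}" if "\<And>b. n \<le> b \<Longrightarrow> x b = \<zero>\<^bsub>R\<^esub>" for x :: "nat \<Rightarrow> 'a"
    by (rule finite_subset[of _ "{..<n}"]) (use that not_le in auto)
  then show ?thesis
    by (auto simp: free_module_carrier tup_def not_less)
qed

context cring begin

lemma free_module_closed: "x \<in> carrier (free_module R B) \<Longrightarrow> x b \<in> carrier R"
  by (cases "b \<in> B") (auto simp: free_module_carrier)

lemma free_module: "module R (free_module R B)"
proof (rule moduleI[OF cring_axioms])
  show "abelian_group (free_module R B)"
  proof (rule abelian_groupI)
    fix x y assume xy: "x \<in> carrier (free_module R B)" "y \<in> carrier (free_module R B)"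
    have "finite ({b. x b \<noteq> \<zero>} \<union> {b. y b \<noteq> \<zero>})" using xy by (simp add: free_module_carrier)
    then have "finite {b. x b \<oplus> y b \<noteq> \<zero>}" by (rule finite_subset[rotated]) auto
    then show "x \<oplus>\<^bsub>free_module R B\<^esub> y \<in> carrier (free_module R B)"
      using xy by (simp add: free_module_carrier)
  next
    fix x assume x: "x \<in> carrier (free_module R B)"
    have "finite {b. x b \<noteq> \<zero>}" using x by (simp add: free_module_carrier)
    then have "finite {b. \<ominus> x b \<noteq> \<zero>}" by (rule finite_subset[rotated]) auto
    then have "(\<lambda>b. \<ominus> x b) \<in> carrier (free_module R B)"
      using x by (auto simp: free_module_carrier)
    then show "\<exists>y\<in>carrier (free_module R B). y \<oplus>\<^bsub>free_module R B\<^esub> x = \<zero>\<^bsub>free_module R B\<^esub>"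
      using free_module_closed[OF x] by (intro bexI[of _ "\<lambda>b. \<ominus> x b"]) (auto simp: l_neg)
  next
    show "\<zero>\<^bsub>free_module R B\<^esub> \<in> carrier (free_module R B)" by (simp add: free_module_carrier)
  qed (simp_all add: free_module_closed a_ac)
next
  fix r x assume rx: "r \<in> carrier R" "x \<in> carrier (free_module R B)"
  have "finite {b. x b \<noteq> \<zero>}" using rx by (simp add: free_module_carrier)
  then have "finite {b. r \<otimes> x b \<noteq> \<zero>}" by (rule finite_subset[rotated]) (use rx in auto)
  then show "r \<odot>\<^bsub>free_module R B\<^esub> x \<in> carrier (free_module R B)"
    using rx by (simp add: free_module_carrier)
qed (auto simp: l_distr r_distr m_assoc free_module_closed)

lemma free_module_eval: "(\<lambda>x. x b) \<in> mod_hom R (free_module R B) (self_module R)"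
  by (auto simp: mod_hom_def free_module_closed)

text \<open>The evaluations at basis elements serve as functionals: \<open>y\<close> is the sum over
  \<open>b\<close> of the tuple of its \<open>b\<close>-coordinates, an element of \<open>K\<close>,
  times the basis vector at \<open>b\<close>. Only finitely many \<open>b\<close> occur, and the
  induction removes them one at a time.\<close>

lemma coord_free_module: "coord_module R (free_module R B)"
  unfolding coord_module_def
proof (intro conjI free_module exI[of _ "(\<lambda>b x. x b) ` B"] allI impI)
  show "(\<lambda>b x. x b) ` B \<subseteq> mod_hom R (free_module R B) (self_module R)"
    by (intro image_subsetI free_module_eval)
next
  interpret F: module R "free_module R B" by (rule free_module)
  fix q K y
  assume K: "tup_submodule R q K" and y: "y \<in> tup (free_module R B) q"
    and yK: "\<forall>\<phi>\<in>(\<lambda>b x. x b) ` B. (\<lambda>l. \<phi> (y l)) \<in> K"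
  have main: "y \<in> dot_span (free_module R B) K"
    if "finite D" "D \<subseteq> B" "y \<in> tup (free_module R B) q" "\<And>b. b \<in> B \<Longrightarrow> (\<lambda>l. y l b) \<in> K"
      "\<And>l b. b \<notin> D \<Longrightarrow> y l b = \<zero>" for D y
    using that
  proof (induction D arbitrary: y)
    case empty
    then have "y l b = \<zero>" for l b by simp
    then have "y = (\<lambda>_. \<zero>\<^bsub>free_module R B\<^esub>)" by (intro ext) simp
    then show ?case using dot_span.zero by metis
  next
    case (insert a D)
    have yc: "y l \<in> carrier (free_module R B)" for l using F.tupD[OF insert.prems(2)] .
    define \<delta> where "\<delta> = (\<lambda>b. if b = a then \<one> else \<zero>)"
    have "{b. \<delta> b \<noteq> \<zero>} \<subseteq> {a}" by (auto simp: \<delta>_def)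
    then have \<delta>: "\<delta> \<in> carrier (free_module R B)"
      using insert.prems(1) finite_subset[of "{b. \<delta> b \<noteq> \<zero>}" "{a}"]
      by (auto simp: free_module_carrier \<delta>_def)
    define y' where "y' = (\<lambda>l. (y l)(a := \<zero>))"
    have "y' \<in> dot_span (free_module R B) K"
    proof (rule insert.IH)
      have "y' l \<in> carrier (free_module R B)" for l
      proof -
        have "{b. y' l b \<noteq> \<zero>} \<subseteq> {b. y l b \<noteq> \<zero>}" by (auto simp: y'_def)
        then show ?thesis
          using yc[of l] finite_subset[of "{b. y' l b \<noteq> \<zero>}" "{b. y l b \<noteq> \<zero>}"]
          by (auto simp: free_module_carrier y'_def)
      qed
      moreover have "y' l = (\<lambda>_. \<zero>)" if "l \<ge> q" for l
        using F.tup_ge[OF insert.prems(2) that] by (auto simp: y'_def)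
      ultimately show "y' \<in> tup (free_module R B) q" by (simp add: tup_def)
      show "(\<lambda>l. y' l b) \<in> K" if "b \<in> B" for b
        using insert.prems(3)[OF that] tup_submoduleD(2)[OF K] by (cases "b = a") (simp_all add: y'_def)
      show "y' l b = \<zero>" if "b \<notin> D" for l b
        using insert.prems(4)[of b l] that by (auto simp: y'_def)
    qed (use insert.prems(1) in auto)
    then have "(\<lambda>l. y l a \<odot>\<^bsub>free_module R B\<^esub> \<delta> \<oplus>\<^bsub>free_module R B\<^esub> y' l) \<in> dot_span (free_module R B) K"
      using insert.prems(1,3) \<delta> by (intro dot_span.step[of "\<lambda>l. y l a"]) auto
    moreover have "y l a \<odot>\<^bsub>free_module R B\<^esub> \<delta> \<oplus>\<^bsub>free_module R B\<^esub> y' l = y l" for l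
      using free_module_closed[OF yc[of l]] by (auto simp: \<delta>_def y'_def)
    ultimately show ?case by simp
  qed
  define D where "D = (\<Union>l<q. {b. y l b \<noteq> \<zero>})"
  have yc: "y l \<in> carrier (free_module R B)" for l using F.tupD[OF y] .
  show "y \<in> dot_span (free_module R B) K"
  proof (rule main[of D])
    show "finite D" using yc by (auto simp: D_def free_module_carrier)
    show "D \<subseteq> B" using yc by (auto simp: D_def free_module_carrier)
    show "y l b = \<zero>" if "b \<notin> D" for l b
      using that F.tup_ge[OF y, of l] by (cases "l < q") (auto simp: D_def)
  qed (use y yK in auto)
qed

text \<open>The functionals of the free module are pulled back along \<open>i\<close>. Detection
  takes place in the free module, and \<open>p\<close> carries the resulting span back to the
  summand.\<close>

lemma coord_projective_module:
  fixes P :: "('a, 'c, 'd) module_scheme"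
  assumes "projective_module R P" shows "coord_module R P"
proof -
  have P: "module R P" using assms by (simp add: projective_module_def)
  from assms have "\<exists>(B :: 'c set) i p. i \<in> mod_hom R P (free_module R B) \<and>
      p \<in> mod_hom R (free_module R B) P \<and> (\<forall>x\<in>carrier P. p (i x) = x)"
    by (simp add: projective_module_def)
  then obtain B :: "'c set" and i p where "i \<in> mod_hom R P (free_module R B) \<and>
      p \<in> mod_hom R (free_module R B) P \<and> (\<forall>x\<in>carrier P. p (i x) = x)"
    by (elim exE) (rule that)
  then have i: "i \<in> mod_hom R P (free_module R B)"
    and p: "p \<in> mod_hom R (free_module R B) P" and pi: "\<And>x. x \<in> carrier P \<Longrightarrow> p (i x) = x"
    by auto
  interpret i: two_modules R P "free_module R B" i
    using P i free_module by (simp add: two_modules_def two_modules_axioms_def)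
  interpret p: two_modules R "free_module R B" P p
    using P p free_module by (simp add: two_modules_def two_modules_axioms_def)
  from coord_moduleE[OF coord_free_module] obtain \<Lambda> where
    L: "\<Lambda> \<subseteq> mod_hom R (free_module R B) (self_module R)"
    "\<And>q K y. \<lbrakk>tup_submodule R q K; y \<in> tup (free_module R B) q; \<And>\<phi>. \<phi> \<in> \<Lambda> \<Longrightarrow> (\<lambda>l. \<phi> (y l)) \<in> K\<rbrakk> \<Longrightarrow>
      y \<in> dot_span (free_module R B) K" by blast
  show ?thesis
    unfolding coord_module_def
  proof (intro conjI P exI[of _ "(\<lambda>\<phi> x. \<phi> (i x)) ` \<Lambda>"] allI impI)
    have "(\<lambda>x. \<phi> (i x)) \<in> mod_hom R P (self_module R)"
      if "\<phi> \<in> mod_hom R (free_module R B) (self_module R)" for \<phi>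
      using that i by (auto simp: mod_hom_def Pi_iff)
    then show "(\<lambda>\<phi> x. \<phi> (i x)) ` \<Lambda> \<subseteq> mod_hom R P (self_module R)" using L(1) by auto
    fix q K y
    assume K: "tup_submodule R q K" and y: "y \<in> tup P q"
      and "\<forall>\<phi>\<in>(\<lambda>\<phi> x. \<phi> (i x)) ` \<Lambda>. (\<lambda>l. \<phi> (y l)) \<in> K"
    then have "(\<lambda>l. i (y l)) \<in> dot_span (free_module R B) K"
      by (intro L(2)[OF K i.f_tup[OF y]]) auto
    then have "(\<lambda>l. p (i (y l))) \<in> dot_span P K"
      by (rule p.f_dot_span[OF _ tup_submoduleD(1)[OF K]])
    then show "y \<in> dot_span P K" using pi i.M.tupD[OF y] by simp
  qed
qed

lemma coord_resolutionI:
  assumes "module R M" "projective_resolution R M P d e" shows "coord_resolution R M P d e"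
  using assms unfolding projective_resolution_def coord_resolution_def coord_resolution_axioms_def
  by (auto simp: coord_projective_module)

lemma combination_hom:
  fixes q :: nat
  assumes "module R M" and g: "\<And>l. l < q \<Longrightarrow> g l \<in> carrier M"
  shows "(\<lambda>r. \<Oplus>\<^bsub>M\<^esub>l\<in>{..<q}. r l \<odot>\<^bsub>M\<^esub> g l) \<in> mod_hom R (free_module R {..<q}) M"
proof -
  interpret M: module R M by fact
  define aug where "aug = (\<lambda>r. \<Oplus>\<^bsub>M\<^esub>l\<in>{..<q}. r l \<odot>\<^bsub>M\<^esub> g l)"
  have c: "r l \<in> carrier R" if "r \<in> tup R q" for r l using tupE[OF that] .
  have gc: "g l \<in> carrier M" if "l \<in> {..<q}" for l using g that by simp
  have "aug r \<in> carrier M" if "r \<in> tup R q" for r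
    unfolding aug_def using c[OF that] gc by (intro M.M.finsum_closed) auto
  moreover have "aug (\<lambda>l. r l \<oplus> s l) = aug r \<oplus>\<^bsub>M\<^esub> aug s" if "r \<in> tup R q" "s \<in> tup R q" for r s
  proof -
    have "(\<Oplus>\<^bsub>M\<^esub>l\<in>{..<q}. (r l \<oplus> s l) \<odot>\<^bsub>M\<^esub> g l) = (\<Oplus>\<^bsub>M\<^esub>l\<in>{..<q}. r l \<odot>\<^bsub>M\<^esub> g l \<oplus>\<^bsub>M\<^esub> s l \<odot>\<^bsub>M\<^esub> g l)"
      using c that gc by (intro M.M.finsum_cong') (auto simp: M.smult_l_distr)
    also have "\<dots> = aug r \<oplus>\<^bsub>M\<^esub> aug s"
      unfolding aug_def using c that gc by (intro M.M.finsum_addf) auto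
    finally show ?thesis by (simp add: aug_def)
  qed
  moreover have "aug (\<lambda>l. a \<otimes> r l) = a \<odot>\<^bsub>M\<^esub> aug r" if "r \<in> tup R q" "a \<in> carrier R" for r a
  proof -
    have "(\<Oplus>\<^bsub>M\<^esub>l\<in>{..<q}. (a \<otimes> r l) \<odot>\<^bsub>M\<^esub> g l) = (\<Oplus>\<^bsub>M\<^esub>l\<in>{..<q}. a \<odot>\<^bsub>M\<^esub> (r l \<odot>\<^bsub>M\<^esub> g l))"
      using c that gc by (intro M.M.finsum_cong') (auto simp: M.smult_assoc1)
    also have "\<dots> = a \<odot>\<^bsub>M\<^esub> aug r"
      unfolding aug_def using c that gc by (intro M.finsum_smult_ldistr[symmetric]) auto
    finally show ?thesis by (simp add: aug_def)
  qed
  ultimately show ?thesis unfolding aug_def[symmetric] by (simp add: mod_hom_def free_module_tup)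
qed

lemma lincomb_hom:
  assumes "\<And>j. j < p \<Longrightarrow> k j \<in> tup R q"
  shows "lincomb (self_module R) k p \<in> mod_hom R (free_module R {..<p}) (free_module R {..<q})"
proof -
  interpret S: module R "self_module R" by (rule self_module)
  have "lincomb (self_module R) k p x \<in> tup R q" if "x \<in> tup R p" for x
    using S.lincomb_closed[of p k q x] assms that by simp
  moreover have "lincomb (self_module R) k p (\<lambda>l. x l \<oplus> y l) =
      (\<lambda>l. lincomb (self_module R) k p x l \<oplus> lincomb (self_module R) k p y l)"
    if "x \<in> tup R p" "y \<in> tup R p" for x y
    using S.lincomb_add[of p k q x y] assms that by simp
  moreover have "lincomb (self_module R) k p (\<lambda>l. r \<otimes> x l) = (\<lambda>l. r \<otimes> lincomb (self_module R) k p x l)"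
    if "x \<in> tup R p" "r \<in> carrier R" for x r
    using S.lincomb_smult[of p k q x r] assms that by simp
  ultimately show ?thesis by (simp add: mod_hom_def free_module_tup)
qed

end

section \<open>Minimal free resolutions\<close>

context noetherian_cring begin

definition min_gens :: "nat \<times> (nat \<Rightarrow> 'a) set \<Rightarrow> (nat \<Rightarrow> nat \<Rightarrow> 'a) \<times> nat" where
  "min_gens qK = (SOME (k, p). gens R (fst qK) (snd qK) k p \<and> (\<forall>r\<in>rels R k p. \<forall>j. r j \<notin> Units R))"

primrec syzygy :: "nat \<times> (nat \<Rightarrow> 'a) set \<Rightarrow> nat \<Rightarrow> nat \<times> (nat \<Rightarrow> 'a) set" where
  "syzygy qK 0 = qK"
| "syzygy qK (Suc n) = (snd (min_gens (syzygy qK n)),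
     rels R (fst (min_gens (syzygy qK n))) (snd (min_gens (syzygy qK n))))"

lemma min_gens:
  assumes "tup_submodule R q K" "\<one> \<noteq> \<zero>"
  shows "gens R q K (fst (min_gens (q, K))) (snd (min_gens (q, K)))"
    "r \<in> rels R (fst (min_gens (q, K))) (snd (min_gens (q, K))) \<Longrightarrow> r j \<notin> Units R"
proof -
  have "\<exists>kp. case kp of (k, p) \<Rightarrow> gens R q K k p \<and> (\<forall>r\<in>rels R k p. \<forall>j. r j \<notin> Units R)"
    using exists_min_gens[OF assms] by auto
  from someI_ex[OF this] have *: "case min_gens (q, K) of (k, p) \<Rightarrow>
      gens R q K k p \<and> (\<forall>r\<in>rels R k p. \<forall>j. r j \<notin> Units R)"
    by (simp add: min_gens_def)
  then show "gens R q K (fst (min_gens (q, K))) (snd (min_gens (q, K)))" by (simp add: case_prod_beta)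
  show "r j \<notin> Units R" if "r \<in> rels R (fst (min_gens (q, K))) (snd (min_gens (q, K)))"
    using * that by (simp add: case_prod_beta)
qed

end

text \<open>The family \<open>g\<close> is any finite generating family; minimality begins with the
  generators of its kernel. Below, \<open>syz 0\<close> is therefore the first syzygy of
  \<open>M\<close> and \<open>syz 1\<close> the second one, whose vanishing makes the resolution
  stop after \<open>rank 1\<close>.\<close>

locale minimal_resolution = noetherian_cring R + M: module R M
  for R :: "('r, 'x) ring_scheme" (structure) and M :: "('r, 'm, 'y) module_scheme" +
  fixes g :: "nat \<Rightarrow> 'm" and q :: nat
  assumes g_closed: "l < q \<Longrightarrow> g l \<in> carrier M"
    and g_span: "carrier M = (\<lambda>r. \<Oplus>\<^bsub>M\<^esub>l\<in>{..<q}. r l \<odot>\<^bsub>M\<^esub> g l) ` tup R q"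
    and nontriv: "\<one> \<noteq> \<zero>"
begin

definition aug :: "(nat \<Rightarrow> 'r) \<Rightarrow> 'm" where
  "aug r = (\<Oplus>\<^bsub>M\<^esub>l\<in>{..<q}. r l \<odot>\<^bsub>M\<^esub> g l)"

definition ker_aug :: "(nat \<Rightarrow> 'r) set" where
  "ker_aug = {r \<in> tup R q. aug r = \<zero>\<^bsub>M\<^esub>}"

definition rank :: "nat \<Rightarrow> nat" where
  "rank n = fst (syzygy (q, ker_aug) n)"

definition syz :: "nat \<Rightarrow> (nat \<Rightarrow> 'r) set" where
  "syz n = snd (syzygy (q, ker_aug) n)"

definition mat :: "nat \<Rightarrow> nat \<Rightarrow> nat \<Rightarrow> 'r" where
  "mat n = fst (min_gens (syzygy (q, ker_aug) n))"

definition diff :: "nat \<Rightarrow> (nat \<Rightarrow> 'r) \<Rightarrow> nat \<Rightarrow> 'r" where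
  "diff n = lincomb (self_module R) (mat n) (rank (Suc n))"

lemma rank_0 [simp]: "rank 0 = q" and syz_0 [simp]: "syz 0 = ker_aug"
  and syz_Suc: "syz (Suc n) = rels R (mat n) (rank (Suc n))"
  by (simp_all add: rank_def syz_def mat_def)

lemma aug_hom: "aug \<in> mod_hom R (free_module R {..<q}) M"
  unfolding aug_def[abs_def] by (rule combination_hom[OF M.module_axioms g_closed])

lemma tup_submodule_ker_aug: "tup_submodule R q ker_aug"
proof -
  interpret A: two_modules R "free_module R {..<q}" M aug
    by (intro two_modules.intro two_modules_axioms.intro free_module M.module_axioms aug_hom)
  have [simp]: "(\<lambda>_. \<zero>) \<in> tup R q" by (simp add: tup_def)
  have [simp]: "aug (\<lambda>_. \<zero>) = \<zero>\<^bsub>M\<^esub>" using A.f_zero by simp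
  have "aug (\<lambda>l. x l \<oplus> y l) = \<zero>\<^bsub>M\<^esub>" if "x \<in> ker_aug" "y \<in> ker_aug" for x y
    using A.f_add[of x y] that by (simp add: ker_aug_def free_module_tup)
  moreover have "aug (\<lambda>l. r \<otimes> x l) = \<zero>\<^bsub>M\<^esub>" if "x \<in> ker_aug" "r \<in> carrier R" for x r
    using A.f_smult[of r x] that by (simp add: ker_aug_def free_module_tup)
  ultimately show ?thesis
    by (auto simp: tup_submodule_def) (auto simp: ker_aug_def tup_def)
qed

lemma tup_submodule_syz: "tup_submodule R (rank n) (syz n)"
proof (induction n)
  case 0
  then show ?case using tup_submodule_ker_aug by simp
next
  case (Suc n)
  have "gens R (rank n) (syz n) (mat n) (rank (Suc n))"
    using min_gens(1)[OF Suc nontriv] by (simp add: rank_def syz_def mat_def)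
  then show ?case unfolding syz_Suc by (intro tup_submodule_rels[of _ _ "rank n"]) (simp add: gens_def)
qed

lemma gens_syz: "gens R (rank n) (syz n) (mat n) (rank (Suc n))"
  using min_gens(1)[OF tup_submodule_syz nontriv] by (simp add: rank_def syz_def mat_def)

lemma syz_minimal: "r \<in> syz (Suc n) \<Longrightarrow> r j \<notin> Units R"
  using min_gens(2)[OF tup_submodule_syz nontriv, of r n] by (simp add: rank_def syz_def mat_def)

lemma mat_closed: "j < rank (Suc n) \<Longrightarrow> mat n j \<in> tup R (rank n)"
  using gens_syz[of n] by (simp add: gens_def)

lemma diff_image: "diff n ` tup R (rank (Suc n)) = syz n"
  using gens_syz[of n] by (simp add: gens_def diff_def)

lemma diff_kernel: "{x \<in> tup R (rank (Suc n)). diff n x = (\<lambda>_. \<zero>)} = syz (Suc n)"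
  by (simp add: syz_Suc rels_def diff_def)

lemma diff_hom: "diff n \<in> mod_hom R (free_module R {..<rank (Suc n)}) (free_module R {..<rank n})"
  unfolding diff_def by (rule lincomb_hom) (rule mat_closed)

lemma coord_resolution: "coord_resolution R M (\<lambda>n. free_module R {..<rank n}) diff aug"
proof (intro coord_resolution.intro coord_resolution_axioms.intro M.module_axioms coord_free_module diff_hom)
  show "aug \<in> mod_hom R (free_module R {..<rank 0}) M" using aug_hom by simp
  show "aug ` carrier (free_module R {..<rank 0}) = carrier M"
    using g_span by (simp add: free_module_tup aug_def[abs_def])
  show "diff 0 ` carrier (free_module R {..<rank 1}) = {x \<in> carrier (free_module R {..<rank 0}). aug x = \<zero>\<^bsub>M\<^esub>}"
    using diff_image[of 0] by (simp add: free_module_tup ker_aug_def)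
  show "diff (Suc n) ` carrier (free_module R {..<rank (Suc (Suc n))}) =
      {x \<in> carrier (free_module R {..<rank (Suc n)}). diff n x = \<zero>\<^bsub>free_module R {..<rank n}\<^esub>}" for n
    using diff_image[of "Suc n"] diff_kernel[of n] by (simp add: free_module_tup)
qed

text \<open>A minimal generating family of the zero module is empty, because a zero generator admits
  the relation with coefficient 1.\<close>

lemma syz_trivial_rank:
  assumes "syz (Suc n) = {\<lambda>_. \<zero>}"
  shows "rank (Suc (Suc n)) = 0" "syz (Suc (Suc n)) = {\<lambda>_. \<zero>}"
proof -
  show 0: "rank (Suc (Suc n)) = 0"
  proof (rule ccontr)
    assume "rank (Suc (Suc n)) \<noteq> 0"
    then have p: "0 < rank (Suc (Suc n))" by simp
    have "mat (Suc n) 0 \<in> syz (Suc n)"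
      using module.gens_mem[OF self_module gens_syz p] .
    then have "mat (Suc n) 0 = (\<lambda>_. \<zero>)" using assms by simp
    then have "lincomb (self_module R) (mat (Suc n)) (rank (Suc (Suc n))) (\<lambda>j. if j = 0 then \<one> else \<zero>) = (\<lambda>_. \<zero>)"
      using lincomb_single[of "rank (Suc (Suc n))" "mat (Suc n)" "rank (Suc n)" 0 \<one>] mat_closed p by simp
    then have "(\<lambda>j. if j = 0 then \<one> else \<zero>) \<in> syz (Suc (Suc n))"
      using p unfolding syz_Suc[of "Suc n"] by (auto simp: rels_def tup_def)
    from syz_minimal[OF this, of 0] show False by simp
  qed
  show "syz (Suc (Suc n)) = {\<lambda>_. \<zero>}"
    using tup_submoduleD(1,2)[OF tup_submodule_syz[of "Suc (Suc n)"]] 0 by (auto simp: tup_def)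
qed

lemma syz_1_trivial:
  assumes "syz 1 = {\<lambda>_. \<zero>}" shows "rank (Suc (Suc n)) = 0"
proof -
  have "syz (Suc n) = {\<lambda>_. \<zero>}"
    using assms by (induction n) (simp_all add: syz_trivial_rank(2))
  then show ?thesis by (rule syz_trivial_rank(1))
qed

end

section \<open>Resolutions by modules of lists\<close>

text \<open>Copies of the modules \<open>R\<^sup>n\<close> whose elements have the type required by the definitions of the
  projective dimension and of Tor.\<close>

definition enc :: "nat \<Rightarrow> (nat \<Rightarrow> 'r) \<Rightarrow> ('r + 'm) list" where
  "enc n x = map (\<lambda>l. Inl (x l)) [0..<n]"

definition dec :: "('r, 'x) ring_scheme \<Rightarrow> nat \<Rightarrow> ('r + 'm) list \<Rightarrow> nat \<Rightarrow> 'r" where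
  "dec R n xs = (\<lambda>l. if l < n then projl (xs ! l) else \<zero>\<^bsub>R\<^esub>)"

definition list_module :: "('r, 'x) ring_scheme \<Rightarrow> nat \<Rightarrow> ('r, ('r + 'm) list) module" where
  "list_module R n =
     \<lparr>carrier = enc n ` tup R n, monoid.mult = undefined, one = undefined,
      ring.zero = enc n (\<lambda>_. \<zero>\<^bsub>R\<^esub>),
      add = (\<lambda>x y. enc n (\<lambda>l. dec R n x l \<oplus>\<^bsub>R\<^esub> dec R n y l)),
      smult = (\<lambda>r x. enc n (\<lambda>l. r \<otimes>\<^bsub>R\<^esub> dec R n x l))\<rparr>"

lemma list_module_simps [simp]:
  "carrier (list_module R n) = enc n ` tup R n"
  "\<zero>\<^bsub>list_module R n\<^esub> = enc n (\<lambda>_. \<zero>\<^bsub>R\<^esub>)"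
  "x \<oplus>\<^bsub>list_module R n\<^esub> y = enc n (\<lambda>l. dec R n x l \<oplus>\<^bsub>R\<^esub> dec R n y l)"
  "r \<odot>\<^bsub>list_module R n\<^esub> x = enc n (\<lambda>l. r \<otimes>\<^bsub>R\<^esub> dec R n x l)"
  by (simp_all add: list_module_def)

lemma dec_enc [simp]: "x \<in> tup R n \<Longrightarrow> dec R n (enc n x) = x"
  by (auto simp: dec_def enc_def tup_def)

context cring begin

lemma tup_closed [simp]:
  "(\<lambda>_. \<zero>) \<in> tup R n"
  "x \<in> tup R n \<Longrightarrow> y \<in> tup R n \<Longrightarrow> (\<lambda>l. x l \<oplus> y l) \<in> tup R n"
  "r \<in> carrier R \<Longrightarrow> x \<in> tup R n \<Longrightarrow> (\<lambda>l. r \<otimes> x l) \<in> tup R n"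
  "x \<in> tup R n \<Longrightarrow> (\<lambda>l. \<ominus> x l) \<in> tup R n"
  by (auto simp: tup_def)

lemma list_module: "module R (list_module R n :: ('a, ('a + 'm) list) module)"
proof (rule moduleI[OF cring_axioms])
  show "abelian_group (list_module R n :: ('a, ('a + 'm) list) module)"
  proof (rule abelian_groupI)
    fix x :: "('a + 'm) list" assume "x \<in> carrier (list_module R n)"
    then obtain a where a: "a \<in> tup R n" "x = enc n a" by auto
    then have "(\<lambda>l. \<ominus> a l \<oplus> a l) = (\<lambda>_. \<zero>)" using tupE[OF a(1)] by (simp add: l_neg)
    then show "\<exists>y\<in>carrier (list_module R n). y \<oplus>\<^bsub>list_module R n\<^esub> x = \<zero>\<^bsub>list_module R n\<^esub>"
      using a by (intro bexI[of _ "enc n (\<lambda>l. \<ominus> a l)"]) auto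
  qed (auto simp: tupE a_ac)
qed (auto simp: tupE l_distr r_distr m_assoc)

text \<open>Projectivity is defined with a basis inside the type of the module's own elements. The
  basis consists of \<open>n\<close> lists of zeros, told apart by their lengths 0 to n - 1, so that
  the length of a basis element is the index of its coordinate.\<close>

lemma projective_list_module:
  "projective_module R (list_module R n :: ('a, ('a + 'm) list) module)"
proof -
  define b :: "nat \<Rightarrow> ('a + 'm) list" where "b = (\<lambda>i. replicate i (Inl \<zero>))"
  have b: "b i = b j \<longleftrightarrow> i = j" for i j
    unfolding b_def by (metis length_replicate)
  define B where "B = b ` {..<n}"
  define i :: "('a + 'm) list \<Rightarrow> ('a + 'm) list \<Rightarrow> 'a"
    where "i = (\<lambda>x y. if y \<in> B then dec R n x (length y) else \<zero>)"
  define p :: "(('a + 'm) list \<Rightarrow> 'a) \<Rightarrow> ('a + 'm) list"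
    where "p = (\<lambda>f. enc n (\<lambda>l. if l < n then f (b l) else \<zero>))"
  have fin: "finite B" by (simp add: B_def)
  have fin': "finite {y. i x y \<noteq> \<zero>}" for x
    by (rule finite_subset[OF _ fin]) (auto simp: i_def)
  have "i \<in> mod_hom R (list_module R n) (free_module R B)"
    using fin' by (auto simp: mod_hom_def free_module_carrier i_def tupE)
  moreover have pt: "(\<lambda>l. if l < n then f (b l) else \<zero>) \<in> tup R n" if "f \<in> carrier (free_module R B)" for f
    using that by (auto simp: tup_def free_module_carrier B_def)
  have "p \<in> mod_hom R (free_module R B) (list_module R n)"
    unfolding mod_hom_def using pt
    by (auto simp: p_def intro!: arg_cong[where f = "enc n"])
  moreover have "p (i x) = x" if x: "x \<in> carrier (list_module R n)" for x
  proof -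
    from x obtain a where a: "a \<in> tup R n" "x = enc n a" by auto
    have "(\<lambda>l. if l < n then i x (b l) else \<zero>) = a"
      using a by (auto simp: i_def B_def b_def tup_def fun_eq_iff)
    then show ?thesis unfolding p_def by (simp only: a(2))
  qed
  ultimately show ?thesis unfolding projective_module_def using list_module by blast
qed

end

context minimal_resolution begin

definition ldiff :: "nat \<Rightarrow> ('r + 'c) list \<Rightarrow> ('r + 'c) list" where
  "ldiff n x = enc (rank n) (diff n (dec R (rank (Suc n)) x))"

text \<open>A copy of the minimal resolution in the prescribed element type. It bounds the
  projective dimension and shows that the choice in \<open>chosen_resolution\<close> has a
  witness.\<close>

lemma list_resolution:
  "projective_resolution R M (\<lambda>n. list_module R (rank n) :: ('r, ('r, 'c) res_elt) module) ldiff
     (\<lambda>x. aug (dec R q x))"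
proof -
  have dt: "diff n x \<in> tup R (rank n)" if "x \<in> tup R (rank (Suc n))" for n x
    using mod_homD(1)[OF diff_hom, of x n] that by (simp add: free_module_tup)
  have da: "diff n (\<lambda>l. x l \<oplus> y l) = (\<lambda>l. diff n x l \<oplus> diff n y l)"
    if "x \<in> tup R (rank (Suc n))" "y \<in> tup R (rank (Suc n))" for n x y
    using mod_homD(2)[OF diff_hom, of x n y] that by (simp add: free_module_tup)
  have ds: "diff n (\<lambda>l. r \<otimes> x l) = (\<lambda>l. r \<otimes> diff n x l)"
    if "x \<in> tup R (rank (Suc n))" "r \<in> carrier R" for n x r
    using mod_homD(3)[OF diff_hom, of r x n] that by (simp add: free_module_tup)
  have at: "aug x \<in> carrier M" if "x \<in> tup R q" for x
    using mod_homD(1)[OF aug_hom, of x] that by (simp add: free_module_tup)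
  have aa: "aug (\<lambda>l. x l \<oplus> y l) = aug x \<oplus>\<^bsub>M\<^esub> aug y" if "x \<in> tup R q" "y \<in> tup R q" for x y
    using mod_homD(2)[OF aug_hom, of x y] that by (simp add: free_module_tup)
  have as: "aug (\<lambda>l. r \<otimes> x l) = r \<odot>\<^bsub>M\<^esub> aug x" if "x \<in> tup R q" "r \<in> carrier R" for x r
    using mod_homD(3)[OF aug_hom, of r x] that by (simp add: free_module_tup)
  have inj: "(enc n x :: ('r + 'c) list) = enc n y \<longleftrightarrow> x = y" if "x \<in> tup R n" "y \<in> tup R n" for n x y
    using that dec_enc by metis
  have im: "ldiff n ` carrier (list_module R (rank (Suc n)) :: ('r, ('r + 'c) list) module) = enc (rank n) ` syz n" for n
    unfolding diff_image[symmetric] by (auto simp: ldiff_def image_iff)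
  show ?thesis
    unfolding projective_resolution_def
  proof (intro conjI allI projective_list_module)
    show "ldiff n \<in> mod_hom R (list_module R (rank (Suc n))) (list_module R (rank n))" for n
      by (auto simp: mod_hom_def ldiff_def dt da ds)
    show "(\<lambda>x. aug (dec R q x)) \<in> mod_hom R (list_module R (rank 0)) M"
      by (auto simp: mod_hom_def at aa as)
    have "(\<lambda>x. aug (dec R q x)) ` enc q ` tup R q = aug ` tup R q"
      by (auto simp: image_iff)
    then show "(\<lambda>x. aug (dec R q x)) ` carrier (list_module R (rank 0)) = carrier M"
      using g_span by (simp add: aug_def[abs_def])
    have "(enc q ` ker_aug :: ('r + 'c) list set) = {x \<in> enc q ` tup R q. aug (dec R q x) = \<zero>\<^bsub>M\<^esub>}"
      by (auto simp: ker_aug_def)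
    then show "ldiff 0 ` carrier (list_module R (rank 1) :: ('r, ('r, 'c) res_elt) module) =
        {x \<in> carrier (list_module R (rank 0)). aug (dec R q x) = \<zero>\<^bsub>M\<^esub>}"
      using im[of 0] by simp
    show "ldiff (Suc n) ` carrier (list_module R (rank (Suc (Suc n))) :: ('r, ('r, 'c) res_elt) module) =
        {x \<in> carrier (list_module R (rank (Suc n))). ldiff n x = \<zero>\<^bsub>list_module R (rank n)\<^esub>}" for n
      unfolding im diff_kernel[symmetric] by (auto simp: ldiff_def inj dt)
  qed
qed

lemma proj_dim_le_1:
  assumes "syz 1 = {\<lambda>_. \<zero>}" shows "proj_dim R M \<le> 1"
proof -
  have "carrier (list_module R (rank i) :: ('r, ('r, 'm) res_elt) module) = {\<zero>\<^bsub>list_module R (rank i)\<^esub>}"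
    if "i > 1" for i
  proof -
    have "i = Suc (Suc (i - 2))" using that by simp
    then have "rank i = 0" using syz_1_trivial[OF assms] by metis
    then show ?thesis by (auto simp: tup_def enc_def)
  qed
  then have "\<exists>(P :: nat \<Rightarrow> ('r, ('r, 'm) res_elt) module) d e.
      projective_resolution R M P d e \<and> (\<forall>i>1. carrier (P i) = {\<zero>\<^bsub>P i\<^esub>})"
    using list_resolution by blast
  then have "Inf {enat n | n. \<exists>(P :: nat \<Rightarrow> ('r, ('r, 'm) res_elt) module) d e.
      projective_resolution R M P d e \<and> (\<forall>i>n. carrier (P i) = {\<zero>\<^bsub>P i\<^esub>})} \<le> enat 1"
    by (intro Inf_lower) blast
  then show ?thesis by (simp add: proj_dim_def one_enat_def)
qed

text \<open>The choice need not return the minimal resolution; all that is known about it is that it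
  is a projective resolution.\<close>

lemma chosen_resolution:
  obtains P d e where "chosen_resolution R M = (P, d)" "coord_resolution R M P d e"
proof -
  have "\<exists>Pd. case Pd of (P :: nat \<Rightarrow> ('r, ('r, 'm) res_elt) module, d) \<Rightarrow> \<exists>e. projective_resolution R M P d e"
    using list_resolution by blast
  from someI_ex[OF this] have "case chosen_resolution R M of (P, d) \<Rightarrow> \<exists>e. projective_resolution R M P d e"
    by (simp add: chosen_resolution_def)
  then obtain P d e where "chosen_resolution R M = (P, d)" "projective_resolution R M P d e"
    by (cases "chosen_resolution R M") auto
  then show thesis using that coord_resolutionI[OF M.module_axioms] by blast
qed

end

lemma (in cring) fin_gen_enumerate:
  assumes "module R M" "fin_gen R M"
  shows "\<exists>g q. (\<forall>l<q. g l \<in> carrier M) \<and>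
    carrier M = (\<lambda>r. \<Oplus>\<^bsub>M\<^esub>l\<in>{..<q}. r l \<odot>\<^bsub>M\<^esub> g l) ` tup R q"
proof -
  interpret M: module R M by fact
  from assms(2) obtain A where A: "finite A" "A \<subseteq> carrier M"
    "\<And>U. submodule U R M \<Longrightarrow> A \<subseteq> U \<Longrightarrow> U = carrier M"
    unfolding fin_gen_def by blast
  from A(1) obtain q :: nat and g where g: "A = g ` {i. i < q}"
    using finite_imp_nat_seg_image_inj_on by blast
  have gc: "g l \<in> carrier M" if "l \<in> {..<q}" for l using A(2) g that by auto
  define f where "f = (\<lambda>r. \<Oplus>\<^bsub>M\<^esub>l\<in>{..<q}. r l \<odot>\<^bsub>M\<^esub> g l)"
  have fh: "f \<in> mod_hom R (free_module R {..<q}) M"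
    unfolding f_def using gc by (intro combination_hom assms(1)) simp
  interpret f: two_modules R "free_module R {..<q}" M f
    by (intro two_modules.intro two_modules_axioms.intro free_module assms(1) fh)
  have fc: "f r \<in> carrier M" if "r \<in> tup R q" for r
    using f.f_closed[of r] that by (simp add: free_module_tup)
  have fa: "f (\<lambda>l. r l \<oplus> s l) = f r \<oplus>\<^bsub>M\<^esub> f s" if "r \<in> tup R q" "s \<in> tup R q" for r s
    using f.f_add[of r s] that by (simp add: free_module_tup)
  have fs: "f (\<lambda>l. a \<otimes> r l) = a \<odot>\<^bsub>M\<^esub> f r" if "r \<in> tup R q" "a \<in> carrier R" for r a
    using f.f_smult[of a r] that by (simp add: free_module_tup)
  have f0: "f (\<lambda>_. \<zero>) = \<zero>\<^bsub>M\<^esub>" using f.f_zero by simp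
  have "submodule (f ` tup R q) R M"
  proof (rule M.submoduleI)
    show "f ` tup R q \<subseteq> carrier M" using fc by auto
    show "\<zero>\<^bsub>M\<^esub> \<in> f ` tup R q" using f0 by (metis imageI tup_closed(1))
    show "\<ominus>\<^bsub>M\<^esub> a \<in> f ` tup R q" if a: "a \<in> f ` tup R q" for a
    proof -
      from a obtain r where r: "r \<in> tup R q" "a = f r" by blast
      have "\<ominus>\<^bsub>M\<^esub> a = (\<ominus> \<one>) \<odot>\<^bsub>M\<^esub> a" using r fc by (simp add: M.smult_l_minus)
      then have "\<ominus>\<^bsub>M\<^esub> a = f (\<lambda>l. (\<ominus> \<one>) \<otimes> r l)" using fs[OF r(1), of "\<ominus> \<one>"] r by simp
      then show ?thesis using tup_closed(3)[OF _ r(1), of "\<ominus> \<one>"] by blast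
    qed
    show "a \<oplus>\<^bsub>M\<^esub> b \<in> f ` tup R q" if "a \<in> f ` tup R q" "b \<in> f ` tup R q" for a b
      using that fa[symmetric] tup_closed(2) by blast
    show "a \<odot>\<^bsub>M\<^esub> x \<in> f ` tup R q" if "a \<in> carrier R" "x \<in> f ` tup R q" for a x
      using that fs[symmetric] tup_closed(3) by blast
  qed
  moreover have "A \<subseteq> f ` tup R q"
  proof
    fix a assume "a \<in> A"
    then obtain i where i: "i < q" "a = g i" using g by auto
    define \<delta> where "\<delta> = (\<lambda>l. if l = i then \<one> else \<zero>)"
    have "f \<delta> = (\<Oplus>\<^bsub>M\<^esub>l\<in>{..<q}. if i = l then g l else \<zero>\<^bsub>M\<^esub>)"
      unfolding f_def using gc by (intro M.M.finsum_cong') (auto simp: \<delta>_def)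
    also have "\<dots> = g i" using gc i by (intro M.M.finsum_singleton) auto
    finally have "f \<delta> = a" using i by simp
    moreover have "\<delta> \<in> tup R q" using i by (auto simp: \<delta>_def tup_def)
    ultimately show "a \<in> f ` tup R q" by blast
  qed
  ultimately have "f ` tup R q = carrier M" by (rule A(3))
  then show ?thesis using gc unfolding f_def by (intro exI[of _ g] exI[of _ q]) auto
qed

lemma minimal_resolution_exists:
  assumes "noetherian_cring R" "module R M" "fin_gen R M" "\<one>\<^bsub>R\<^esub> \<noteq> \<zero>\<^bsub>R\<^esub>"
  obtains g q where "minimal_resolution R M g q"
proof -
  interpret noetherian_cring R by fact
  from fin_gen_enumerate[OF assms(2,3)] obtain g q where "\<forall>l<q. g l \<in> carrier M"
    "carrier M = (\<lambda>r. \<Oplus>\<^bsub>M\<^esub>l\<in>{..<q}. r l \<odot>\<^bsub>M\<^esub> g l) ` tup R q" by blast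
  then have "minimal_resolution R M g q"
    using assms by (intro minimal_resolution.intro minimal_resolution_axioms.intro) auto
  then show thesis by (rule that)
qed

section \<open>Nakayama's lemma for the second syzygy of \<open>M\<close>\<close>

locale split_minimal_resolution = split_local_ring R I J + minimal_resolution R M g q
  for R (structure) and I J M g q
begin

sublocale split_resolution R I J M "\<lambda>n. free_module R {..<rank n}" diff aug
  by (intro split_resolution.intro split_local_ring_axioms coord_resolution)

text \<open>Let F be the free module of rank \<open>rank 1\<close>. As F modulo \<open>syz 1\<close>
  is the first syzygy of \<open>M\<close>, the quotient of the intersection of I F and
  \<open>syz 1\<close> by I times \<open>syz 1\<close> is Tor_2(M, R/I). The hypothesis on
  \<open>I\<close> says that this is 0.\<close>

lemma syz_1_ideal_part:
  assumes g: "gens R (rank 1) (syz 1) k p"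
    and v: "tor_vanishes 1 1 (ideal_tup I 1)" and x: "x \<in> syz 1" "x \<in> ideal_tup I (rank 1)"
  shows "x \<in> lincomb (self_module R) k p ` ideal_tup I p"
proof -
  interpret F: module R "free_module R {..<rank 1}" by (rule free_module)
  interpret Fp: module R "free_module R {..<p}" by (rule free_module)
  interpret d0: two_modules R "free_module R {..<rank 1}" "free_module R {..<rank 0}" "diff 0"
    using diff_hom[of 0] by (simp add: two_modules_def two_modules_axioms_def free_module)
  have kt: "\<And>j. j < p \<Longrightarrow> k j \<in> tup R (rank 1)" using g by (simp add: gens_def)
  obtain y n where y: "gens R 1 (ideal_tup I 1) y n"
    using exists_gens[OF tup_submodule_ideal_tup[OF I.ideal_axioms]] by blast
  have yt: "\<And>j. j < n \<Longrightarrow> y j \<in> tup R 1" using y by (simp add: gens_def)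
  have yI: "\<And>j. j < n \<Longrightarrow> y j \<in> ideal_tup I 1" using module.gens_mem[OF self_module y] by blast
  have eval: "lincomb (free_module R {..<m}) y n V l b = lincomb (self_module R) y n (\<lambda>j. V j b) l"
    if "V \<in> tup (free_module R {..<m}) n" for m V l b
  proof -
    interpret E: two_modules R "free_module R {..<m}" "self_module R" "\<lambda>x. x b"
      by (intro two_modules.intro two_modules_axioms.intro free_module self_module free_module_eval)
    show ?thesis using E.f_lincomb[of n y 1 V l] yt that by simp
  qed
  have "\<exists>r\<in>tup R n. x l = lincomb (self_module R) y n r 0" for l
  proof -
    have "(\<lambda>i. if i = 0 then x l else \<zero>) \<in> ideal_tup I 1"
      using x(2) I.Icarr by (auto simp: ideal_tup_def tup_def)
    then obtain r where "r \<in> tup R n" "(\<lambda>i. if i = 0 then x l else \<zero>) = lincomb (self_module R) y n r"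
      using y unfolding gens_def by blast
    then show ?thesis by (intro bexI[of _ r]) (auto dest: fun_cong[of _ _ 0])
  qed
  then obtain r where r: "\<And>l. r l \<in> tup R n" "\<And>l. x l = lincomb (self_module R) y n (r l) 0" by metis
  \<comment> \<open>Expanding every coordinate of \<open>x\<close> in the generators
    \<open>y\<close> of \<open>I\<close> writes \<open>x\<close> as the sum of the
    \<open>y j\<close> times vectors \<open>V j\<close> of the free module. The index 0 in the
    combinations below is the only coordinate of R^1, where \<open>I\<close> lives.\<close>
  define V where "V = (\<lambda>j l. if l < rank 1 then r l j else \<zero>)"
  have V: "V \<in> tup (free_module R {..<rank 1}) n"
    using tupE[OF r(1)] r(1) unfolding tup_def
    by (auto simp: V_def free_module_tup) (auto simp: tup_def)
  have Vx: "lincomb (free_module R {..<rank 1}) y n V 0 = x"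
  proof
    fix l
    show "lincomb (free_module R {..<rank 1}) y n V 0 l = x l"
    proof (cases "l < rank 1")
      case True
      then show ?thesis using r(2)[of l] eval[OF V, of 0 l] by (simp add: V_def)
    next
      case False
      have "lincomb (free_module R {..<rank 1}) y n V 0 \<in> tup R (rank 1)"
        using F.tupD[OF F.lincomb_closed[of n y 1 V, OF yt V], of 0] by (simp add: free_module_tup)
      then show ?thesis using False x(2) by (auto simp: tup_def ideal_tup_def)
    qed
  qed
  have dx: "diff 0 x = (\<lambda>_. \<zero>)" using x(1) diff_kernel[of 0] by auto
  have "lincomb (free_module R {..<rank 0}) y n (\<lambda>j. diff 0 (V j)) l = \<zero>\<^bsub>free_module R {..<rank 0}\<^esub>" for l
  proof -
    have "diff 0 (lincomb (free_module R {..<rank 1}) y n V l) = (\<lambda>_. \<zero>)"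
      using Vx dx F.tup_ge[OF F.lincomb_closed[of n y 1 V, OF yt V], of l] d0.f_zero
      by (cases l) simp_all
    then show ?thesis using d0.f_lincomb[of n y 1 V l, OF yt V] by simp
  qed
  then have "lincomb (free_module R {..<rank 0}) y n (\<lambda>j. diff 0 (V j)) = (\<lambda>_. \<zero>\<^bsub>free_module R {..<rank 0}\<^esub>)"
    by blast
  moreover have "rels_exact R (free_module R {..<rank (Suc (Suc 0))}) (diff (Suc 0))
      (free_module R {..<rank (Suc 0)}) (diff 0) (free_module R {..<rank 0}) y n"
    using tor_vanishes_rels_exact[OF y, of 0] v by simp
  ultimately obtain u w where u: "u \<in> tup (free_module R {..<rank (Suc (Suc 0))}) n"
    and w: "w \<in> dot_span (free_module R {..<rank 1}) (rels R y n)"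
    and Vuw: "V = (\<lambda>l. diff (Suc 0) (u l) \<oplus>\<^bsub>free_module R {..<rank 1}\<^esub> w l)"
    using V unfolding rels_exact_def by fastforce
  \<comment> \<open>The part \<open>w\<close> of \<open>V\<close> is a combination of relations of
    \<open>y\<close> and contributes 0, so \<open>V\<close> may be replaced by the boundaries
    \<open>z j\<close>, which lie in \<open>syz 1\<close>.\<close>
  define z where "z = (\<lambda>j. diff (Suc 0) (u j))"
  have zs: "z j \<in> syz 1" for j
    using diff_image[of 1] module.tupD[OF free_module u, of j] by (auto simp: z_def free_module_tup)
  have z: "z \<in> tup (free_module R {..<rank 1}) n"
  proof -
    interpret d1: two_modules R "free_module R {..<rank (Suc (Suc 0))}" "free_module R {..<rank 1}" "diff (Suc 0)"
      using diff_hom[of "Suc 0"] by (simp add: two_modules_def two_modules_axioms_def free_module)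
    show ?thesis unfolding z_def by (rule d1.f_tup[OF u])
  qed
  have wt: "w \<in> tup (free_module R {..<rank 1}) n" by (rule F.dot_span_tup[OF w rels_tup])
  have "x = lincomb (free_module R {..<rank 1}) y n z 0"
  proof -
    have "lincomb (free_module R {..<rank 1}) y n V 0 = lincomb (free_module R {..<rank 1}) y n z 0
        \<oplus>\<^bsub>free_module R {..<rank 1}\<^esub> \<zero>\<^bsub>free_module R {..<rank 1}\<^esub>"
      using F.lincomb_add[of n y 1 z w, OF yt z wt] F.lincomb_rels[of n y 1 w, OF yt w] Vuw z_def by simp
    also have "\<dots> = lincomb (free_module R {..<rank 1}) y n z 0"
      using F.tupD[OF F.lincomb_closed[of n y 1 z, OF yt z], of 0] by (rule F.M.r_zero)
    finally show ?thesis using Vx by simp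
  qed
  have "\<exists>\<rho>\<in>tup R p. z j = lincomb (self_module R) k p \<rho>" for j
    using zs[of j] g by (auto simp: gens_def)
  then obtain \<rho>' where \<rho>': "\<And>j. \<rho>' j \<in> tup R p" "\<And>j. z j = lincomb (self_module R) k p (\<rho>' j)" by metis
  define \<rho> where "\<rho> = (\<lambda>j. if j < n then \<rho>' j else (\<lambda>_. \<zero>))"
  have \<rho>: "\<rho> \<in> tup (free_module R {..<p}) n" using \<rho>'(1) by (auto simp: \<rho>_def tup_def free_module_tup)
  interpret k: two_modules R "free_module R {..<p}" "free_module R {..<rank 1}" "lincomb (self_module R) k p"
    using lincomb_hom[of p k "rank 1"] kt by (simp add: two_modules_def two_modules_axioms_def free_module)
  have z\<rho>: "z = (\<lambda>j. lincomb (self_module R) k p (\<rho> j))"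
  proof
    fix j
    show "z j = lincomb (self_module R) k p (\<rho> j)"
      using \<rho>'(2)[of j] F.tup_ge[OF z, of j] k.f_zero by (cases "j < n") (simp_all add: \<rho>_def)
  qed
  \<comment> \<open>Exchanging the two sums: the generators \<open>y j\<close> of \<open>I\<close>
    are moved from the elements \<open>z j\<close> to their coefficients over \<open>k\<close>,
    which places the new coefficients in \<open>I\<close>.\<close>
  have "x = lincomb (self_module R) k p (lincomb (free_module R {..<p}) y n \<rho> 0)"
    using \<open>x = lincomb (free_module R {..<rank 1}) y n z 0\<close> k.f_lincomb[of n y 1 \<rho> 0, OF yt \<rho>] z\<rho> by simp
  moreover have "lincomb (free_module R {..<p}) y n \<rho> 0 \<in> ideal_tup I p"
  proof -
    have "lincomb (free_module R {..<p}) y n \<rho> 0 b \<in> I" for b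
    proof -
      have "(\<lambda>j. \<rho> j b) \<in> tup R n"
        using Fp.tupD[OF \<rho>] Fp.tup_ge[OF \<rho>] tupE
        by (simp add: tup_def[of R n] free_module_tup) blast
      then have "lincomb (self_module R) y n (\<lambda>j. \<rho> j b) \<in> ideal_tup I 1"
        using lincomb_mem[OF tup_submodule_ideal_tup[OF I.ideal_axioms], of n y] yI by blast
      then show ?thesis by (simp add: eval[OF \<rho>] ideal_tup_def)
    qed
    moreover have "lincomb (free_module R {..<p}) y n \<rho> 0 \<in> tup R p"
      using Fp.tupD[OF Fp.lincomb_closed[of n y 1 \<rho>, OF yt \<rho>], of 0] by (simp add: free_module_tup)
    ultimately show ?thesis by (simp add: ideal_tup_def)
  qed
  ultimately show ?thesis by blast
qed

end

lemma (in split_minimal_resolution) swap_minimal_resolution: "split_minimal_resolution R J I M g q"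
  by (intro split_minimal_resolution.intro swap minimal_resolution_axioms)

text \<open>By \<open>rels_split\<close> and \<open>syz_1_ideal_part\<close>, the first minimal
  generator is a combination of all generators with coefficients in I + J. Subtracting it from the
  trivial expression gives a relation whose first coefficient is 1 minus an element of I + J.
  Minimality makes this a nonunit, so 1 would be in I + J.\<close>

lemma (in split_minimal_resolution) syz_1_eq_0:
  assumes vI: "tor_vanishes 1 1 (ideal_tup I 1)" and vJ: "tor_vanishes 1 1 (ideal_tup J 1)"
  shows "syz 1 = {\<lambda>_. \<zero>}"
proof (rule ccontr)
  interpret S: module R "self_module R" by (rule self_module)
  assume nz: "syz 1 \<noteq> {\<lambda>_. \<zero>}"
  have kg: "gens R (rank 1) (syz 1) (mat 1) (rank 2)"
    using gens_syz[of 1] by (simp add: numeral_2_eq_2)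
  have kt: "\<And>j. j < rank 2 \<Longrightarrow> mat 1 j \<in> tup R (rank 1)" using kg by (simp add: gens_def)
  have p: "0 < rank 2" by (rule gens_positive[OF kg nz])
  let ?L = "lincomb (self_module R) (mat 1) (rank 2)"
  have x: "mat 1 0 \<in> syz 1" by (rule S.gens_mem[OF kg p])
  have s1: "syz 1 = rels R (mat 0) (rank 1)" using syz_Suc[of 0] by simp
  have "\<exists>a\<in>rels R (mat 0) (rank 1) \<inter> ideal_tup I (rank 1). \<exists>b\<in>rels R (mat 0) (rank 1) \<inter> ideal_tup J (rank 1).
      mat 1 0 = (\<lambda>j. a j \<oplus> b j)"
  proof (rule rels_split[of _ _ "rank 0"])
    show "mat 0 j \<in> tup R (rank 0)" if "j < rank 1" for j using mat_closed[of j 0] that by simp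
    show "mat 1 0 \<in> rels R (mat 0) (rank 1)" using x s1 by simp
    show "mat 1 0 j \<notin> Units R" for j using syz_minimal[of "mat 1 0" 0 j] x by simp
  qed
  then obtain a b where a: "a \<in> syz 1" "a \<in> ideal_tup I (rank 1)" and b: "b \<in> syz 1" "b \<in> ideal_tup J (rank 1)"
    and xab: "mat 1 0 = (\<lambda>j. a j \<oplus> b j)" unfolding s1 by blast
  obtain \<alpha> where \<alpha>: "\<alpha> \<in> ideal_tup I (rank 2)" "a = ?L \<alpha>"
    using syz_1_ideal_part[OF kg vI a] by blast
  obtain \<beta> where \<beta>: "\<beta> \<in> ideal_tup J (rank 2)" "b = ?L \<beta>"
    using split_minimal_resolution.syz_1_ideal_part[OF swap_minimal_resolution kg vJ b] by blast
  have t: "\<alpha> \<in> tup R (rank 2)" "\<beta> \<in> tup R (rank 2)" using \<alpha> \<beta> by (auto simp: ideal_tup_def)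
  define \<delta> where "\<delta> = (\<lambda>j::nat. if j = 0 then \<one> else \<zero>)"
  have \<delta>: "\<delta> \<in> tup R (rank 2)" using p by (auto simp: \<delta>_def tup_def)
  have "?L \<delta> = mat 1 0"
    using lincomb_single[of "rank 2" "mat 1" "rank 1" 0 \<one>, OF kt p] tupE[OF kt[OF p]] by (simp add: \<delta>_def)
  moreover have "?L (\<lambda>j. \<alpha> j \<oplus> \<beta> j) = mat 1 0"
    using S.lincomb_add[of "rank 2" "mat 1" "rank 1" \<alpha> \<beta>] kt t \<alpha>(2) \<beta>(2) xab by simp
  moreover have abt: "(\<lambda>j. \<alpha> j \<oplus> \<beta> j) \<in> tup R (rank 2)" using t by simp
  moreover have "?L (\<lambda>j. \<delta> j \<ominus>\<^bsub>self_module R\<^esub> (\<alpha> j \<oplus> \<beta> j)) = (\<lambda>l. mat 1 0 l \<ominus>\<^bsub>self_module R\<^esub> mat 1 0 l)"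
    using S.lincomb_diff[of "rank 2" "mat 1" "rank 1" \<delta> "\<lambda>j. \<alpha> j \<oplus> \<beta> j"] kt \<delta> abt calculation by simp
  moreover have "z \<oplus> (\<ominus>\<^bsub>self_module R\<^esub> z) = \<zero>" if "z \<in> carrier R" for z
    using S.M.r_neg[of z] that by simp
  ultimately have "(\<lambda>j. \<delta> j \<ominus>\<^bsub>self_module R\<^esub> (\<alpha> j \<oplus> \<beta> j)) \<in> rels R (mat 1) (rank 2)"
    using S.tup_diff[of \<delta> "rank 2" "\<lambda>j. \<alpha> j \<oplus> \<beta> j"] \<delta> tupE[OF kt[OF p]]
    by (simp add: rels_def a_minus_def)
  then have "(\<lambda>j. \<delta> j \<ominus>\<^bsub>self_module R\<^esub> (\<alpha> j \<oplus> \<beta> j)) \<in> syz (Suc 1)"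
    using syz_Suc[of 1] by (simp add: numeral_2_eq_2)
  from syz_minimal[OF this, of 0] have nu: "\<one> \<ominus>\<^bsub>self_module R\<^esub> (\<alpha> 0 \<oplus> \<beta> 0) \<notin> Units R"
    by (simp add: \<delta>_def)
  have c: "\<alpha> 0 \<in> I" "\<beta> 0 \<in> J" using \<alpha> \<beta> by (auto simp: ideal_tup_def)
  have cc: "\<alpha> 0 \<in> carrier R" "\<beta> 0 \<in> carrier R" using c I.Icarr J.Icarr by auto
  have "\<one> \<ominus>\<^bsub>self_module R\<^esub> (\<alpha> 0 \<oplus> \<beta> 0) \<in> carrier R" using S.M.minus_closed[of \<one> "\<alpha> 0 \<oplus> \<beta> 0"] cc by simp
  from split[OF this nu] obtain a' b' where ab': "a' \<in> I" "b' \<in> J"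
    "\<one> \<ominus>\<^bsub>self_module R\<^esub> (\<alpha> 0 \<oplus> \<beta> 0) = a' \<oplus> b'" by blast
  have cc': "a' \<in> carrier R" "b' \<in> carrier R" using ab' I.Icarr J.Icarr by auto
  have "\<one> = (\<one> \<ominus>\<^bsub>self_module R\<^esub> (\<alpha> 0 \<oplus> \<beta> 0)) \<oplus> (\<alpha> 0 \<oplus> \<beta> 0)"
    using S.M.a_assoc[of \<one> "\<ominus>\<^bsub>self_module R\<^esub> (\<alpha> 0 \<oplus> \<beta> 0)" "\<alpha> 0 \<oplus> \<beta> 0"] S.M.l_neg[of "\<alpha> 0 \<oplus> \<beta> 0"]
      S.M.a_inv_closed[of "\<alpha> 0 \<oplus> \<beta> 0"] cc by (simp add: a_minus_def)
  also have "\<dots> = (a' \<oplus> \<alpha> 0) \<oplus> (b' \<oplus> \<beta> 0)" unfolding ab'(3) using cc cc' by (simp add: a_ac)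
  finally have "\<one> = (a' \<oplus> \<alpha> 0) \<oplus> (b' \<oplus> \<beta> 0)" .
  moreover have "a' \<oplus> \<alpha> 0 \<in> I" "b' \<oplus> \<beta> 0 \<in> J" using ab' c by auto
  ultimately show False using nonunit Units_one_closed by metis
qed

section \<open>Homology of a tensored complex\<close>

abbreviation tensor_frags ::
  "('r, 'a, 'y) module_scheme \<Rightarrow> ('r, 'b, 'z) module_scheme \<Rightarrow> ('a \<times> 'b \<Rightarrow>\<^sub>0 int) monoid" where
  "tensor_frags M N \<equiv> free_Abelian_group (carrier M \<times> carrier N)"

abbreviation frag_map :: "('a \<Rightarrow> 'b) \<Rightarrow> ('a \<times> 'c \<Rightarrow>\<^sub>0 int) \<Rightarrow> ('b \<times> 'c \<Rightarrow>\<^sub>0 int)" where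
  "frag_map f \<equiv> frag_extend (\<lambda>(x, y). frag_of (f x, y))"

definition tensor_gens ::
  "('r, 'x) ring_scheme \<Rightarrow> ('r, 'a, 'y) module_scheme \<Rightarrow> ('r, 'b, 'z) module_scheme \<Rightarrow> ('a \<times> 'b \<Rightarrow>\<^sub>0 int) set" where
  "tensor_gens R M N =
     {frag_of (x \<oplus>\<^bsub>M\<^esub> x', y) - frag_of (x, y) - frag_of (x', y) | x x' y.
         x \<in> carrier M \<and> x' \<in> carrier M \<and> y \<in> carrier N} \<union>
      {frag_of (x, y \<oplus>\<^bsub>N\<^esub> y') - frag_of (x, y) - frag_of (x, y') | x y y'.
         x \<in> carrier M \<and> y \<in> carrier N \<and> y' \<in> carrier N} \<union>
      {frag_of (r \<odot>\<^bsub>M\<^esub> x, y) - frag_of (x, r \<odot>\<^bsub>N\<^esub> y) | r x y.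
         r \<in> carrier R \<and> x \<in> carrier M \<and> y \<in> carrier N}"

lemma tensor_rels_eq: "tensor_rels R M N = generate (tensor_frags M N) (tensor_gens R M N)"
  by (simp add: tensor_rels_def tensor_gens_def)

lemma tensor_gens_cases:
  assumes "a \<in> tensor_gens R M N"
    and "\<And>x x' y. \<lbrakk>x \<in> carrier M; x' \<in> carrier M; y \<in> carrier N\<rbrakk> \<Longrightarrow>
      Q (frag_of (x \<oplus>\<^bsub>M\<^esub> x', y) - frag_of (x, y) - frag_of (x', y))"
    and "\<And>x y y'. \<lbrakk>x \<in> carrier M; y \<in> carrier N; y' \<in> carrier N\<rbrakk> \<Longrightarrow>
      Q (frag_of (x, y \<oplus>\<^bsub>N\<^esub> y') - frag_of (x, y) - frag_of (x, y'))"
    and "\<And>r x y. \<lbrakk>r \<in> carrier R; x \<in> carrier M; y \<in> carrier N\<rbrakk> \<Longrightarrow>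
      Q (frag_of (r \<odot>\<^bsub>M\<^esub> x, y) - frag_of (x, r \<odot>\<^bsub>N\<^esub> y))"
  shows "Q a"
  using assms(1) unfolding tensor_gens_def
  by (elim UnE CollectE exE conjE) (simp_all add: assms(2-4))

lemma free_Abelian_group_diff:
  "a \<in> carrier (free_Abelian_group S) \<Longrightarrow> b \<in> carrier (free_Abelian_group S) \<Longrightarrow>
    a - b \<in> carrier (free_Abelian_group S)"
  using keys_diff[of a b] by auto

lemma frag_map_closed:
  assumes "\<And>x. x \<in> carrier M \<Longrightarrow> f x \<in> carrier M'" "c \<in> carrier (tensor_frags M N)"
  shows "frag_map f c \<in> carrier (tensor_frags M' N)"
proof -
  have "Poly_Mapping.keys (frag_map f c) \<subseteq> (\<Union>z\<in>Poly_Mapping.keys c. Poly_Mapping.keys (case z of (x, y) \<Rightarrow> frag_of (f x, y)))"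
    by (rule keys_frag_extend)
  then show ?thesis using assms by fastforce
qed

locale tensor_pair = M: module R M + N: module R N
  for R (structure) and M :: "('a, 'b, 'c) module_scheme" and N :: "('a, 'd, 'e) module_scheme"
begin

abbreviation F where "F \<equiv> tensor_frags M N"
abbreviation T where "T \<equiv> tensor_rels R M N"

lemma tensor_gens_closed: "tensor_gens R M N \<subseteq> carrier F"
proof -
  have *: "frag_of a - frag_of b - frag_of c \<in> carrier F" "frag_of a - frag_of b \<in> carrier F"
    if "a \<in> carrier M \<times> carrier N" "b \<in> carrier M \<times> carrier N" "c \<in> carrier M \<times> carrier N" for a b c
    using that by (intro free_Abelian_group_diff; simp)+
  show ?thesis unfolding tensor_gens_def
    by (auto simp del: carrier_free_Abelian_group_iff intro!: *)
qed

lemma subgroup_T: "subgroup T F"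
  unfolding tensor_rels_eq by (intro group.generate_is_subgroup tensor_gens_closed) simp

lemma T_closed: "c \<in> T \<Longrightarrow> c \<in> carrier F"
  using subgroup.mem_carrier[OF subgroup_T] by blast

lemma T_zero: "0 \<in> T"
  using subgroup.one_closed[OF subgroup_T] by simp

lemma T_add: "a \<in> T \<Longrightarrow> b \<in> T \<Longrightarrow> a + b \<in> T"
  using subgroup.m_closed[OF subgroup_T] by simp

lemma T_minus: "a \<in> T \<Longrightarrow> - a \<in> T"
  using subgroup.m_inv_closed[OF subgroup_T, of a] T_closed[of a] by simp

lemma T_diff: "a \<in> T \<Longrightarrow> b \<in> T \<Longrightarrow> a - b \<in> T"
  using T_add[OF _ T_minus, of a b] by simp

lemma T_gen: "a \<in> tensor_gens R M N \<Longrightarrow> a \<in> T"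
  unfolding tensor_rels_eq by (rule generate.incl)

lemma T_add_left: "\<lbrakk>x \<in> carrier M; x' \<in> carrier M; y \<in> carrier N\<rbrakk> \<Longrightarrow>
    frag_of (x \<oplus>\<^bsub>M\<^esub> x', y) - frag_of (x, y) - frag_of (x', y) \<in> T"
  by (rule T_gen) (unfold tensor_gens_def, blast)

lemma T_add_right: "\<lbrakk>x \<in> carrier M; y \<in> carrier N; y' \<in> carrier N\<rbrakk> \<Longrightarrow>
    frag_of (x, y \<oplus>\<^bsub>N\<^esub> y') - frag_of (x, y) - frag_of (x, y') \<in> T"
  by (rule T_gen) (unfold tensor_gens_def, blast)

lemma T_smult: "\<lbrakk>r \<in> carrier R; x \<in> carrier M; y \<in> carrier N\<rbrakk> \<Longrightarrow>
    frag_of (r \<odot>\<^bsub>M\<^esub> x, y) - frag_of (x, r \<odot>\<^bsub>N\<^esub> y) \<in> T"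
  by (rule T_gen) (unfold tensor_gens_def, blast)

text \<open>Closure under differences, together with 0, covers sums and inverses in one case, which
  matches the additivity lemma \<open>frag_extend_diff\<close>.\<close>

lemma T_induct [consumes 1, case_names zero gen diff]:
  assumes "c \<in> T" "Q 0" "\<And>a. a \<in> tensor_gens R M N \<Longrightarrow> Q a"
    and "\<And>a b. a \<in> T \<Longrightarrow> b \<in> T \<Longrightarrow> Q a \<Longrightarrow> Q b \<Longrightarrow> Q (a - b)"
  shows "Q c"
proof -
  have neg: "Q (- a)" if "a \<in> T" "Q a" for a using assms(4)[OF T_zero that(1) assms(2) that(2)] by simp
  from assms(1) have "c \<in> T \<and> Q c"
    unfolding tensor_rels_eq
  proof induction
    case one
    then show ?case using assms(2) T_zero by (simp add: tensor_rels_eq)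
  next
    case (incl h)
    then show ?case using assms(3) generate.incl by metis
  next
    case (inv h)
    have h: "h \<in> T" using inv by (rule T_gen)
    have "inv\<^bsub>F\<^esub> h = - h" using T_closed[OF h] by simp
    then show ?case using neg[OF h assms(3)[OF inv]] T_minus[OF h] by (simp add: tensor_rels_eq)
  next
    case (eng a b)
    have ab: "a \<in> T" "b \<in> T" using eng by (simp_all add: tensor_rels_eq)
    have "Q (a - - b)" using assms(4)[OF ab(1) T_minus[OF ab(2)]] neg[OF ab(2)] eng by blast
    then show ?case using T_add[OF ab] by (simp add: tensor_rels_eq)
  qed
  then show ?thesis ..
qed

lemma coset_eq_iff:
  assumes "a \<in> carrier F" "b \<in> carrier F"
  shows "T #>\<^bsub>F\<^esub> a = T #>\<^bsub>F\<^esub> b \<longleftrightarrow> a - b \<in> T"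
proof
  assume "T #>\<^bsub>F\<^esub> a = T #>\<^bsub>F\<^esub> b"
  moreover have "a \<in> T #>\<^bsub>F\<^esub> a" using T_zero by (auto simp: r_coset_def)
  ultimately obtain h where "h \<in> T" "a = h + b" by (auto simp: r_coset_def)
  then show "a - b \<in> T" by simp
next
  assume ab: "a - b \<in> T"
  have "h + a \<in> T #>\<^bsub>F\<^esub> b" if "h \<in> T" for h
  proof -
    show ?thesis using T_add[OF that ab] by (auto simp: r_coset_def intro!: bexI[of _ "h + (a - b)"])
  qed
  moreover have "h + b \<in> T #>\<^bsub>F\<^esub> a" if "h \<in> T" for h
  proof -
    show ?thesis using T_diff[OF that ab] by (auto simp: r_coset_def intro!: bexI[of _ "h - (a - b)"])
  qed
  ultimately show "T #>\<^bsub>F\<^esub> a = T #>\<^bsub>F\<^esub> b" by (auto simp: r_coset_def)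
qed

lemma coset_zero: "T #>\<^bsub>F\<^esub> 0 = T"
  by (auto simp: r_coset_def)

lemma normal_T: "T \<lhd> F"
  by (rule comm_group.subgroup_imp_normal[OF abelian_free_Abelian_group subgroup_T])

lemma comm_group_tensor: "comm_group (tensor R M N)"
  unfolding tensor_def by (rule comm_group.abelian_FactGroup[OF abelian_free_Abelian_group subgroup_T])

lemma tensor_carrier: "carrier (tensor R M N) = {T #>\<^bsub>F\<^esub> c | c. c \<in> carrier F}"
  by (auto simp: tensor_def FactGroup_def RCOSETS_def)

lemma tensor_one: "\<one>\<^bsub>tensor R M N\<^esub> = T"
  by (simp add: tensor_def FactGroup_def)

lemma tensor_mult:
  assumes "a \<in> carrier F" "b \<in> carrier F"
  shows "(T #>\<^bsub>F\<^esub> a) \<otimes>\<^bsub>tensor R M N\<^esub> (T #>\<^bsub>F\<^esub> b) = T #>\<^bsub>F\<^esub> (a + b)"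
  using normal.rcos_sum[OF normal_T assms] by (simp add: tensor_def FactGroup_def)

end

section \<open>The map induced on tensor products by a homomorphism\<close>

locale tensor_hom = M: tensor_pair R M N + M': tensor_pair R M' N
  for R (structure) and M and M' and N + fixes f assumes hom: "f \<in> mod_hom R M M'"
begin

lemma frag_map_rels: "c \<in> tensor_rels R M N \<Longrightarrow> frag_map f c \<in> tensor_rels R M' N"
proof (induction rule: M.T_induct)
  case zero
  then show ?case using M'.T_zero by simp
next
  case (gen a)
  note h = mod_homD[OF hom]
  from gen show ?case
  proof (rule tensor_gens_cases)
    show "frag_map f (frag_of (x \<oplus>\<^bsub>M\<^esub> x', y) - frag_of (x, y) - frag_of (x', y)) \<in> tensor_rels R M' N"
      if "x \<in> carrier M" "x' \<in> carrier M" "y \<in> carrier N" for x x' y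
      using M'.T_add_left[OF h(1)[OF that(1)] h(1)[OF that(2)] that(3)] that
      by (simp add: frag_extend_diff h)
    show "frag_map f (frag_of (x, y \<oplus>\<^bsub>N\<^esub> y') - frag_of (x, y) - frag_of (x, y')) \<in> tensor_rels R M' N"
      if "x \<in> carrier M" "y \<in> carrier N" "y' \<in> carrier N" for x y y'
      using M'.T_add_right[OF h(1)[OF that(1)] that(2,3)] by (simp add: frag_extend_diff)
    show "frag_map f (frag_of (r \<odot>\<^bsub>M\<^esub> x, y) - frag_of (x, r \<odot>\<^bsub>N\<^esub> y)) \<in> tensor_rels R M' N"
      if "r \<in> carrier R" "x \<in> carrier M" "y \<in> carrier N" for r x y
      using M'.T_smult[OF that(1) h(1)[OF that(2)] that(3)] that by (simp add: frag_extend_diff h)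
  qed
next
  case (diff a b)
  then show ?case using M'.T_diff by (simp add: frag_extend_diff)
qed

lemma frag_map_carrier: "c \<in> carrier (tensor_frags M N) \<Longrightarrow> frag_map f c \<in> carrier (tensor_frags M' N)"
  by (rule frag_map_closed[OF mod_homD(1)[OF hom]])

text \<open>Two representatives differ by an element of \<open>tensor_rels\<close>, which
  \<open>frag_map\<close> sends to \<open>tensor_rels\<close> again; so the set under
  \<open>the_elem\<close> is indeed a singleton.\<close>

lemma tensor_map_coset:
  assumes c: "c \<in> carrier (tensor_frags M N)"
  shows "tensor_map R M M' f N (tensor_rels R M N #>\<^bsub>tensor_frags M N\<^esub> c) =
    tensor_rels R M' N #>\<^bsub>tensor_frags M' N\<^esub> frag_map f c"
proof -
  have "tensor_rels R M' N #>\<^bsub>tensor_frags M' N\<^esub> frag_map f (h + c) =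
      tensor_rels R M' N #>\<^bsub>tensor_frags M' N\<^esub> frag_map f c" if h: "h \<in> tensor_rels R M N" for h
  proof -
    have "h + c \<in> carrier (tensor_frags M N)"
      using M.T_closed[OF h] c keys_add[of h c] by auto
    from M'.coset_eq_iff[OF frag_map_carrier[OF this] frag_map_carrier[OF c]] show ?thesis
      using frag_map_rels[OF h] by (simp add: frag_extend_add)
  qed
  then have "(\<lambda>c. tensor_rels R M' N #>\<^bsub>tensor_frags M' N\<^esub> frag_map f c) ` (tensor_rels R M N #>\<^bsub>tensor_frags M N\<^esub> c) =
      {tensor_rels R M' N #>\<^bsub>tensor_frags M' N\<^esub> frag_map f c}"
    using M.T_zero by (auto simp: r_coset_def)
  then show ?thesis unfolding tensor_map_def by simp
qed

lemma tensor_map_hom: "tensor_map R M M' f N \<in> hom (tensor R M N) (tensor R M' N)"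
proof (rule homI)
  fix x assume "x \<in> carrier (tensor R M N)"
  then obtain c where "c \<in> carrier (tensor_frags M N)" "x = tensor_rels R M N #>\<^bsub>tensor_frags M N\<^esub> c"
    unfolding M.tensor_carrier by blast
  then show "tensor_map R M M' f N x \<in> carrier (tensor R M' N)"
    using tensor_map_coset frag_map_carrier unfolding M'.tensor_carrier by blast
next
  fix x y assume "x \<in> carrier (tensor R M N)" "y \<in> carrier (tensor R M N)"
  then obtain a b where a: "a \<in> carrier (tensor_frags M N)" "x = tensor_rels R M N #>\<^bsub>tensor_frags M N\<^esub> a"
    and b: "b \<in> carrier (tensor_frags M N)" "y = tensor_rels R M N #>\<^bsub>tensor_frags M N\<^esub> b"
    unfolding M.tensor_carrier by blast
  have ab: "a + b \<in> carrier (tensor_frags M N)" using a(1) b(1) keys_add[of a b] by auto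
  show "tensor_map R M M' f N (x \<otimes>\<^bsub>tensor R M N\<^esub> y) =
      tensor_map R M M' f N x \<otimes>\<^bsub>tensor R M' N\<^esub> tensor_map R M M' f N y"
    unfolding a(2) b(2) M.tensor_mult[OF a(1) b(1)] tensor_map_coset[OF ab] tensor_map_coset[OF a(1)]
      tensor_map_coset[OF b(1)] M'.tensor_mult[OF frag_map_carrier[OF a(1)] frag_map_carrier[OF b(1)]]
    by (simp add: frag_extend_add)
qed

end

lemma (in comm_group) trivial_quotient_iff:
  assumes A: "subgroup A G" and B: "B \<subseteq> A" "\<one> \<in> B"
  shows "trivial_group (G\<lparr>carrier := A\<rparr> Mod B) \<longleftrightarrow> A \<subseteq> B"
proof
  assume "trivial_group (G\<lparr>carrier := A\<rparr> Mod B)"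
  then have eq: "B #>\<^bsub>G\<lparr>carrier := A\<rparr>\<^esub> x = B" if "x \<in> A" for x
    using that by (auto simp: trivial_group_def FactGroup_def RCOSETS_def)
  show "A \<subseteq> B"
  proof
    fix x assume x: "x \<in> A"
    then have "\<one> \<otimes> x \<in> B #>\<^bsub>G\<lparr>carrier := A\<rparr>\<^esub> x" using B(2) by (auto simp: r_coset_def)
    then show "x \<in> B" using eq[OF x] subgroup.mem_carrier[OF A x] by simp
  qed
next
  assume "A \<subseteq> B"
  then have AB: "B = A" using B by blast
  interpret A: comm_group "G\<lparr>carrier := A\<rparr>" 
    using subgroup.subgroup_is_group[OF A is_group] subgroup.mem_carrier[OF A] m_comm
    by (intro group.group_comm_groupI) auto
  have s: "subgroup A (G\<lparr>carrier := A\<rparr>)" using A.subgroup_self by simp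
  have "group (G\<lparr>carrier := A\<rparr> Mod A)"
    by (rule normal.factorgroup_is_group[OF A.subgroup_imp_normal[OF s]])
  moreover have "A #>\<^bsub>G\<lparr>carrier := A\<rparr>\<^esub> x = A" if "x \<in> A" for x
    by (rule A.coset_join2) (use that s in auto)
  then have "rcosets\<^bsub>G\<lparr>carrier := A\<rparr>\<^esub> A = {A}"
    using A.one_closed by (auto simp: RCOSETS_def)
  ultimately show "trivial_group (G\<lparr>carrier := A\<rparr> Mod B)"
    by (simp add: trivial_group_def AB FactGroup_def)
qed

text \<open>Both quotients, by the bilinearity relations and by the boundaries, are removed in
  favour of representatives: a cycle modulo the relations has to be a boundary modulo the
  relations.\<close>

lemma trivial_tensor_homology_iff:
  fixes P :: "nat \<Rightarrow> ('r, 'p) module"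
  assumes P: "\<And>n. module R (P n)" and N: "module R N"
    and d: "\<And>n. d n \<in> mod_hom R (P (Suc n)) (P n)"
    and dd: "\<And>n x. x \<in> carrier (P (Suc (Suc n))) \<Longrightarrow> d n (d (Suc n) x) = \<zero>\<^bsub>P n\<^esub>"
  shows "trivial_group (tensor_homology R P d N (Suc n)) \<longleftrightarrow>
    (\<forall>c\<in>carrier (tensor_frags (P (Suc n)) N). frag_map (d n) c \<in> tensor_rels R (P n) N \<longrightarrow>
       (\<exists>u\<in>carrier (tensor_frags (P (Suc (Suc n))) N).
          c - frag_map (d (Suc n)) u \<in> tensor_rels R (P (Suc n)) N))"
proof -
  interpret f: tensor_hom R "P (Suc (Suc n))" "P (Suc n)" N "d (Suc n)"
    by (intro tensor_hom.intro tensor_pair.intro tensor_hom_axioms.intro P N d)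
  interpret h: tensor_hom R "P (Suc n)" "P n" N "d n"
    by (intro tensor_hom.intro tensor_pair.intro tensor_hom_axioms.intro P N d)
  let ?F = "tensor_frags (P (Suc n)) N" and ?T = "tensor_rels R (P (Suc n)) N"
  let ?G = "tensor R (P (Suc n)) N"
  interpret G: comm_group ?G by (rule f.M'.comm_group_tensor)
  interpret G': comm_group "tensor R (P n) N" by (rule h.M'.comm_group_tensor)
  interpret dh: group_hom ?G "tensor R (P n) N" "tensor_map R (P (Suc n)) (P n) (d n) N"
    using h.tensor_map_hom by (intro group_hom.intro group_hom_axioms.intro G.is_group G'.is_group)
  define Z where "Z = tensor_cycles R P d N (Suc n)"
  define B where "B = tensor_map R (P (Suc (Suc n))) (P (Suc n)) (d (Suc n)) N ` carrier (tensor R (P (Suc (Suc n))) N)"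
  have Z_kernel: "Z = kernel ?G (tensor R (P n) N) (tensor_map R (P (Suc n)) (P n) (d n) N)"
    by (simp add: Z_def tensor_cycles_def)
  have Z: "Z = {?T #>\<^bsub>?F\<^esub> c | c. c \<in> carrier ?F \<and> frag_map (d n) c \<in> tensor_rels R (P n) N}"
  proof -
    have "tensor_map R (P (Suc n)) (P n) (d n) N (?T #>\<^bsub>?F\<^esub> c) = \<one>\<^bsub>tensor R (P n) N\<^esub> \<longleftrightarrow>
        frag_map (d n) c \<in> tensor_rels R (P n) N" if c: "c \<in> carrier ?F" for c
    proof -
      have "tensor_rels R (P n) N #>\<^bsub>tensor_frags (P n) N\<^esub> frag_map (d n) c =
          tensor_rels R (P n) N #>\<^bsub>tensor_frags (P n) N\<^esub> 0 \<longleftrightarrow> frag_map (d n) c - 0 \<in> tensor_rels R (P n) N"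
        by (rule h.M'.coset_eq_iff[OF h.frag_map_carrier[OF c]]) simp
      then show ?thesis by (simp add: h.tensor_map_coset[OF c] h.M'.tensor_one h.M'.coset_zero)
    qed
    then show ?thesis unfolding Z_kernel kernel_def f.M'.tensor_carrier by blast
  qed
  have B: "B = {?T #>\<^bsub>?F\<^esub> frag_map (d (Suc n)) u | u. u \<in> carrier (tensor_frags (P (Suc (Suc n))) N)}"
    unfolding B_def f.M.tensor_carrier using f.tensor_map_coset by (auto simp: image_iff)
  have "B \<subseteq> Z"
  proof
    fix x assume "x \<in> B"
    then obtain u where u: "u \<in> carrier (tensor_frags (P (Suc (Suc n))) N)" "x = ?T #>\<^bsub>?F\<^esub> frag_map (d (Suc n)) u"
      unfolding B by blast
    have "frag_map (d n) (frag_map (d (Suc n)) u) \<in> tensor_rels R (P n) N"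
      using u(1)[unfolded carrier_free_Abelian_group_iff]
    proof (induction u rule: frag_induction)
      case zero
      then show ?case using h.M'.T_zero by simp
    next
      case (one xy)
      then obtain a b where ab: "xy = (a, b)" "a \<in> carrier (P (Suc (Suc n)))" "b \<in> carrier N" by auto
      have z: "\<zero>\<^bsub>P n\<^esub> \<in> carrier (P n)" "\<zero>\<^bsub>P n\<^esub> \<oplus>\<^bsub>P n\<^esub> \<zero>\<^bsub>P n\<^esub> = \<zero>\<^bsub>P n\<^esub>" by simp_all
      \<comment> \<open>The additivity relation for 0 + 0 = 0 is the negative of the symbol itself,
        so 0 \<otimes> b is a relation.\<close>
      have "- frag_of (\<zero>\<^bsub>P n\<^esub>, b) \<in> tensor_rels R (P n) N"
        using h.M'.T_add_left[OF z(1) z(1) ab(3)] z(2) by simp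
      then have "frag_of (\<zero>\<^bsub>P n\<^esub>, b) \<in> tensor_rels R (P n) N"
        using h.M'.T_minus by fastforce
      then show ?case by (simp add: ab(1) dd[OF ab(2)])
    next
      case (diff a b)
      then show ?case using h.M'.T_diff by (simp add: frag_extend_diff)
    qed
    then show "x \<in> Z" unfolding Z using u f.frag_map_carrier by blast
  qed
  have "?T #>\<^bsub>?F\<^esub> frag_map (d (Suc n)) 0 = \<one>\<^bsub>?G\<^esub>"
    using f.M'.coset_zero by (simp add: f.M'.tensor_one)
  then have "\<one>\<^bsub>?G\<^esub> \<in> B" unfolding B using carrier_free_Abelian_group_iff[of 0]
    by (metis (mono_tags, lifting) empty_subsetI keys_zero mem_Collect_eq)
  have "trivial_group (tensor_homology R P d N (Suc n)) \<longleftrightarrow> Z \<subseteq> B"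
    unfolding tensor_homology_def Z_def[symmetric] B_def[symmetric]
    using dh.subgroup_kernel \<open>B \<subseteq> Z\<close> \<open>\<one>\<^bsub>?G\<^esub> \<in> B\<close>
    by (intro G.trivial_quotient_iff) (simp_all add: Z_kernel)
  also have "\<dots> \<longleftrightarrow> (\<forall>c\<in>carrier ?F. frag_map (d n) c \<in> tensor_rels R (P n) N \<longrightarrow> ?T #>\<^bsub>?F\<^esub> c \<in> B)"
    unfolding Z by blast
  also have "\<dots> \<longleftrightarrow> (\<forall>c\<in>carrier ?F. frag_map (d n) c \<in> tensor_rels R (P n) N \<longrightarrow>
      (\<exists>u\<in>carrier (tensor_frags (P (Suc (Suc n))) N). c - frag_map (d (Suc n)) u \<in> ?T))"
  proof -
    have "?T #>\<^bsub>?F\<^esub> c \<in> B \<longleftrightarrow>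
        (\<exists>u\<in>carrier (tensor_frags (P (Suc (Suc n))) N). c - frag_map (d (Suc n)) u \<in> ?T)"
      if c: "c \<in> carrier ?F" for c
      unfolding B using f.M'.coset_eq_iff[OF c f.frag_map_carrier] by blast
    then show ?thesis by blast
  qed
  finally show ?thesis .
qed

section \<open>Tensor products in coordinates\<close>

context tensor_pair begin

lemma T_sum: "(\<And>i. i \<in> A \<Longrightarrow> h i \<in> T) \<Longrightarrow> sum h A \<in> T"
  by (induction A rule: infinite_finite_induct) (auto intro: T_zero T_add)

lemma T_zero_left: "y \<in> carrier N \<Longrightarrow> frag_of (\<zero>\<^bsub>M\<^esub>, y) \<in> T"
  using T_minus[OF T_add_left[of "\<zero>\<^bsub>M\<^esub>" "\<zero>\<^bsub>M\<^esub>" y]] by simp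

lemma T_zero_right: "x \<in> carrier M \<Longrightarrow> frag_of (x, \<zero>\<^bsub>N\<^esub>) \<in> T"
  using T_minus[OF T_add_right[of x "\<zero>\<^bsub>N\<^esub>" "\<zero>\<^bsub>N\<^esub>"]] by simp

end

context minimal_resolution begin

definition coords :: "'m \<Rightarrow> nat \<Rightarrow> 'r" where
  "coords y = (SOME r. r \<in> tup R q \<and> aug r = y)"

lemma coords:
  assumes "y \<in> carrier M" shows "coords y \<in> tup R q" "aug (coords y) = y"
proof -
  have "\<exists>r. r \<in> tup R q \<and> aug r = y"
  proof -
    have "y \<in> aug ` tup R q" using assms g_span by (simp add: aug_def[abs_def])
    then show ?thesis by auto
  qed
  from someI_ex[OF this] show "coords y \<in> tup R q" "aug (coords y) = y"
    by (simp_all add: coords_def)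
qed

interpretation A: two_modules R "free_module R {..<q}" M aug
  by (intro two_modules.intro two_modules_axioms.intro free_module M.module_axioms aug_hom)

lemma aug_closed: "r \<in> tup R q \<Longrightarrow> aug r \<in> carrier M"
  using A.f_closed by (simp add: free_module_tup)

lemma aug_add: "r \<in> tup R q \<Longrightarrow> s \<in> tup R q \<Longrightarrow> aug (\<lambda>l. r l \<oplus> s l) = aug r \<oplus>\<^bsub>M\<^esub> aug s"
  using A.f_add by (simp add: free_module_tup)

lemma aug_smult: "r \<in> tup R q \<Longrightarrow> a \<in> carrier R \<Longrightarrow> aug (\<lambda>l. a \<otimes> r l) = a \<odot>\<^bsub>M\<^esub> aug r"
  using A.f_smult by (simp add: free_module_tup)

lemma ker_augI:
  assumes "r \<in> tup R q" "s \<in> tup R q" "aug r = aug s"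
  shows "(\<lambda>l. r l \<ominus> s l) \<in> ker_aug"
proof -
  have t: "(\<lambda>l. r l \<ominus> s l) \<in> tup R q" unfolding a_minus_def using assms by (intro tup_closed)
  have "r l \<ominus> s l \<oplus> s l = r l" for l
    using tupE[OF assms(1)] tupE[OF assms(2)] by (simp add: a_minus_def a_assoc l_neg)
  then have "aug r = aug (\<lambda>l. r l \<ominus> s l) \<oplus>\<^bsub>M\<^esub> aug s" using aug_add[OF t assms(2)] by simp
  then have "aug (\<lambda>l. r l \<ominus> s l) = \<zero>\<^bsub>M\<^esub>"
    using assms(3) M.M.add.r_cancel_one'[OF aug_closed[OF assms(2)] aug_closed[OF t]] by simp
  then show ?thesis using t by (simp add: ker_aug_def)
qed

end

locale tensor_coords = minimal_resolution R M g q + P: tensor_pair R P M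
  for R :: "('r, 'x) ring_scheme" (structure) and M :: "('r, 'm, 'y) module_scheme" and g q
    and P :: "('r, 'p, 'z) module_scheme"
begin

text \<open>The maps \<open>tup_of\<close> and \<open>frag_of_tup\<close> induce mutually inverse isomorphisms between \<open>P \<otimes> M\<close> and \<open>P\<^sup>q\<close>
  modulo the image of \<open>P \<otimes> ker_aug\<close>.\<close>

definition tup_of :: "('p \<times> 'm \<Rightarrow>\<^sub>0 int) \<Rightarrow> nat \<Rightarrow> 'p" where
  "tup_of c = (\<lambda>l. (SOME h. h \<in> hom (tensor_frags P M) (add_monoid P) \<and>
      (\<forall>z\<in>carrier P \<times> carrier M. h (frag_of z) = coords (snd z) l \<odot>\<^bsub>P\<^esub> fst z)) c)"

definition frag_of_tup :: "(nat \<Rightarrow> 'p) \<Rightarrow> 'p \<times> 'm \<Rightarrow>\<^sub>0 int" where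
  "frag_of_tup x = (\<Sum>l<q. frag_of (x l, g l))"

lemma tup_of_hom:
  "(\<lambda>c. tup_of c l) \<in> hom (tensor_frags P M) (add_monoid P)"
  "x \<in> carrier P \<Longrightarrow> y \<in> carrier M \<Longrightarrow> tup_of (frag_of (x, y)) l = coords y l \<odot>\<^bsub>P\<^esub> x"
proof -
  have "(\<lambda>z. coords (snd z) l \<odot>\<^bsub>P\<^esub> fst z) ` (carrier P \<times> carrier M) \<subseteq> carrier (add_monoid P)"
    using tupE[OF coords(1)] by auto
  from comm_group.free_Abelian_group_universal[OF P.M.M.a_comm_group this]
  obtain h where "h \<in> hom (tensor_frags P M) (add_monoid P)"
    "\<And>z. z \<in> carrier P \<times> carrier M \<Longrightarrow> h (frag_of z) = coords (snd z) l \<odot>\<^bsub>P\<^esub> fst z"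
    by blast
  then have "\<exists>h. h \<in> hom (tensor_frags P M) (add_monoid P) \<and>
      (\<forall>z\<in>carrier P \<times> carrier M. h (frag_of z) = coords (snd z) l \<odot>\<^bsub>P\<^esub> fst z)" by auto
  note * = someI_ex[OF this]
  show "(\<lambda>c. tup_of c l) \<in> hom (tensor_frags P M) (add_monoid P)"
    unfolding tup_of_def using * by (simp add: eta_contract_eq)
  show "x \<in> carrier P \<Longrightarrow> y \<in> carrier M \<Longrightarrow> tup_of (frag_of (x, y)) l = coords y l \<odot>\<^bsub>P\<^esub> x"
    unfolding tup_of_def using * by auto
qed

lemma tup_of_closed: "c \<in> carrier P.F \<Longrightarrow> tup_of c l \<in> carrier P"
  using hom_carrier[OF tup_of_hom(1)[of l]] by auto

lemma tup_of_add:
  assumes "a \<in> carrier P.F" "b \<in> carrier P.F"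
  shows "tup_of (a + b) l = tup_of a l \<oplus>\<^bsub>P\<^esub> tup_of b l"
  using hom_mult[OF tup_of_hom(1)[of l] assms] by simp

lemma tup_of_diff:
  assumes "a \<in> carrier P.F" "b \<in> carrier P.F"
  shows "tup_of (a - b) l = tup_of a l \<ominus>\<^bsub>P\<^esub> tup_of b l"
proof -
  have ab: "a - b \<in> carrier P.F" by (rule free_Abelian_group_diff[OF assms])
  have "tup_of a l = tup_of (a - b) l \<oplus>\<^bsub>P\<^esub> tup_of b l"
    using tup_of_add[OF ab assms(2), of l] by simp
  then show ?thesis
    using tup_of_closed[OF ab, of l] tup_of_closed[OF assms(2), of l]
    by (simp add: a_minus_def P.M.M.a_assoc P.M.M.r_neg)
qed

lemma tup_of_zero: "tup_of 0 l = \<zero>\<^bsub>P\<^esub>"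
proof -
  have 0: "0 \<in> carrier P.F" by simp
  have "tup_of (0 - 0) l = tup_of 0 l \<ominus>\<^bsub>P\<^esub> tup_of 0 l" by (rule tup_of_diff[OF 0 0])
  then show ?thesis using tup_of_closed[OF 0, of l] by (simp add: a_minus_def P.M.M.r_neg)
qed

lemma tup_of_tup:
  assumes "c \<in> carrier P.F" shows "tup_of c \<in> tup P q"
proof -
  have "tup_of c l = \<zero>\<^bsub>P\<^esub>" if l: "q \<le> l" for l
    using assms[unfolded carrier_free_Abelian_group_iff]
  proof (induction c rule: free_Abelian_group_induct[consumes 1, case_names 1 2 3])
    case 1
    then show ?case by (rule tup_of_zero)
  next
    case (2 a b)
    then show ?case using tup_of_diff[of a b l] by (simp add: a_minus_def P.M.M.r_neg)
  next
    case (3 z)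
    then show ?case
      using tup_of_hom(2)[of "fst z" "snd z" l] coords(1)[of "snd z"] l by (auto simp: tup_def)
  qed
  then show ?thesis using tup_of_closed[OF assms] by (simp add: tup_def)
qed

lemma ker_aug_tup: "ker_aug \<subseteq> tup R q"
  by (auto simp: ker_aug_def)

text \<open>\<open>coords\<close> is a chosen section of \<open>aug\<close> and need be neither
  additive nor linear, but its defects lie in \<open>ker_aug\<close> by \<open>ker_augI\<close>.
  Additivity in the first factor gives 0 exactly; the other two kinds of relations give a defect
  times an element of \<open>P\<close>.\<close>

lemma tup_of_rels: "c \<in> P.T \<Longrightarrow> tup_of c \<in> dot_span P ker_aug"
proof (induction rule: P.T_induct)
  case zero
  have "tup_of 0 = (\<lambda>_. \<zero>\<^bsub>P\<^esub>)" using tup_of_zero by blast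
  then show ?case by (simp add: dot_span.zero)
next
  case (diff a b)
  have "tup_of (a - b) = (\<lambda>l. tup_of a l \<ominus>\<^bsub>P\<^esub> tup_of b l)"
    using tup_of_diff P.T_closed diff(1,2) by blast
  then show ?case using P.M.dot_span_diff[OF diff(3,4) ker_aug_tup] by simp
next
  case (gen a)
  have fF: "frag_of (x, y) \<in> carrier P.F" if "x \<in> carrier P" "y \<in> carrier M" for x y
    using that by simp
  from gen show ?case
  proof (rule tensor_gens_cases)
    fix x x' y assume a: "x \<in> carrier P" "x' \<in> carrier P" "y \<in> carrier M"
    have "tup_of (frag_of (x \<oplus>\<^bsub>P\<^esub> x', y) - frag_of (x, y) - frag_of (x', y)) = (\<lambda>_. \<zero>\<^bsub>P\<^esub>)"
    proof
      fix l
      have c: "coords y l \<in> carrier R" using tupE[OF coords(1)[OF a(3)]] .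
      have "tup_of (frag_of (x \<oplus>\<^bsub>P\<^esub> x', y) - frag_of (x, y) - frag_of (x', y)) l =
          coords y l \<odot>\<^bsub>P\<^esub> (x \<oplus>\<^bsub>P\<^esub> x') \<ominus>\<^bsub>P\<^esub> coords y l \<odot>\<^bsub>P\<^esub> x \<ominus>\<^bsub>P\<^esub> coords y l \<odot>\<^bsub>P\<^esub> x'"
        using a fF free_Abelian_group_diff[OF fF fF]
        by (simp add: tup_of_diff tup_of_hom(2) del: carrier_free_Abelian_group_iff)
      also have "\<dots> = \<zero>\<^bsub>P\<^esub>"
        using a c by (simp add: P.M.smult_r_distr a_minus_def P.M.M.a_ac P.M.M.r_neg P.M.M.r_neg1 P.M.M.r_neg2)
      finally show "tup_of (frag_of (x \<oplus>\<^bsub>P\<^esub> x', y) - frag_of (x, y) - frag_of (x', y)) l = \<zero>\<^bsub>P\<^esub>" .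
    qed
    then show "tup_of (frag_of (x \<oplus>\<^bsub>P\<^esub> x', y) - frag_of (x, y) - frag_of (x', y)) \<in> dot_span P ker_aug"
      by (simp add: dot_span.zero)
  next
    fix x y y' assume a: "x \<in> carrier P" "y \<in> carrier M" "y' \<in> carrier M"
    let ?s = "\<lambda>l. coords y l \<oplus> coords y' l"
    note c = tupE[OF coords(1)[OF a(2)]] tupE[OF coords(1)[OF a(3)]]
      tupE[OF coords(1)[OF M.a_closed[OF a(2,3)]]]
    have s: "?s \<in> tup R q" using coords(1)[OF a(2)] coords(1)[OF a(3)] by simp
    have "(\<lambda>l. coords (y \<oplus>\<^bsub>M\<^esub> y') l \<ominus> ?s l) \<in> ker_aug"
      using coords a s by (intro ker_augI) (simp_all add: aug_add)
    from P.M.dot_span_single[OF this a(1) ker_aug_tup]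
    have "(\<lambda>l. (coords (y \<oplus>\<^bsub>M\<^esub> y') l \<ominus> ?s l) \<odot>\<^bsub>P\<^esub> x) \<in> dot_span P ker_aug" .
    moreover have "tup_of (frag_of (x, y \<oplus>\<^bsub>M\<^esub> y') - frag_of (x, y) - frag_of (x, y')) =
        (\<lambda>l. (coords (y \<oplus>\<^bsub>M\<^esub> y') l \<ominus> ?s l) \<odot>\<^bsub>P\<^esub> x)"
    proof
      fix l
      have "tup_of (frag_of (x, y \<oplus>\<^bsub>M\<^esub> y') - frag_of (x, y) - frag_of (x, y')) l =
          coords (y \<oplus>\<^bsub>M\<^esub> y') l \<odot>\<^bsub>P\<^esub> x \<ominus>\<^bsub>P\<^esub> coords y l \<odot>\<^bsub>P\<^esub> x \<ominus>\<^bsub>P\<^esub> coords y' l \<odot>\<^bsub>P\<^esub> x"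
        using a fF free_Abelian_group_diff[OF fF fF]
        by (simp add: tup_of_diff tup_of_hom(2) del: carrier_free_Abelian_group_iff)
      then show "tup_of (frag_of (x, y \<oplus>\<^bsub>M\<^esub> y') - frag_of (x, y) - frag_of (x, y')) l =
          (coords (y \<oplus>\<^bsub>M\<^esub> y') l \<ominus> ?s l) \<odot>\<^bsub>P\<^esub> x"
        using c a by (simp add: a_minus_def P.M.smult_l_distr P.M.smult_l_minus P.M.M.minus_add P.M.M.a_assoc)
    qed
    ultimately show "tup_of (frag_of (x, y \<oplus>\<^bsub>M\<^esub> y') - frag_of (x, y) - frag_of (x, y')) \<in> dot_span P ker_aug"
      by simp
  next
    fix r x y assume a: "r \<in> carrier R" "x \<in> carrier P" "y \<in> carrier M"
    let ?s = "\<lambda>l. r \<otimes> coords y l"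
    have s: "?s \<in> tup R q" using coords(1)[OF a(3)] a(1) by simp
    note c = tupE[OF coords(1)[OF a(3)]] tupE[OF coords(1)[OF M.smult_closed[OF a(1,3)]]]
    have "(\<lambda>l. ?s l \<ominus> coords (r \<odot>\<^bsub>M\<^esub> y) l) \<in> ker_aug"
      using coords a s by (intro ker_augI) (simp_all add: aug_smult)
    from P.M.dot_span_single[OF this a(2) ker_aug_tup]
    have "(\<lambda>l. (?s l \<ominus> coords (r \<odot>\<^bsub>M\<^esub> y) l) \<odot>\<^bsub>P\<^esub> x) \<in> dot_span P ker_aug" .
    moreover have "tup_of (frag_of (r \<odot>\<^bsub>P\<^esub> x, y) - frag_of (x, r \<odot>\<^bsub>M\<^esub> y)) =
        (\<lambda>l. (?s l \<ominus> coords (r \<odot>\<^bsub>M\<^esub> y) l) \<odot>\<^bsub>P\<^esub> x)"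
    proof
      fix l
      have "tup_of (frag_of (r \<odot>\<^bsub>P\<^esub> x, y) - frag_of (x, r \<odot>\<^bsub>M\<^esub> y)) l =
          coords y l \<odot>\<^bsub>P\<^esub> (r \<odot>\<^bsub>P\<^esub> x) \<ominus>\<^bsub>P\<^esub> coords (r \<odot>\<^bsub>M\<^esub> y) l \<odot>\<^bsub>P\<^esub> x"
        using a fF by (simp add: tup_of_diff tup_of_hom(2) del: carrier_free_Abelian_group_iff)
      then show "tup_of (frag_of (r \<odot>\<^bsub>P\<^esub> x, y) - frag_of (x, r \<odot>\<^bsub>M\<^esub> y)) l =
          (?s l \<ominus> coords (r \<odot>\<^bsub>M\<^esub> y) l) \<odot>\<^bsub>P\<^esub> x"
        using c a m_comm[OF a(1) c(1)[of l]]
        by (simp add: a_minus_def P.M.smult_l_distr P.M.smult_l_minus P.M.smult_assoc1[symmetric])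
    qed
    ultimately show "tup_of (frag_of (r \<odot>\<^bsub>P\<^esub> x, y) - frag_of (x, r \<odot>\<^bsub>M\<^esub> y)) \<in> dot_span P ker_aug"
      by simp
  qed
qed

lemma frag_of_tup_closed: "x \<in> tup P q \<Longrightarrow> frag_of_tup x \<in> carrier P.F"
  unfolding frag_of_tup_def
  by (rule sum_closed_free_Abelian_group) (use P.M.tupD g_closed in auto)

text \<open>Bilinearity moves the scalars \<open>r l\<close> from \<open>u\<close> to the generators
  \<open>g l\<close>, whose combination is \<open>aug r\<close>. In particular a vector of
  \<open>ker_aug\<close> yields u \<otimes> 0.\<close>

lemma frag_of_tup_scalar:
  assumes r: "r \<in> tup R q" and u: "u \<in> carrier P"
  shows "frag_of_tup (\<lambda>l. r l \<odot>\<^bsub>P\<^esub> u) - frag_of (u, aug r) \<in> P.T"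
proof -
  have rc: "r l \<in> carrier R" for l by (rule tupE[OF r])
  have "(\<Sum>l<n. frag_of (r l \<odot>\<^bsub>P\<^esub> u, g l)) - frag_of (u, \<Oplus>\<^bsub>M\<^esub>l\<in>{..<n}. r l \<odot>\<^bsub>M\<^esub> g l) \<in> P.T" if "n \<le> q" for n
    using that
  proof (induction n)
    case 0
    have "(\<Oplus>\<^bsub>M\<^esub>l\<in>{..<0::nat}. r l \<odot>\<^bsub>M\<^esub> g l) = \<zero>\<^bsub>M\<^esub>" by simp
    then show ?case using P.T_minus[OF P.T_zero_right[OF u]] by simp
  next
    case (Suc n)
    define s where "s = (\<Oplus>\<^bsub>M\<^esub>l\<in>{..<n}. r l \<odot>\<^bsub>M\<^esub> g l)"
    have gc: "g l \<in> carrier M" if "l \<le> n" for l using g_closed Suc.prems that by simp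
    have s: "s \<in> carrier M" unfolding s_def using gc rc by (intro M.M.finsum_closed) auto
    have sum: "(\<Oplus>\<^bsub>M\<^esub>l\<in>{..<Suc n}. r l \<odot>\<^bsub>M\<^esub> g l) = r n \<odot>\<^bsub>M\<^esub> g n \<oplus>\<^bsub>M\<^esub> s"
      unfolding s_def lessThan_Suc using gc rc by (intro M.M.finsum_insert) auto
    have rg: "r n \<odot>\<^bsub>M\<^esub> g n \<in> carrier M" using gc rc by simp
    \<comment> \<open>The induction hypothesis plus a scalar relation minus an additivity relation;
      all inner terms cancel and the claim for n + 1 terms is left.\<close>
    have "((\<Sum>l<n. frag_of (r l \<odot>\<^bsub>P\<^esub> u, g l)) - frag_of (u, s)) +
        (frag_of (r n \<odot>\<^bsub>P\<^esub> u, g n) - frag_of (u, r n \<odot>\<^bsub>M\<^esub> g n)) -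
        (frag_of (u, r n \<odot>\<^bsub>M\<^esub> g n \<oplus>\<^bsub>M\<^esub> s) - frag_of (u, r n \<odot>\<^bsub>M\<^esub> g n) - frag_of (u, s)) \<in> P.T"
      using Suc by (intro P.T_diff[OF P.T_add[OF _ P.T_smult[OF rc u gc]] P.T_add_right[OF u rg s]])
        (simp_all add: s_def)
    then show ?case by (simp add: sum algebra_simps)
  qed
  from this[of q] show ?thesis by (simp add: frag_of_tup_def aug_def)
qed

lemma frag_of_tup_add:
  assumes "x \<in> tup P q" "y \<in> tup P q"
  shows "frag_of_tup (\<lambda>l. x l \<oplus>\<^bsub>P\<^esub> y l) - frag_of_tup x - frag_of_tup y \<in> P.T"
proof -
  have "(\<Sum>l<q. frag_of (x l \<oplus>\<^bsub>P\<^esub> y l, g l) - frag_of (x l, g l) - frag_of (y l, g l)) \<in> P.T"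
    using P.M.tupD[OF assms(1)] P.M.tupD[OF assms(2)] g_closed
    by (intro P.T_sum P.T_add_left) auto
  then show ?thesis by (simp add: frag_of_tup_def sum_subtractf)
qed

lemma frag_of_tup_diff:
  assumes x: "x \<in> tup P q" and y: "y \<in> tup P q"
  shows "frag_of_tup (\<lambda>l. x l \<ominus>\<^bsub>P\<^esub> y l) - (frag_of_tup x - frag_of_tup y) \<in> P.T"
proof -
  have "(\<lambda>l. (x l \<ominus>\<^bsub>P\<^esub> y l) \<oplus>\<^bsub>P\<^esub> y l) = x"
    using P.M.tupD[OF x] P.M.tupD[OF y] by (simp add: a_minus_def P.M.M.a_assoc P.M.M.l_neg)
  then have "- (frag_of_tup x - frag_of_tup (\<lambda>l. x l \<ominus>\<^bsub>P\<^esub> y l) - frag_of_tup y) \<in> P.T"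
    using P.T_minus[OF frag_of_tup_add[OF P.M.tup_diff[OF x y] y]] by simp
  then show ?thesis by (simp add: algebra_simps)
qed

lemma frag_of_dot_span: "v \<in> dot_span P ker_aug \<Longrightarrow> frag_of_tup v \<in> P.T"
proof (induction rule: dot_span.induct)
  case zero
  then show ?case unfolding frag_of_tup_def using g_closed by (intro P.T_sum P.T_zero_left) auto
next
  case (step \<kappa> u v)
  have \<kappa>: "\<kappa> \<in> tup R q" "aug \<kappa> = \<zero>\<^bsub>M\<^esub>" using step(1) by (auto simp: ker_aug_def)
  have v: "v \<in> tup P q" by (rule P.M.dot_span_tup[OF step(3) ker_aug_tup])
  have "(frag_of_tup (\<lambda>l. \<kappa> l \<odot>\<^bsub>P\<^esub> u \<oplus>\<^bsub>P\<^esub> v l) - frag_of_tup (\<lambda>l. \<kappa> l \<odot>\<^bsub>P\<^esub> u) - frag_of_tup v) +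
      (frag_of_tup (\<lambda>l. \<kappa> l \<odot>\<^bsub>P\<^esub> u) - frag_of (u, \<zero>\<^bsub>M\<^esub>)) + frag_of (u, \<zero>\<^bsub>M\<^esub>) + frag_of_tup v \<in> P.T"
    using P.T_add[OF P.T_add[OF P.T_add[OF frag_of_tup_add[OF P.M.tup_smult[OF \<kappa>(1) step(2)] v]
        frag_of_tup_scalar[OF \<kappa>(1) step(2), unfolded \<kappa>(2)]] P.T_zero_right[OF step(2)]] step(4)] .
  then show ?case by simp
qed

lemma frag_of_tup_of: "c \<in> carrier P.F \<Longrightarrow> frag_of_tup (tup_of c) - c \<in> P.T"
  unfolding carrier_free_Abelian_group_iff
proof (induction c rule: free_Abelian_group_induct[consumes 1, case_names 1 2 3])
  case 1
  have "tup_of 0 = (\<lambda>_. \<zero>\<^bsub>P\<^esub>)" using tup_of_zero by blast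
  then show ?case using frag_of_dot_span[OF dot_span.zero] by simp
next
  case (2 a b)
  have ab: "a \<in> carrier P.F" "b \<in> carrier P.F" using 2 by simp_all
  have "tup_of (a - b) = (\<lambda>l. tup_of a l \<ominus>\<^bsub>P\<^esub> tup_of b l)" using tup_of_diff[OF ab] by blast
  then have "(frag_of_tup (tup_of (a - b)) - (frag_of_tup (tup_of a) - frag_of_tup (tup_of b))) +
      ((frag_of_tup (tup_of a) - a) - (frag_of_tup (tup_of b) - b)) \<in> P.T"
    using P.T_add[OF frag_of_tup_diff[OF tup_of_tup[OF ab(1)] tup_of_tup[OF ab(2)]] P.T_diff[OF 2(3,4)]]
    by simp
  then show ?case by (simp add: algebra_simps)
next
  case (3 z)
  then obtain x y where z: "z = (x, y)" "x \<in> carrier P" "y \<in> carrier M" by auto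
  have "tup_of (frag_of z) = (\<lambda>l. coords y l \<odot>\<^bsub>P\<^esub> x)" using tup_of_hom(2)[OF z(2,3)] z(1) by blast
  then show ?case using frag_of_tup_scalar[OF coords(1)[OF z(3)] z(2)] coords(2)[OF z(3)] z(1) by simp
qed

text \<open>The round trip replaces the n-th unit vector by \<open>coords (g n)\<close>. Both are
  mapped to \<open>g n\<close> by \<open>aug\<close>, so they differ by an element of
  \<open>ker_aug\<close>. The induction compares partial sums with \<open>x\<close> cut off after
  \<open>n\<close> entries.\<close>

lemma tup_of_frag_of:
  assumes x: "x \<in> tup P q"
  shows "(\<lambda>l. tup_of (frag_of_tup x) l \<ominus>\<^bsub>P\<^esub> x l) \<in> dot_span P ker_aug"
proof -
  have xc: "x l \<in> carrier P" for l by (rule P.M.tupD[OF x])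
  have "(\<lambda>l. tup_of (\<Sum>i<n. frag_of (x i, g i)) l \<ominus>\<^bsub>P\<^esub> (if l < n then x l else \<zero>\<^bsub>P\<^esub>)) \<in> dot_span P ker_aug"
    if "n \<le> q" for n
    using that
  proof (induction n)
    case 0
    then show ?case by (simp add: tup_of_zero a_minus_def dot_span.zero P.M.neg_zero)
  next
    case (Suc n)
    have gn: "g n \<in> carrier M" using g_closed Suc.prems by simp
    have c: "coords (g n) \<in> tup R q" by (rule coords(1)[OF gn])
    define \<delta> where "\<delta> = (\<lambda>l. if l = n then \<one> else \<zero>)"
    have \<delta>: "\<delta> \<in> tup R q" using Suc.prems by (auto simp: \<delta>_def tup_def)
    have "aug \<delta> = (\<Oplus>\<^bsub>M\<^esub>l\<in>{..<q}. if n = l then g l else \<zero>\<^bsub>M\<^esub>)"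
      unfolding aug_def using g_closed by (intro M.M.finsum_cong') (auto simp: \<delta>_def)
    also have "\<dots> = g n" using g_closed Suc.prems by (intro M.M.finsum_singleton) auto
    finally have "(\<lambda>l. coords (g n) l \<ominus> \<delta> l) \<in> ker_aug"
      using coords(2)[OF gn] by (intro ker_augI c \<delta>) simp
    from dot_span.step[OF this xc[of n] Suc.IH]
    have step: "(\<lambda>l. (coords (g n) l \<ominus> \<delta> l) \<odot>\<^bsub>P\<^esub> x n \<oplus>\<^bsub>P\<^esub>
        (tup_of (\<Sum>i<n. frag_of (x i, g i)) l \<ominus>\<^bsub>P\<^esub> (if l < n then x l else \<zero>\<^bsub>P\<^esub>))) \<in> dot_span P ker_aug"
      using Suc.prems by simp
    have "(coords (g n) l \<ominus> \<delta> l) \<odot>\<^bsub>P\<^esub> x n \<oplus>\<^bsub>P\<^esub>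
        (tup_of (\<Sum>i<n. frag_of (x i, g i)) l \<ominus>\<^bsub>P\<^esub> (if l < n then x l else \<zero>\<^bsub>P\<^esub>)) =
        tup_of (\<Sum>i<Suc n. frag_of (x i, g i)) l \<ominus>\<^bsub>P\<^esub> (if l < Suc n then x l else \<zero>\<^bsub>P\<^esub>)" for l
    proof -
      have F: "(\<Sum>i<n. frag_of (x i, g i)) \<in> carrier P.F" "frag_of (x n, g n) \<in> carrier P.F"
        using sum_closed_free_Abelian_group[of "{..<n}" "\<lambda>i. frag_of (x i, g i)"] xc g_closed Suc.prems
        by simp_all
      define t where "t = tup_of (\<Sum>i<n. frag_of (x i, g i)) l"
      have t: "t \<in> carrier P" unfolding t_def by (rule tup_of_closed[OF F(1)])
      have cl: "coords (g n) l \<in> carrier R" by (rule tupE[OF c])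
      have "tup_of (\<Sum>i<Suc n. frag_of (x i, g i)) l = t \<oplus>\<^bsub>P\<^esub> coords (g n) l \<odot>\<^bsub>P\<^esub> x n"
        using tup_of_add[OF F, of l] tup_of_hom(2)[OF xc gn] by (simp add: t_def)
      moreover have C: "coords (g n) l \<odot>\<^bsub>P\<^esub> x n \<in> carrier P" using cl xc by simp
      have n0: "\<ominus> \<zero> = \<zero>" using r_neg[of \<zero>] by simp
      define w where "w = (if l < n then x l else \<zero>\<^bsub>P\<^esub>)"
      have w: "w \<in> carrier P" using xc by (simp add: w_def)
      have "(coords (g n) l \<ominus> \<delta> l) \<odot>\<^bsub>P\<^esub> x n \<oplus>\<^bsub>P\<^esub> (t \<ominus>\<^bsub>P\<^esub> w) =
          (t \<oplus>\<^bsub>P\<^esub> coords (g n) l \<odot>\<^bsub>P\<^esub> x n) \<ominus>\<^bsub>P\<^esub> (if l < Suc n then x l else \<zero>\<^bsub>P\<^esub>)"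
      proof (cases "l = n")
        case True
        have "(coords (g n) l \<ominus> \<delta> l) \<odot>\<^bsub>P\<^esub> x n = coords (g n) l \<odot>\<^bsub>P\<^esub> x n \<oplus>\<^bsub>P\<^esub> \<ominus>\<^bsub>P\<^esub> x n"
          using True cl xc[of n] by (simp add: \<delta>_def a_minus_def P.M.smult_l_distr P.M.smult_l_minus)
        moreover have "t \<ominus>\<^bsub>P\<^esub> w = t" using True t by (simp add: w_def a_minus_def P.M.neg_zero)
        ultimately show ?thesis
          using True t C xc[of n] P.M.M.a_comm[OF _ t, of "coords (g n) l \<odot>\<^bsub>P\<^esub> x n \<oplus>\<^bsub>P\<^esub> \<ominus>\<^bsub>P\<^esub> x n"]
          by (simp add: a_minus_def P.M.M.a_assoc)
      next
        case False
        have "(coords (g n) l \<ominus> \<delta> l) \<odot>\<^bsub>P\<^esub> x n = coords (g n) l \<odot>\<^bsub>P\<^esub> x n"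
          using False cl n0 by (simp add: \<delta>_def a_minus_def)
        moreover have "(if l < Suc n then x l else \<zero>\<^bsub>P\<^esub>) = w" using False by (simp add: w_def less_Suc_eq)
        ultimately show ?thesis
          using t C w P.M.M.a_comm[OF C t] by (simp add: a_minus_def P.M.M.a_assoc[symmetric])
      qed
      ultimately show ?thesis unfolding t_def[symmetric] w_def[symmetric] by simp
    qed
    with step show ?case by simp
  qed
  from this[of q] have "(\<lambda>l. tup_of (frag_of_tup x) l \<ominus>\<^bsub>P\<^esub> (if l < q then x l else \<zero>\<^bsub>P\<^esub>)) \<in> dot_span P ker_aug"
    by (simp add: frag_of_tup_def)
  moreover have "(if l < q then x l else \<zero>\<^bsub>P\<^esub>) = x l" for l using x by (auto simp: tup_def)
  ultimately show ?thesis by simp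
qed

end

text \<open>The coordinates depend only on the second tensor factor, which \<open>f\<close> leaves
  alone; hence naturality holds exactly and not just modulo relations.\<close>

lemma (in minimal_resolution) tup_of_frag_map:
  assumes P: "module R P" and P': "module R P'" and f: "f \<in> mod_hom R P P'"
    and c: "c \<in> carrier (tensor_frags P M)"
  shows "tensor_coords.tup_of R M g q P' (frag_map f c) l = f (tensor_coords.tup_of R M g q P c l)"
proof -
  interpret C: tensor_coords R M g q P
    by (intro tensor_coords.intro tensor_pair.intro minimal_resolution_axioms P M.module_axioms)
  interpret C': tensor_coords R M g q P'
    by (intro tensor_coords.intro tensor_pair.intro minimal_resolution_axioms P' M.module_axioms)
  interpret f: two_modules R P P' f
    by (intro two_modules.intro two_modules_axioms.intro P P' f)
  show ?thesis
    using c[unfolded carrier_free_Abelian_group_iff]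
  proof (induction c rule: free_Abelian_group_induct[consumes 1, case_names zero diff of])
    case zero
    then show ?case by (simp add: C.tup_of_zero C'.tup_of_zero)
  next
    case (diff a b)
    have ab: "a \<in> carrier (tensor_frags P M)" "b \<in> carrier (tensor_frags P M)" using diff by simp_all
    have "tensor_coords.tup_of R M g q P' (frag_map f (a - b)) l =
        C'.tup_of (frag_map f a) l \<ominus>\<^bsub>P'\<^esub> C'.tup_of (frag_map f b) l"
      using C'.tup_of_diff[OF frag_map_closed[OF f.f_closed ab(1)] frag_map_closed[OF f.f_closed ab(2)]]
      by (simp add: frag_extend_diff)
    then show ?case
      using diff(3,4) C.tup_of_diff[OF ab] f.f_diff C.tup_of_closed[OF ab(1)] C.tup_of_closed[OF ab(2)] by simp
  next
    case (of z)
    then obtain x y where z: "z = (x, y)" "x \<in> carrier P" "y \<in> carrier M" by auto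
    show ?case
      using tupE[OF coords(1)[OF z(3)]] C.tup_of_hom(2)[OF z(2,3)] C'.tup_of_hom(2)[OF f.f_closed[OF z(2)] z(3)] z
      by (simp add: f.f_smult)
  qed
qed

text \<open>\<open>tup_of\<close> and \<open>frag_of_tup\<close> are inverse up to relations and
  commute with the differentials, so cycles and boundaries correspond. The resolution belongs to M',
  while the \<open>M\<close> of this context is the second argument of Tor, presented as R^q modulo
  \<open>ker_aug\<close>.\<close>

lemma (in minimal_resolution) trivial_tensor_homology_iff_tor_vanishes:
  fixes P :: "nat \<Rightarrow> ('r, 'p) module"
  assumes res: "coord_resolution R M' P d e"
  shows "trivial_group (tensor_homology R P d M (Suc n)) \<longleftrightarrow>
    coord_resolution.tor_vanishes R P d n q ker_aug"
proof -
  interpret C: coord_resolution R M' P d e by (rule res)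
  have Pm: "module R (P n)" for n by (rule coord_module_module[OF C.coord])
  have tc: "tensor_coords R M g q (P n)" for n
    by (intro tensor_coords.intro tensor_pair.intro minimal_resolution_axioms Pm M.module_axioms)
  interpret c0: tensor_coords R M g q "P n" by (rule tc)
  interpret c1: tensor_coords R M g q "P (Suc n)" by (rule tc)
  interpret c2: tensor_coords R M g q "P (Suc (Suc n))" by (rule tc)
  interpret f: two_modules R "P (Suc (Suc n))" "P (Suc n)" "d (Suc n)"
    by (intro two_modules.intro two_modules_axioms.intro Pm C.d_hom)
  interpret h: two_modules R "P (Suc n)" "P n" "d n"
    by (intro two_modules.intro two_modules_axioms.intro Pm C.d_hom)
  let ?F0 = "tensor_frags (P n) M" and ?F1 = "tensor_frags (P (Suc n)) M"
    and ?F2 = "tensor_frags (P (Suc (Suc n))) M"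
  let ?T0 = "tensor_rels R (P n) M" and ?T1 = "tensor_rels R (P (Suc n)) M"
  have dd: "d n (d (Suc n) x) = \<zero>\<^bsub>P n\<^esub>" if "x \<in> carrier (P (Suc (Suc n)))" for n x
    using C.exact_Suc[of n] that by auto
  have h_tup: "c0.tup_of (frag_map (d n) c) = (\<lambda>l. d n (c1.tup_of c l))" if "c \<in> carrier ?F1" for c
    using tup_of_frag_map[OF Pm Pm C.d_hom that] by blast
  have f_tup: "c1.tup_of (frag_map (d (Suc n)) c) = (\<lambda>l. d (Suc n) (c2.tup_of c l))" if "c \<in> carrier ?F2" for c
    using tup_of_frag_map[OF Pm Pm C.d_hom that] by blast
  have h_frag: "frag_map (d n) (c1.frag_of_tup x) = c0.frag_of_tup (\<lambda>l. d n (x l))" for x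
    by (simp add: c1.frag_of_tup_def c0.frag_of_tup_def frag_extend_sum o_def)
  have f_frag: "frag_map (d (Suc n)) (c2.frag_of_tup x) = c1.frag_of_tup (\<lambda>l. d (Suc n) (x l))" for x
    by (simp add: c1.frag_of_tup_def c2.frag_of_tup_def frag_extend_sum o_def)
  have f_closed: "frag_map (d (Suc n)) c \<in> carrier ?F1" if "c \<in> carrier ?F2" for c
    by (rule frag_map_closed[OF f.f_closed that])
  have iff: "trivial_group (tensor_homology R P d M (Suc n)) \<longleftrightarrow>
      (\<forall>c\<in>carrier ?F1. frag_map (d n) c \<in> ?T0 \<longrightarrow> (\<exists>u\<in>carrier ?F2. c - frag_map (d (Suc n)) u \<in> ?T1))"
    by (rule trivial_tensor_homology_iff) (rule Pm M.module_axioms C.d_hom dd; assumption?)+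
  show ?thesis
    unfolding iff C.tor_vanishes_def tensor_exact_def
  proof (intro iffI ballI impI)
    fix x
    assume ex: "\<forall>c\<in>carrier ?F1. frag_map (d n) c \<in> ?T0 \<longrightarrow> (\<exists>u\<in>carrier ?F2. c - frag_map (d (Suc n)) u \<in> ?T1)"
      and x: "x \<in> tup (P (Suc n)) q" and dx: "(\<lambda>l. d n (x l)) \<in> dot_span (P n) ker_aug"
    let ?c = "c1.frag_of_tup x"
    have c: "?c \<in> carrier ?F1" by (rule c1.frag_of_tup_closed[OF x])
    have "frag_map (d n) ?c \<in> ?T0" unfolding h_frag by (rule c0.frag_of_dot_span[OF dx])
    with ex c obtain u where u: "u \<in> carrier ?F2" and cu: "?c - frag_map (d (Suc n)) u \<in> ?T1" by blast
    have "c1.tup_of (?c - frag_map (d (Suc n)) u) = (\<lambda>l. c1.tup_of ?c l \<ominus>\<^bsub>P (Suc n)\<^esub> d (Suc n) (c2.tup_of u l))"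
      using c1.tup_of_diff[OF c f_closed[OF u]] f_tup[OF u] by auto
    with c1.tup_of_rels[OF cu]
    have 1: "(\<lambda>l. c1.tup_of ?c l \<ominus>\<^bsub>P (Suc n)\<^esub> d (Suc n) (c2.tup_of u l)) \<in> dot_span (P (Suc n)) ker_aug" by simp
    have 2: "(\<lambda>l. c1.tup_of ?c l \<ominus>\<^bsub>P (Suc n)\<^esub> x l) \<in> dot_span (P (Suc n)) ker_aug"
      by (rule c1.tup_of_frag_of[OF x])
    \<comment> \<open>The error of the boundary condition minus the error of the round trip of
      \<open>x\<close>; the coordinates of the fragment cancel and \<open>x\<close> minus the
      boundary remains.\<close>
    define w where "w = (\<lambda>l. (c1.tup_of ?c l \<ominus>\<^bsub>P (Suc n)\<^esub> d (Suc n) (c2.tup_of u l)) \<ominus>\<^bsub>P (Suc n)\<^esub>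
        (c1.tup_of ?c l \<ominus>\<^bsub>P (Suc n)\<^esub> x l))"
    have w: "w \<in> dot_span (P (Suc n)) ker_aug"
      unfolding w_def by (rule c1.P.M.dot_span_diff[OF 1 2 c1.ker_aug_tup])
    have "x = (\<lambda>l. d (Suc n) (c2.tup_of u l) \<oplus>\<^bsub>P (Suc n)\<^esub> w l)"
    proof
      fix l
      have "x l \<in> carrier (P (Suc n))" "c1.tup_of ?c l \<in> carrier (P (Suc n))"
        "d (Suc n) (c2.tup_of u l) \<in> carrier (P (Suc n))"
        using c1.P.M.tupD[OF x] c1.tup_of_closed[OF c] f.f_closed[OF c2.tup_of_closed[OF u]] by auto
      then show "x l = d (Suc n) (c2.tup_of u l) \<oplus>\<^bsub>P (Suc n)\<^esub> w l"
        by (simp add: w_def a_minus_def c1.P.M.M.minus_add c1.P.M.M.a_ac c1.P.M.M.r_neg c1.P.M.M.r_neg1 c1.P.M.M.r_neg2)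
    qed
    then show "\<exists>u\<in>tup (P (Suc (Suc n))) q. \<exists>w\<in>dot_span (P (Suc n)) ker_aug.
        x = (\<lambda>l. d (Suc n) (u l) \<oplus>\<^bsub>P (Suc n)\<^esub> w l)"
      by (intro bexI[OF _ c2.tup_of_tup[OF u]] bexI[OF _ w])
  next
    fix c
    assume ex: "\<forall>x\<in>tup (P (Suc n)) q. (\<lambda>l. d n (x l)) \<in> dot_span (P n) ker_aug \<longrightarrow>
        (\<exists>u\<in>tup (P (Suc (Suc n))) q. \<exists>w\<in>dot_span (P (Suc n)) ker_aug. x = (\<lambda>l. d (Suc n) (u l) \<oplus>\<^bsub>P (Suc n)\<^esub> w l))"
      and c: "c \<in> carrier ?F1" and dc: "frag_map (d n) c \<in> ?T0"
    have "(\<lambda>l. d n (c1.tup_of c l)) \<in> dot_span (P n) ker_aug"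
      using c0.tup_of_rels[OF dc] h_tup[OF c] by simp
    with ex c1.tup_of_tup[OF c] obtain u w where u: "u \<in> tup (P (Suc (Suc n))) q"
      and w: "w \<in> dot_span (P (Suc n)) ker_aug"
      and eq: "c1.tup_of c = (\<lambda>l. d (Suc n) (u l) \<oplus>\<^bsub>P (Suc n)\<^esub> w l)" by blast
    let ?u = "c2.frag_of_tup u"
    have U: "?u \<in> carrier ?F2" by (rule c2.frag_of_tup_closed[OF u])
    have "(c1.frag_of_tup (c1.tup_of c) - c1.frag_of_tup (\<lambda>l. d (Suc n) (u l)) - c1.frag_of_tup w) +
        c1.frag_of_tup w - (c1.frag_of_tup (c1.tup_of c) - c) \<in> ?T1"
      using c1.P.T_diff[OF c1.P.T_add[OF c1.frag_of_tup_add[OF f.f_tup[OF u] c1.P.M.dot_span_tup[OF w c1.ker_aug_tup]]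
        c1.frag_of_dot_span[OF w]] c1.frag_of_tup_of[OF c]] by (simp add: eq)
    then have "c - frag_map (d (Suc n)) ?u \<in> ?T1" by (simp add: f_frag)
    then show "\<exists>u\<in>carrier ?F2. c - frag_map (d (Suc n)) u \<in> ?T1" using U by blast
  qed
qed

section \<open>Local rings with a residue field\<close>

locale residue_map = cring S + noetherian_ring S + k: field k
  for S :: "('s, 'x) ring_scheme" (structure) and k :: "('k, 'y) ring_scheme" +
  fixes \<pi>
  assumes pi_hom: "\<pi> \<in> ring_hom S k" and pi_surj: "\<pi> ` carrier S = carrier k"
    and unique_maximal: "\<exists>!I. maximalideal I S"
begin

lemma pi_simps [simp]:
  "x \<in> carrier S \<Longrightarrow> \<pi> x \<in> carrier k"
  "x \<in> carrier S \<Longrightarrow> y \<in> carrier S \<Longrightarrow> \<pi> (x \<otimes> y) = \<pi> x \<otimes>\<^bsub>k\<^esub> \<pi> y"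
  "x \<in> carrier S \<Longrightarrow> y \<in> carrier S \<Longrightarrow> \<pi> (x \<oplus> y) = \<pi> x \<oplus>\<^bsub>k\<^esub> \<pi> y"
  "\<pi> \<one> = \<one>\<^bsub>k\<^esub>"
  using pi_hom by (auto simp: ring_hom_def)

lemma pi_zero [simp]: "\<pi> \<zero> = \<zero>\<^bsub>k\<^esub>"
  using pi_simps(3)[of \<zero> \<zero>] pi_simps(1)[of \<zero>] k.add.r_cancel_one'[of "\<pi> \<zero>" "\<pi> \<zero>"] by simp

lemma pi_minus [simp]: "x \<in> carrier S \<Longrightarrow> \<pi> (\<ominus> x) = \<ominus>\<^bsub>k\<^esub> \<pi> x"
  using pi_simps(3)[of "\<ominus> x" x] by (simp add: l_neg k.minus_equality)

definition ker where "ker = {x \<in> carrier S. \<pi> x = \<zero>\<^bsub>k\<^esub>}"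

lemma ideal_ker: "ideal ker S"
  by (rule cring_idealI) (auto simp: ker_def)

lemma ideal_meets_ker_complement:
  assumes "ideal I S" "x \<in> I" "x \<in> carrier S" "\<pi> x \<noteq> \<zero>\<^bsub>k\<^esub>" "ker \<subseteq> I" shows "I = carrier S"
proof -
  interpret ideal I S by fact
  have "\<pi> x \<in> Units k" using assms(3,4) k.field_Units by simp
  then obtain y where y: "y \<in> carrier S" "\<pi> y = inv\<^bsub>k\<^esub> (\<pi> x)"
    using pi_surj k.Units_inv_closed by (metis imageE)
  have "\<pi> (\<one> \<ominus> y \<otimes> x) = \<zero>\<^bsub>k\<^esub>"
    using y assms(3) \<open>\<pi> x \<in> Units k\<close> by (simp add: a_minus_def k.r_neg)
  then have "\<one> \<ominus> y \<otimes> x \<in> I" using assms(3,5) y by (auto simp: ker_def)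
  then have "(\<one> \<ominus> y \<otimes> x) \<oplus> y \<otimes> x \<in> I" using I_l_closed[OF assms(2) y(1)] by simp
  then have "\<one> \<in> I" using y(1) assms(3) by (simp add: a_minus_def a_assoc l_neg)
  then show ?thesis by (rule one_imp_carrier)
qed

lemma maximal_ker: "maximalideal ker S"
proof (rule maximalidealI[OF ideal_ker])
  show "carrier S \<noteq> ker"
  proof
    assume "carrier S = ker"
    then have "\<one> \<in> ker" using one_closed by blast
    then show False by (simp add: ker_def)
  qed
  fix I assume I: "ideal I S" "ker \<subseteq> I" "I \<subseteq> carrier S"
  show "I = ker \<or> I = carrier S"
    using ideal_meets_ker_complement[OF I(1) _ _ _ I(2)] I(2,3) by (auto simp: ker_def)
qed

text \<open>Zorn's lemma yields an ideal above \<open>I\<close> that is maximal without containing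
  1, and uniqueness of the maximal ideal identifies it with \<open>ker\<close>. In a Noetherian ring
  a nonempty chain of ideals contains its union.\<close>

lemma proper_ideal_subset_ker:
  assumes I: "ideal I S" "\<one> \<notin> I" shows "I \<subseteq> ker"
proof -
  define A where "A = {K. ideal K S \<and> I \<subseteq> K \<and> \<one> \<notin> K}"
  have "\<exists>K\<in>A. \<forall>L\<in>A. K \<subseteq> L \<longrightarrow> L = K"
  proof (rule subset_Zorn_nonempty)
    show "A \<noteq> {}" using I by (auto simp: A_def)
    fix C assume C: "C \<noteq> {}" "subset.chain A C"
    then have "subset.chain {I. ideal I S} C" by (auto simp: A_def subset.chain_def)
    from ideal_chain_is_trivial[OF C(1) this] C(2) show "\<Union>C \<in> A" by (auto simp: subset.chain_def)
  qed
  then obtain K where K: "ideal K S" "I \<subseteq> K" "\<one> \<notin> K" and max: "\<And>L. L \<in> A \<Longrightarrow> K \<subseteq> L \<Longrightarrow> L = K"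
    by (auto simp: A_def)
  have "maximalideal K S"
  proof (rule maximalidealI[OF K(1)])
    show "carrier S \<noteq> K" using K(3) by auto
    fix L assume L: "ideal L S" "K \<subseteq> L" "L \<subseteq> carrier S"
    show "L = K \<or> L = carrier S"
    proof (cases "\<one> \<in> L")
      case True
      then show ?thesis using ideal.one_imp_carrier[OF L(1)] by simp
    next
      case False
      then show ?thesis using max[of L] L K(2) by (auto simp: A_def)
    qed
  qed
  then have "K = ker" using unique_maximal maximal_ker by blast
  then show ?thesis using K(2) by simp
qed

lemma Units_iff: "x \<in> carrier S \<Longrightarrow> x \<in> Units S \<longleftrightarrow> \<pi> x \<noteq> \<zero>\<^bsub>k\<^esub>"
proof
  assume x: "x \<in> carrier S" and "x \<in> Units S"
  then have "x \<otimes> inv x = \<one>" "inv x \<in> carrier S" by simp_all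
  then have "\<pi> x \<otimes>\<^bsub>k\<^esub> \<pi> (inv x) = \<one>\<^bsub>k\<^esub>" using pi_simps(2)[OF x, of "inv x"] by simp
  then show "\<pi> x \<noteq> \<zero>\<^bsub>k\<^esub>" using \<open>inv x \<in> carrier S\<close> by auto
next
  assume x: "x \<in> carrier S" and nz: "\<pi> x \<noteq> \<zero>\<^bsub>k\<^esub>"
  have "\<one> \<in> PIdl x"
  proof (rule ccontr)
    assume "\<one> \<notin> PIdl x"
    then have "PIdl x \<subseteq> ker" by (rule proper_ideal_subset_ker[OF cgenideal_ideal[OF x]])
    then show False using cgenideal_self[OF x] nz by (auto simp: ker_def)
  qed
  then obtain y where "y \<in> carrier S" "\<one> = y \<otimes> x" by (auto simp: cgenideal_def)
  then show "x \<in> Units S" using x m_comm by (auto simp: Units_def)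
qed

lemma not_in_ker_Units: "x \<in> carrier S \<Longrightarrow> x \<notin> ker \<Longrightarrow> x \<in> Units S"
  using Units_iff by (simp add: ker_def)

lemma ker_carrier: "x \<in> ker \<Longrightarrow> x \<in> carrier S"
  by (simp add: ker_def)

text \<open>Elements outside \<open>ker\<close> are units, so \<open>x\<close> is a nonzerodivisor
  on all of \<open>S\<close>. Then every nonzero element is a unit times a power of
  \<open>x\<close>, which makes \<open>S\<close> a domain and makes every nonzero ideal generated by
  the least power of \<open>x\<close> in it.\<close>

lemma discrete_valuation_domainI:
  assumes nz: "ker \<noteq> {\<zero>}" and x: "x \<in> ker" "\<And>y. y \<in> ker \<Longrightarrow> \<exists>r\<in>carrier S. y = r \<otimes> x"
    and reg: "\<And>a. a \<in> ker \<Longrightarrow> a \<otimes> x = \<zero> \<Longrightarrow> a = \<zero>"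
  shows "discrete_valuation_domain S"
proof -
  have xc: "x \<in> carrier S" using x(1) by (rule ker_carrier)
  have x0: "x \<noteq> \<zero>"
  proof
    assume "x = \<zero>"
    then have "y = \<zero>" if "y \<in> ker" for y using x(2)[OF that] by auto
    moreover have "\<zero> \<in> ker" by (simp add: ker_def)
    ultimately show False using nz by blast
  qed
  have unit_cancel: "a = \<zero>" if "u \<in> Units S" "a \<in> carrier S" "u \<otimes> a = \<zero>" for u a
  proof -
    have "inv u \<otimes> (u \<otimes> a) = (inv u \<otimes> u) \<otimes> a"
      using that(1,2) by (intro m_assoc[symmetric]) (auto simp: Units_closed)
    then have "a = inv u \<otimes> (u \<otimes> a)" using that(1,2) by simp
    then show ?thesis using that by simp
  qed
  have reg': "a = \<zero>" if "a \<in> carrier S" "a \<otimes> x = \<zero>" for a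
    using reg[OF _ that(2)] unit_cancel[OF not_in_ker_Units[OF that(1)] xc that(2)] x0 by blast
  have pow_reg: "a = \<zero>" if "a \<in> carrier S" "a \<otimes> x [^] (n::nat) = \<zero>" for a n
    using that
  proof (induction n arbitrary: a)
    case (Suc n)
    have "(a \<otimes> x [^] n) \<otimes> x = \<zero>" using Suc.prems xc by (simp add: m_assoc)
    from reg'[OF _ this] have "a \<otimes> x [^] n = \<zero>" using Suc.prems(1) xc by simp
    then show ?case by (rule Suc.IH[OF Suc.prems(1)])
  qed simp
  have form: "\<exists>u\<in>Units S. \<exists>n::nat. s = u \<otimes> x [^] n" if s: "s \<in> carrier S" "s \<noteq> \<zero>" for s
  proof (rule ccontr)
    assume no: "\<not> ?thesis"
    \<comment> \<open>In place of Krull's intersection theorem: among the counterexamples take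
      \<open>b\<close> with maximal principal ideal. It is a nonunit, so b = r x, and
      \<open>r\<close> is again a counterexample. Maximality gives r = c b = c x r, and since 1 - c
      x is a unit, r = 0.\<close>
    define B where "B = {s \<in> carrier S. s \<noteq> \<zero> \<and> \<not> (\<exists>u\<in>Units S. \<exists>n::nat. s = u \<otimes> x [^] n)}"
    have "\<exists>M\<in>(\<lambda>s. PIdl s) ` B. \<forall>L\<in>(\<lambda>s. PIdl s) ` B. M \<subseteq> L \<longrightarrow> L = M"
    proof (rule subset_Zorn_nonempty)
      show "(\<lambda>s. PIdl s) ` B \<noteq> {}" using s no by (auto simp: B_def)
      fix C assume C: "C \<noteq> {}" "subset.chain ((\<lambda>s. PIdl s) ` B) C"
      have "subset.chain {I. ideal I S} C"
        using C(2) cgenideal_ideal by (auto simp: B_def subset.chain_def)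
      from ideal_chain_is_trivial[OF C(1) this] C(2) show "\<Union>C \<in> (\<lambda>s. PIdl s) ` B"
        by (auto simp: subset.chain_def)
    qed
    then obtain b where b: "b \<in> B" and max: "\<And>r. r \<in> B \<Longrightarrow> PIdl b \<subseteq> PIdl r \<Longrightarrow> PIdl r = PIdl b" by auto
    have bc: "b \<in> carrier S" "b \<noteq> \<zero>" using b by (auto simp: B_def)
    have "b \<notin> Units S"
    proof
      assume "b \<in> Units S"
      moreover have "b = b \<otimes> x [^] (0::nat)" using bc by simp
      ultimately show False using b unfolding B_def by blast
    qed
    then have "b \<in> ker" using not_in_ker_Units[OF bc(1)] by blast
    then obtain r where r: "r \<in> carrier S" "b = r \<otimes> x" using x(2) by blast
    have "r \<noteq> \<zero>" using bc r xc by auto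
    moreover have False if "u \<in> Units S" "r = u \<otimes> x [^] (n::nat)" for u n
    proof -
      have "b = u \<otimes> x [^] Suc n" using that r xc by (simp add: m_assoc Units_closed)
      then show False using b that(1) unfolding B_def by blast
    qed
    ultimately have rB: "r \<in> B" using r by (auto simp: B_def)
    have "PIdl b \<subseteq> PIdl r"
      using cgenideal_minimal[OF cgenideal_ideal[OF r(1)], of b] r xc m_comm
      by (auto simp: cgenideal_def)
    then have "r \<in> PIdl b" using max[OF rB] cgenideal_self[OF r(1)] by simp
    then obtain c where c: "c \<in> carrier S" "r = c \<otimes> b" by (auto simp: cgenideal_def)
    have "c \<otimes> x \<in> ker" using c(1) x(1) xc by (simp add: ker_def)
    then have "\<pi> (\<one> \<ominus> c \<otimes> x) = \<one>\<^bsub>k\<^esub>" using c(1) xc by (simp add: ker_def a_minus_def)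
    then have u: "\<one> \<ominus> c \<otimes> x \<in> Units S" using c(1) xc Units_iff[of "\<one> \<ominus> c \<otimes> x"] by simp
    have "(\<one> \<ominus> c \<otimes> x) \<otimes> r = r \<ominus> c \<otimes> (r \<otimes> x)"
      using c(1) xc r(1) by (simp add: a_minus_def l_distr l_minus) (simp add: m_ac)
    also have "\<dots> = \<zero>" using c r by (simp add: a_minus_def r_neg)
    finally have "r = \<zero>" using unit_cancel[OF u r(1)] by simp
    then show False using \<open>r \<noteq> \<zero>\<close> by simp
  qed
  have one_zero: "\<one> \<noteq> \<zero>" using pi_simps(4) by (metis k.one_not_zero pi_zero)
  have dom: "domain S"
  proof (rule domain.intro[OF cring_axioms], rule domain_axioms.intro)
    show "\<one> \<noteq> \<zero>" by (rule one_zero)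
    fix a b assume ab: "a \<otimes> b = \<zero>" "a \<in> carrier S" "b \<in> carrier S"
    show "a = \<zero> \<or> b = \<zero>"
    proof (rule ccontr)
      assume "\<not> (a = \<zero> \<or> b = \<zero>)"
      then obtain u n v m where u: "u \<in> Units S" "a = u \<otimes> x [^] (n::nat)"
        and v: "v \<in> Units S" "b = v \<otimes> x [^] (m::nat)"
        using form[of a] form[of b] ab(2,3) by blast
      have "(b \<otimes> u) \<otimes> x [^] n = \<zero>" using ab u v xc by (simp add: m_ac Units_closed)
      from pow_reg[OF _ this] have "b \<otimes> u = \<zero>" using ab(3) u(1) by (simp add: Units_closed)
      then have "u \<otimes> b = \<zero>" using ab u by (simp add: m_comm Units_closed)
      then have "b = \<zero>" by (rule unit_cancel[OF u(1) ab(3)])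
      then show False using \<open>\<not> (a = \<zero> \<or> b = \<zero>)\<close> by simp
    qed
  qed
  have gen: "\<exists>a\<in>carrier S. I = PIdl a" if I: "ideal I S" for I
  proof (cases "I = {\<zero>}")
    case True
    have "PIdl \<zero> = {\<zero>}" by (auto simp: cgenideal_def intro: exI[of _ \<zero>])
    then show ?thesis using True by (intro bexI[of _ \<zero>]) auto
  next
    case False
    interpret I: ideal I S by (rule I)
    have pow: "\<exists>u\<in>Units S. \<exists>n. s = u \<otimes> x [^] (n::nat) \<and> x [^] n \<in> I" if s: "s \<in> I" "s \<noteq> \<zero>" for s
    proof -
      obtain u n where u: "u \<in> Units S" "s = u \<otimes> x [^] (n::nat)" using form[of s] s I.Icarr by blast
      have "inv u \<otimes> s = x [^] n" using u xc by (simp add: m_assoc[symmetric] Units_closed)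
      then have "x [^] n \<in> I" using I.I_l_closed[OF s(1), of "inv u"] u(1) by simp
      then show ?thesis using u by blast
    qed
    define n where "n = (LEAST n::nat. x [^] n \<in> I)"
    have "\<exists>n::nat. x [^] n \<in> I" using False pow I.zero_closed by blast
    then have n: "x [^] n \<in> I" unfolding n_def by (rule LeastI_ex)
    have "I = PIdl (x [^] n)"
    proof
      show "PIdl (x [^] n) \<subseteq> I" by (rule cgenideal_minimal[OF I n])
      show "I \<subseteq> PIdl (x [^] n)"
      proof
        fix s assume s: "s \<in> I"
        show "s \<in> PIdl (x [^] n)"
        proof (cases "s = \<zero>")
          case True
          have "\<zero> = \<zero> \<otimes> x [^] n" using xc by simp
          then show ?thesis unfolding cgenideal_def using True by blast
        next
          case False
          from pow[OF s False] obtain u m where u: "u \<in> Units S" "s = u \<otimes> x [^] (m::nat)" "x [^] m \<in> I"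
            by blast
          have "n \<le> m" unfolding n_def by (rule Least_le) (rule u(3))
          then have "x [^] m = x [^] (m - n) \<otimes> x [^] n" using xc by (simp add: nat_pow_mult)
          then have "s = (u \<otimes> x [^] (m - n)) \<otimes> x [^] n" using u xc by (simp add: m_assoc Units_closed)
          then show ?thesis unfolding cgenideal_def using u xc by (blast intro: Units_closed m_closed nat_pow_closed)
        qed
      qed
    qed
    then show ?thesis using xc by blast
  qed
  have "principal_domain S" by (intro principal_domain.intro principal_domain_axioms.intro dom gen)
  moreover have "local_ring S"
    using cring_axioms noetherian_ring_axioms unique_maximal by (simp add: local_ring_def)
  moreover have "\<not> field S"
  proof
    assume "field S"
    then have "x \<in> Units S" using field.field_Units[of S] xc x0 by simp
    then show False using Units_iff[OF xc] x(1) by (simp add: ker_def)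
  qed
  ultimately show ?thesis by (simp add: discrete_valuation_domain_def)
qed

lemma ker_annihilator:
  assumes "ker \<noteq> {\<zero>}" "\<not> discrete_valuation_domain S" "x \<in> ker"
    "\<And>y. y \<in> ker \<Longrightarrow> \<exists>r\<in>carrier S. y = r \<otimes> x"
  shows "\<exists>a\<in>ker. a \<noteq> \<zero> \<and> a \<otimes> x = \<zero>"
  using discrete_valuation_domainI[OF assms(1,3,4)] assms(2) by blast

lemma ker_nonzero:
  assumes "\<pi> \<notin> ring_iso S k" shows "ker \<noteq> {\<zero>}"
proof
  assume ker: "ker = {\<zero>}"
  have "inj_on \<pi> (carrier S)"
  proof (rule inj_onI)
    fix a b assume ab: "a \<in> carrier S" "b \<in> carrier S" "\<pi> a = \<pi> b"
    then have "a \<ominus> b \<in> ker" by (simp add: ker_def a_minus_def k.r_neg)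
    then have "a \<ominus> b = \<zero>" using ker by simp
    then show "a = b" using ab by simp
  qed
  then show False using assms pi_hom pi_surj by (simp add: ring_iso_def bij_betw_def)
qed

end

section \<open>The fiber product\<close>

lemma fiber_product_simps [simp]:
  "(s, t) \<in> carrier (fiber_product S T f g) \<longleftrightarrow> s \<in> carrier S \<and> t \<in> carrier T \<and> f s = g t"
  "(s, t) \<otimes>\<^bsub>fiber_product S T f g\<^esub> (s', t') = (s \<otimes>\<^bsub>S\<^esub> s', t \<otimes>\<^bsub>T\<^esub> t')"
  "(s, t) \<oplus>\<^bsub>fiber_product S T f g\<^esub> (s', t') = (s \<oplus>\<^bsub>S\<^esub> s', t \<oplus>\<^bsub>T\<^esub> t')"
  "\<one>\<^bsub>fiber_product S T f g\<^esub> = (\<one>\<^bsub>S\<^esub>, \<one>\<^bsub>T\<^esub>)"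
  "\<zero>\<^bsub>fiber_product S T f g\<^esub> = (\<zero>\<^bsub>S\<^esub>, \<zero>\<^bsub>T\<^esub>)"
  by (simp_all add: fiber_product_def RDirProd_def DirProd_def monoid.defs)

locale fiber_product_ring = S: residue_map S k \<pi>S + T: residue_map T k \<pi>T
  for S :: "'s ring" and T :: "'t ring" and k :: "'k ring" and \<pi>S \<pi>T
begin

abbreviation R where "R \<equiv> fiber_product S T \<pi>S \<pi>T"

lemma cring: "cring R"
proof (rule cringI)
  show "abelian_group R"
  proof (rule abelian_groupI)
    fix x assume x: "x \<in> carrier R"
    obtain s t where "x = (s, t)" by (cases x)
    then show "\<exists>y\<in>carrier R. y \<oplus>\<^bsub>R\<^esub> x = \<zero>\<^bsub>R\<^esub>"
      using x by (intro bexI[of _ "(\<ominus>\<^bsub>S\<^esub> s, \<ominus>\<^bsub>T\<^esub> t)"]) (auto simp: S.l_neg T.l_neg)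
  qed (auto simp: S.a_ac T.a_ac)
  show "comm_monoid R"
    by (rule comm_monoidI) (auto simp: S.m_ac T.m_ac)
qed (auto simp: S.l_distr T.l_distr)

sublocale R: cring R by (rule cring)

lemma lift_S: "s \<in> carrier S \<Longrightarrow> \<exists>t\<in>carrier T. (s, t) \<in> carrier R"
  using T.pi_surj S.pi_simps(1)[of s] by (metis fiber_product_simps(1) imageE)

lemma lift_T: "t \<in> carrier T \<Longrightarrow> \<exists>s\<in>carrier S. (s, t) \<in> carrier R"
  using S.pi_surj T.pi_simps(1)[of t] by (metis fiber_product_simps(1) imageE)

lemma minus_eq: "(s, t) \<in> carrier R \<Longrightarrow> \<ominus>\<^bsub>R\<^esub> (s, t) = (\<ominus>\<^bsub>S\<^esub> s, \<ominus>\<^bsub>T\<^esub> t)"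
  by (rule R.minus_equality) (auto simp: S.l_neg T.l_neg)

lemma ideal_projection:
  assumes "ideal I R" shows "ideal {s. \<exists>t. (s, t) \<in> I} S"
proof -
  interpret ideal I R by fact
  show ?thesis
  proof (rule S.cring_idealI)
    show "{s. \<exists>t. (s, t) \<in> I} \<subseteq> carrier S" using Icarr by fastforce
    show "\<zero>\<^bsub>S\<^esub> \<in> {s. \<exists>t. (s, t) \<in> I}" using zero_closed by auto
  next
    fix a b assume "a \<in> {s. \<exists>t. (s, t) \<in> I}" "b \<in> {s. \<exists>t. (s, t) \<in> I}"
    then obtain t u where "(a, t) \<in> I" "(b, u) \<in> I" by blast
    from a_closed[OF this] show "a \<oplus>\<^bsub>S\<^esub> b \<in> {s. \<exists>t. (s, t) \<in> I}" by auto
  next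
    fix r a assume r: "r \<in> carrier S" and "a \<in> {s. \<exists>t. (s, t) \<in> I}"
    then obtain t where t: "(a, t) \<in> I" by blast
    from lift_S[OF r] obtain u where "(r, u) \<in> carrier R" by blast
    from I_l_closed[OF t this] show "r \<otimes>\<^bsub>S\<^esub> a \<in> {s. \<exists>t. (s, t) \<in> I}" by auto
  qed
qed

lemma ideal_section:
  assumes "ideal I R" shows "ideal {t. (\<zero>\<^bsub>S\<^esub>, t) \<in> I} T"
proof -
  interpret ideal I R by fact
  show ?thesis
  proof (rule T.cring_idealI)
    show "{t. (\<zero>\<^bsub>S\<^esub>, t) \<in> I} \<subseteq> carrier T" using Icarr by fastforce
    show "\<zero>\<^bsub>T\<^esub> \<in> {t. (\<zero>\<^bsub>S\<^esub>, t) \<in> I}" using zero_closed by auto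
  next
    fix a b assume "a \<in> {t. (\<zero>\<^bsub>S\<^esub>, t) \<in> I}" "b \<in> {t. (\<zero>\<^bsub>S\<^esub>, t) \<in> I}"
    then have "(\<zero>\<^bsub>S\<^esub>, a) \<in> I" "(\<zero>\<^bsub>S\<^esub>, b) \<in> I" by auto
    from a_closed[OF this] show "a \<oplus>\<^bsub>T\<^esub> b \<in> {t. (\<zero>\<^bsub>S\<^esub>, t) \<in> I}" by simp
  next
    fix r a assume r: "r \<in> carrier T" and "a \<in> {t. (\<zero>\<^bsub>S\<^esub>, t) \<in> I}"
    then have a: "(\<zero>\<^bsub>S\<^esub>, a) \<in> I" by blast
    from lift_T[OF r] obtain u where u: "u \<in> carrier S" "(u, r) \<in> carrier R" by blast
    from I_l_closed[OF a u(2)] u(1) show "r \<otimes>\<^bsub>T\<^esub> a \<in> {t. (\<zero>\<^bsub>S\<^esub>, t) \<in> I}" by simp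
  qed
qed

text \<open>Generators of the projection of \<open>I\<close> to \<open>S\<close>, lifted to
  \<open>I\<close>, and generators of the part of \<open>I\<close> with first component 0 suffice:
  subtracting an element with the same first component leads into that part. Both sets are ideals
  because the fiber product maps onto \<open>S\<close> and onto \<open>T\<close>.\<close>

lemma noetherian: "noetherian_ring R"
proof (rule R.noetherian_ringI)
  fix I assume I: "ideal I R"
  interpret I: ideal I R by (rule I)
  from S.finetely_gen[OF ideal_projection[OF I]] obtain A where A: "A \<subseteq> carrier S" "finite A"
    "{s. \<exists>t. (s, t) \<in> I} = Idl\<^bsub>S\<^esub> A" by blast
  from T.finetely_gen[OF ideal_section[OF I]] obtain B where B: "B \<subseteq> carrier T" "finite B"
    "{t. (\<zero>\<^bsub>S\<^esub>, t) \<in> I} = Idl\<^bsub>T\<^esub> B" by blast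
  have "\<exists>t. (a, t) \<in> I" if "a \<in> A" for a
    using S.genideal_self[OF A(1)] that unfolding A(3)[symmetric] by blast
  then obtain h where h: "\<And>a. a \<in> A \<Longrightarrow> (a, h a) \<in> I" by metis
  have b: "(\<zero>\<^bsub>S\<^esub>, b) \<in> I" if "b \<in> B" for b
    using T.genideal_self[OF B(1)] that unfolding B(3)[symmetric] by blast
  define C where "C = (\<lambda>a. (a, h a)) ` A \<union> (\<lambda>b. (\<zero>\<^bsub>S\<^esub>, b)) ` B"
  have CI: "C \<subseteq> I" using h b by (auto simp: C_def)
  then have Cc: "C \<subseteq> carrier R" using I.Icarr by blast
  have D: "ideal (Idl\<^bsub>R\<^esub> C) R" by (rule R.genideal_ideal[OF Cc])
  interpret D: ideal "Idl\<^bsub>R\<^esub> C" R by (rule D)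
  have CD: "C \<subseteq> Idl\<^bsub>R\<^esub> C" by (rule R.genideal_self[OF Cc])
  have DI: "Idl\<^bsub>R\<^esub> C \<subseteq> I" by (rule R.genideal_minimal[OF I CI])
  have "A \<subseteq> {s. \<exists>t. (s, t) \<in> Idl\<^bsub>R\<^esub> C}" using CD by (auto simp: C_def)
  then have AD: "{s. \<exists>t. (s, t) \<in> I} \<subseteq> {s. \<exists>t. (s, t) \<in> Idl\<^bsub>R\<^esub> C}"
    unfolding A(3) by (rule S.genideal_minimal[OF ideal_projection[OF D]])
  have "B \<subseteq> {t. (\<zero>\<^bsub>S\<^esub>, t) \<in> Idl\<^bsub>R\<^esub> C}" using CD by (auto simp: C_def)
  then have BD: "{t. (\<zero>\<^bsub>S\<^esub>, t) \<in> I} \<subseteq> {t. (\<zero>\<^bsub>S\<^esub>, t) \<in> Idl\<^bsub>R\<^esub> C}"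
    unfolding B(3) by (rule T.genideal_minimal[OF ideal_section[OF D]])
  have "I \<subseteq> Idl\<^bsub>R\<^esub> C"
  proof
    fix x assume x: "x \<in> I"
    obtain s t where st: "x = (s, t)" by (cases x)
    obtain t' where t': "(s, t') \<in> Idl\<^bsub>R\<^esub> C" using AD x st by blast
    have c: "s \<in> carrier S" "t \<in> carrier T" "t' \<in> carrier T"
      using I.Icarr[OF x] D.Icarr[OF t'] st by auto
    have "x \<oplus>\<^bsub>R\<^esub> \<ominus>\<^bsub>R\<^esub> (s, t') \<in> I"
      using x t' DI by (intro I.a_closed I.a_inv_closed) auto
    then have "(\<zero>\<^bsub>S\<^esub>, t \<oplus>\<^bsub>T\<^esub> \<ominus>\<^bsub>T\<^esub> t') \<in> I"
      using st c minus_eq[OF D.Icarr[OF t']] by (simp add: S.r_neg)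
    then have "(\<zero>\<^bsub>S\<^esub>, t \<oplus>\<^bsub>T\<^esub> \<ominus>\<^bsub>T\<^esub> t') \<in> Idl\<^bsub>R\<^esub> C" using BD by blast
    from D.a_closed[OF this t'] show "x \<in> Idl\<^bsub>R\<^esub> C"
      using st c by (simp add: T.a_assoc T.l_neg)
  qed
  then show "\<exists>A\<subseteq>carrier R. finite A \<and> I = Idl\<^bsub>R\<^esub> A"
    using DI Cc A(2) B(2) by (intro exI[of _ C]) (auto simp: C_def)
qed

text \<open>The inverses of the two components have the same image in \<open>k\<close>, by
  uniqueness of inverses there, so they form an element of the fiber product.\<close>

lemma Units_R:
  assumes "(s, t) \<in> carrier R" shows "(s, t) \<in> Units R \<longleftrightarrow> \<pi>S s \<noteq> \<zero>\<^bsub>k\<^esub>"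
proof
  assume "(s, t) \<in> Units R"
  then obtain y where "y \<in> carrier R" "(s, t) \<otimes>\<^bsub>R\<^esub> y = \<one>\<^bsub>R\<^esub>" by (auto simp: Units_def)
  then obtain s' t' where "s' \<in> carrier S" "s \<otimes>\<^bsub>S\<^esub> s' = \<one>\<^bsub>S\<^esub>" by (cases y) auto
  then have "\<pi>S s \<otimes>\<^bsub>k\<^esub> \<pi>S s' = \<one>\<^bsub>k\<^esub>" using S.pi_simps(2)[of s s'] assms by simp
  then show "\<pi>S s \<noteq> \<zero>\<^bsub>k\<^esub>" using \<open>s' \<in> carrier S\<close> by auto
next
  assume nz: "\<pi>S s \<noteq> \<zero>\<^bsub>k\<^esub>"
  have st: "s \<in> carrier S" "t \<in> carrier T" "\<pi>S s = \<pi>T t" using assms by auto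
  have s: "s \<in> Units S" using S.Units_iff[OF st(1)] nz by simp
  have t: "t \<in> Units T" using T.Units_iff[OF st(2)] nz st(3) by simp
  have 1: "\<pi>S (inv\<^bsub>S\<^esub> s) \<otimes>\<^bsub>k\<^esub> \<pi>S s = \<one>\<^bsub>k\<^esub>"
    using S.pi_simps(2)[of "inv\<^bsub>S\<^esub> s" s] s st by (simp del: S.pi_simps(2))
  have 2: "\<pi>S s \<otimes>\<^bsub>k\<^esub> \<pi>T (inv\<^bsub>T\<^esub> t) = \<one>\<^bsub>k\<^esub>"
    using T.pi_simps(2)[of t "inv\<^bsub>T\<^esub> t"] t st by (simp del: T.pi_simps(2))
  have "\<pi>S (inv\<^bsub>S\<^esub> s) = \<pi>T (inv\<^bsub>T\<^esub> t)"
    using S.k.inv_unique[OF 1 2] s t st by simp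
  then have "(inv\<^bsub>S\<^esub> s, inv\<^bsub>T\<^esub> t) \<in> carrier R" using s t by simp
  moreover have "(inv\<^bsub>S\<^esub> s, inv\<^bsub>T\<^esub> t) \<otimes>\<^bsub>R\<^esub> (s, t) = \<one>\<^bsub>R\<^esub>" using s t by simp
  moreover have "(s, t) \<otimes>\<^bsub>R\<^esub> (inv\<^bsub>S\<^esub> s, inv\<^bsub>T\<^esub> t) = \<one>\<^bsub>R\<^esub>" using s t by simp
  ultimately show "(s, t) \<in> Units R" using assms unfolding Units_def by blast
qed

definition I where "I = (\<lambda>s. (s, \<zero>\<^bsub>T\<^esub>)) ` S.ker"

definition J where "J = (\<lambda>t. (\<zero>\<^bsub>S\<^esub>, t)) ` T.ker"

text \<open>An element of the fiber product acts on \<open>I\<close> only through its first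
  component. So if \<open>I\<close> is principal over \<open>R\<close>, then \<open>S.ker\<close> is
  principal over \<open>S\<close>, and the annihilator found in \<open>S\<close> can be used in
  \<open>I\<close>; the same holds for \<open>J\<close> and \<open>T\<close>.\<close>

lemma split_local_ring:
  assumes iso: "\<pi>S \<notin> ring_iso S k" "\<pi>T \<notin> ring_iso T k"
    and nd: "\<not> discrete_valuation_domain S" "\<not> discrete_valuation_domain T"
  shows "split_local_ring R I J"
proof (intro split_local_ring.intro noetherian_cring.intro split_local_ring_axioms.intro cring noetherian)
  have ker_S: "s \<in> S.ker \<longleftrightarrow> s \<in> carrier S \<and> \<pi>S s = \<zero>\<^bsub>k\<^esub>" for s by (simp add: S.ker_def)
  have ker_T: "t \<in> T.ker \<longleftrightarrow> t \<in> carrier T \<and> \<pi>T t = \<zero>\<^bsub>k\<^esub>" for t by (simp add: T.ker_def)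
  show "ideal I R"
    by (rule R.cring_idealI) (auto simp: I_def ker_S image_iff)
  show "ideal J R"
    by (rule R.cring_idealI) (auto simp: J_def ker_T image_iff)
  show "I \<inter> J = {\<zero>\<^bsub>R\<^esub>}" by (auto simp: I_def J_def ker_S ker_T)
  show "\<exists>a\<in>I. \<exists>b\<in>J. r = a \<oplus>\<^bsub>R\<^esub> b" if r: "r \<in> carrier R" "r \<notin> Units R" for r
  proof -
    obtain s t where st: "r = (s, t)" by (cases r)
    then have "\<pi>S s = \<zero>\<^bsub>k\<^esub>" using Units_R r by blast
    then have "(s, \<zero>\<^bsub>T\<^esub>) \<in> I" "(\<zero>\<^bsub>S\<^esub>, t) \<in> J" using r st by (auto simp: I_def J_def ker_S ker_T)
    moreover have "r = (s, \<zero>\<^bsub>T\<^esub>) \<oplus>\<^bsub>R\<^esub> (\<zero>\<^bsub>S\<^esub>, t)" using r st by simp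
    ultimately show ?thesis by blast
  qed
  show "a \<oplus>\<^bsub>R\<^esub> b \<notin> Units R" if "a \<in> I" "b \<in> J" for a b
    using that Units_R by (auto simp: I_def J_def ker_S ker_T)
  obtain s where s: "s \<in> S.ker" "s \<noteq> \<zero>\<^bsub>S\<^esub>" 
  proof -
    have "\<zero>\<^bsub>S\<^esub> \<in> S.ker" by (simp add: ker_S)
    then show ?thesis using S.ker_nonzero[OF iso(1)] that by blast
  qed
  then have "(s, \<zero>\<^bsub>T\<^esub>) \<in> I" by (auto simp: I_def)
  then show "I \<noteq> {\<zero>\<^bsub>R\<^esub>}" using s(2) by auto
  obtain t where t: "t \<in> T.ker" "t \<noteq> \<zero>\<^bsub>T\<^esub>" 
  proof -
    have "\<zero>\<^bsub>T\<^esub> \<in> T.ker" by (simp add: ker_T)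
    then show ?thesis using T.ker_nonzero[OF iso(2)] that by blast
  qed
  then have "(\<zero>\<^bsub>S\<^esub>, t) \<in> J" by (auto simp: J_def)
  then show "J \<noteq> {\<zero>\<^bsub>R\<^esub>}" using t(2) by auto
  show "\<exists>a\<in>I. a \<noteq> \<zero>\<^bsub>R\<^esub> \<and> a \<otimes>\<^bsub>R\<^esub> x = \<zero>\<^bsub>R\<^esub>"
    if x: "x \<in> I" "\<And>y. y \<in> I \<Longrightarrow> \<exists>r\<in>carrier R. y = r \<otimes>\<^bsub>R\<^esub> x" for x
  proof -
    obtain x0 where x0: "x = (x0, \<zero>\<^bsub>T\<^esub>)" "x0 \<in> S.ker" using x(1) by (auto simp: I_def)
    have "\<exists>r\<in>carrier S. y = r \<otimes>\<^bsub>S\<^esub> x0" if "y \<in> S.ker" for y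
    proof -
      have "(y, \<zero>\<^bsub>T\<^esub>) \<in> I" using that by (auto simp: I_def)
      from x(2)[OF this] obtain r where "r \<in> carrier R" "(y, \<zero>\<^bsub>T\<^esub>) = r \<otimes>\<^bsub>R\<^esub> x" by blast
      then show ?thesis using x0(1) by (cases r) auto
    qed
    from S.ker_annihilator[OF S.ker_nonzero[OF iso(1)] nd(1) x0(2) this]
    show ?thesis using x0(1) by (auto simp: I_def)
  qed
  show "\<exists>a\<in>J. a \<noteq> \<zero>\<^bsub>R\<^esub> \<and> a \<otimes>\<^bsub>R\<^esub> x = \<zero>\<^bsub>R\<^esub>"
    if x: "x \<in> J" "\<And>y. y \<in> J \<Longrightarrow> \<exists>r\<in>carrier R. y = r \<otimes>\<^bsub>R\<^esub> x" for x
  proof -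
    obtain x0 where x0: "x = (\<zero>\<^bsub>S\<^esub>, x0)" "x0 \<in> T.ker" using x(1) by (auto simp: J_def)
    have "\<exists>r\<in>carrier T. y = r \<otimes>\<^bsub>T\<^esub> x0" if "y \<in> T.ker" for y
    proof -
      have "(\<zero>\<^bsub>S\<^esub>, y) \<in> J" using that by (auto simp: J_def)
      from x(2)[OF this] obtain r where "r \<in> carrier R" "(\<zero>\<^bsub>S\<^esub>, y) = r \<otimes>\<^bsub>R\<^esub> x" by blast
      then show ?thesis using x0(1) by (cases r) auto
    qed
    from T.ker_annihilator[OF T.ker_nonzero[OF iso(2)] nd(2) x0(2) this]
    show ?thesis using x0(1) by (auto simp: J_def)
  qed
qed

end

text \<open>The condition in degree n + 1 concerns the term with index n + 2 of the minimal
  resolution, which is 0.\<close>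

lemma (in minimal_resolution) tor_vanishes_syz_1_trivial:
  assumes "syz 1 = {\<lambda>_. \<zero>}"
  shows "coord_resolution.tor_vanishes R (\<lambda>n. free_module R {..<rank n}) diff (Suc n) p K"
proof -
  interpret C: coord_resolution R M "\<lambda>n. free_module R {..<rank n}" diff aug by (rule coord_resolution)
  show ?thesis
    unfolding C.tor_vanishes_def tensor_exact_def
  proof (intro ballI impI)
    fix x assume x: "x \<in> tup (free_module R {..<rank (Suc (Suc n))}) p"
    have r0: "rank (Suc (Suc n)) = 0" by (rule syz_1_trivial[OF assms])
    have "x l = (\<lambda>_. \<zero>)" for l
      using module.tupD[OF free_module x, of l] r0 by (auto simp: free_module_carrier)
    then have x0: "x = (\<lambda>_. \<zero>\<^bsub>free_module R {..<rank (Suc (Suc n))}\<^esub>)" by (intro ext) simp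
    interpret d: two_modules R "free_module R {..<rank (Suc (Suc (Suc n)))}" "free_module R {..<rank (Suc (Suc n))}"
      "diff (Suc (Suc n))"
      by (intro two_modules.intro two_modules_axioms.intro free_module diff_hom)
    show "\<exists>u\<in>tup (free_module R {..<rank (Suc (Suc (Suc n)))}) p.
        \<exists>w\<in>dot_span (free_module R {..<rank (Suc (Suc n))}) K.
        x = (\<lambda>l. diff (Suc (Suc n)) (u l) \<oplus>\<^bsub>free_module R {..<rank (Suc (Suc n))}\<^esub> w l)"
      by (intro bexI[OF _ d.M.tup_zero] bexI[OF _ dot_span.zero])
        (simp only: x0 d.f_zero d.N.M.r_zero[OF d.N.M.zero_closed])
  qed
qed

theorem theorem1p16:
  fixes S :: "'s ring" and T :: "'t ring" and k :: "'k ring"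
    and \<pi>S :: "'s \<Rightarrow> 'k" and \<pi>T :: "'t \<Rightarrow> 'k"
    and M :: "('s \<times> 't, 'm) module" and N :: "('s \<times> 't, 'n) module"
    and m :: nat
  defines "R \<equiv> fiber_product S T \<pi>S \<pi>T"
  assumes "local_ring S" and "local_ring T" and "field k"
    and "\<pi>S \<in> ring_hom S k" and "\<pi>S ` carrier S = carrier k"
    and "\<pi>T \<in> ring_hom T k" and "\<pi>T ` carrier T = carrier k"
    and "\<pi>S \<notin> ring_iso S k" and "\<pi>T \<notin> ring_iso T k"
    and "module R M" and "fin_gen R M"
    and "module R N" and "fin_gen R N"
    and "\<not> discrete_valuation_domain S" and "\<not> discrete_valuation_domain T"
    and "m \<ge> 6" and "trivial_group (Tor R m M N)"
  shows "(proj_dim R M \<le> 1 \<or> proj_dim R N \<le> 1) \<and> (\<forall>i\<ge>2. trivial_group (Tor R i M N))"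
proof -
  have "residue_map S k \<pi>S" "residue_map T k \<pi>T"
    using assms by (auto simp: local_ring_def intro!: residue_map.intro residue_map_axioms.intro)
  then interpret fiber_product_ring S T k \<pi>S \<pi>T by (rule fiber_product_ring.intro)
  have split: "split_local_ring R I J"
    unfolding R_def by (rule split_local_ring[OF assms(9,10,15,16)])
  interpret L: split_local_ring R I J by (rule split)
  obtain gM qM where mM: "minimal_resolution R M gM qM"
    using minimal_resolution_exists[OF L.noetherian_cring_axioms assms(11,12) L.nontrivial] by blast
  obtain gN qN where mN: "minimal_resolution R N gN qN"
    using minimal_resolution_exists[OF L.noetherian_cring_axioms assms(13,14) L.nontrivial] by blast
  interpret M: split_minimal_resolution R I J M gM qM
    by (intro split_minimal_resolution.intro split mM)
  interpret N: minimal_resolution R N gN qN by (rule mN)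
  obtain P d e where P: "chosen_resolution R M = (P, d)" "coord_resolution R M P d e"
    using M.chosen_resolution by blast
  interpret P: split_resolution R I J M P d e
    by (intro split_resolution.intro split P(2))
  have Tor: "trivial_group (Tor R (Suc i) M N) \<longleftrightarrow> P.tor_vanishes i qN N.ker_aug" for i
    using N.trivial_tensor_homology_iff_tor_vanishes[OF P(2)] by (simp add: Tor_def P(1))
  have gens: "gens R qN N.ker_aug (N.mat 0) (N.rank 1)" using N.gens_syz[of 0] by simp
  have syz: "N.syz 1 = rels R (N.mat 0) (N.rank 1)" using N.syz_Suc[of 0] by simp
  show ?thesis
  proof (cases "N.syz 1 = {\<lambda>_. \<zero>\<^bsub>R\<^esub>}")
    case True
    have "trivial_group (Tor R i M N)" if "i \<ge> 2" for i
    proof -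
      \<comment> \<open>Tor in degree \<open>i\<close> is \<open>tor_vanishes\<close> at i - 1, a
        successor because i is at least 2; one shift leads to the second syzygy of \<open>N\<close>,
        which is 0 here.\<close>
      have "P.tor_vanishes (Suc (i - 2)) qN N.ker_aug"
        using P.tor_vanishes_Suc[OF gens] P.tor_vanishes_trivial True syz by simp
      moreover have "i = Suc (Suc (i - 2))" using that by simp
      ultimately show ?thesis using Tor by metis
    qed
    then show ?thesis using N.proj_dim_le_1[OF True] by blast
  next
    case False
    have m: "m = Suc (m - 1)" "m - 1 \<ge> 5" using assms(17) by simp_all
    have v: "P.tor_vanishes (m - 1) qN N.ker_aug" using assms(18) Tor m(1) by metis
    have "P.tor_vanishes 1 1 (L.ideal_tup I 1) \<and> P.tor_vanishes 1 1 (L.ideal_tup J 1)"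
    proof (rule P.ideals_from_syzygy[OF gens _ _ m(2) v])
      show "r j \<notin> Units R" if "r \<in> rels R (N.mat 0) (N.rank 1)" for r j
        using N.syz_minimal[of r 0 j] that syz by simp
      show "rels R (N.mat 0) (N.rank 1) \<noteq> {\<lambda>_. \<zero>\<^bsub>R\<^esub>}" using False syz by simp
    qed
    \<comment> \<open>The vanishing obtained for the chosen resolution is moved to the minimal one,
      where \<open>syz_1_eq_0\<close> applies; afterwards the trivial vanishing for the minimal
      resolution is moved back to the one that defines \<open>Tor\<close>.\<close>
    note transfer = tor_vanishes_independent[OF L.noetherian_cring_axioms]
    have 1: "M.syz 1 = {\<lambda>_. \<zero>\<^bsub>R\<^esub>}"
      using \<open>P.tor_vanishes 1 1 (L.ideal_tup I 1) \<and> P.tor_vanishes 1 1 (L.ideal_tup J 1)\<close>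
        transfer[OF P(2) M.coord_resolution] L.tup_submodule_ideal_tup[OF L.I.ideal_axioms]
        L.tup_submodule_ideal_tup[OF L.J.ideal_axioms]
      by (intro M.syz_1_eq_0) blast+
    have "trivial_group (Tor R i M N)" if "i \<ge> 2" for i
    proof -
      have "P.tor_vanishes (Suc (i - 2)) qN N.ker_aug"
        by (rule transfer[OF M.coord_resolution P(2) N.tup_submodule_ker_aug M.tor_vanishes_syz_1_trivial[OF 1]])
      moreover have "i = Suc (Suc (i - 2))" using that by simp
      ultimately show ?thesis using Tor by metis
    qed
    then show ?thesis using M.proj_dim_le_1[OF 1] by blast
  qed
qed

end
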